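(* Let $\alpha\in(1/2,1)$ and $C$ be constants and let $G$ be a typical hyperbolic random graph from $\mathcal G(n,\alpha,C)$ with maximum degree $\Delta$. 1. For any constant $\varepsilon>0$ there exists a constant $c>0$ such that RCTID executed on $G$ with $\varepsilon\cdot\Delta$ colours terminates after exactly 2 rounds with probability $1-O(n^{-c})$. 2. RCTID executed on $G$ with $O(\log^{-3}(n)\cdot\Delta)$ colours never terminates w.e.h.p.
   Context: Hyperbolic random graph $\mathcal G(n,\alpha,C)$: for constants $\alpha\in(1/2,1)$ and $C$, set $R=2\log n+C$ (natural logarithm). Let $\mathcal D_R$ be the disk of radius $R$ around the origin in the hyperbolic plane of curvature $-1$, with points in polar coordinates $(r,\varphi)$. The hyperbolic distance satisfies $\cosh d(x,y)=\cosh r(x)\cosh r(y)-\sinh r(x)\sinh r(y)\cos(\varphi(x)-\varphi(y))$. The vertex set $V$ is a Poisson point process on $\mathcal D_R$ with intensity $n\rho(r)$ with respect to $dr\,d\varphi$, where $\rho(r)=\frac{\alpha\sinh(\alpha r)}{2\pi(\cosh(\alpha R)-1)}$. Vertices are adjacent iff their hyperbolic distance is at most $R$. Asymptotics are as $n\to\infty$. An event holds a.a.s. if it has probability $1-o(1)$, and w.e.h.p. if it has probability $1-n^{-\omega(1)}$. A typical hyperbolic random graph is one having every property that holds a.a.s. for $G\sim\mathcal G(n,\alpha,C)$. Algorithmic probabilities refer to the algorithm's randomness, conditioned on the input being typical. Random colour trial with ID priority (RCTID) with colour space $\Psi$: vertices carry distinct IDs. In each round, every uncoloured vertex $u$ picks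 a candidate colour uniformly at random from its palette. The palette is $\Psi$ minus the colours permanently assigned to neighbours of $u$ in earlier rounds. The vertex $u$ permanently adopts its candidate colour iff no neighbour with a smaller ID picks the same candidate colour in that round. Termination after round $t$ means all vertices are coloured. Never terminating means some vertex stays uncoloured forever.
   Formalization: In part 2 the distinct IDs form a uniformly random order independent of the graph, and "w.e.h.p." is over IDs and candidate colours; for arbitrary IDs part 2 fails (give the few vertices of degree at least the number of colours the smallest IDs). Part 1 is for all distinct IDs. *)

theory Defs
  imports "HOL-Probability.Probability"
begin

section \<open>Graphs\<close>

text \<open>A finite graph is given by a vertex set and a symmetric, irreflexive adjacency predicate.\<close>

definition vertex_degree :: "'v set \<Rightarrow> ('v \<Rightarrow> 'v \<Rightarrow> bool) \<Rightarrow> 'v \<Rightarrow> nat" where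
  "vertex_degree V E v = card {u \<in> V. E v u}"

text \<open>The inserted \<open>0\<close> only matters for the graph without vertices.\<close>

definition max_degree :: "'v set \<Rightarrow> ('v \<Rightarrow> 'v \<Rightarrow> bool) \<Rightarrow> nat" where
  "max_degree V E = Max (insert 0 (vertex_degree V E ` V))"

section \<open>Hyperbolic random graphs\<close>

text \<open>Points of the hyperbolic plane are pairs \<open>(r, \<phi>)\<close> of polar coordinates.\<close>

type_synonym point = "real \<times> real"

definition hyp_dist :: "point \<Rightarrow> point \<Rightarrow> real" where
  "hyp_dist x y =
     arcosh (cosh (fst x) * cosh (fst y) - sinh (fst x) * sinh (fst y) * cos (snd x - snd y))"

lemma hyp_dist_nonneg_cosh:
  assumes "0 \<le> fst x" "0 \<le> fst y"
  shows "0 \<le> hyp_dist x y"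
    and "cosh (hyp_dist x y) =
           cosh (fst x) * cosh (fst y) - sinh (fst x) * sinh (fst y) * cos (snd x - snd y)"
proof -
  have "sinh (fst x) * sinh (fst y) * cos (snd x - snd y) \<le> sinh (fst x) * sinh (fst y) * 1"
    using assms by (intro mult_left_mono) auto
  then have "cosh (fst x - fst y)
      \<le> cosh (fst x) * cosh (fst y) - sinh (fst x) * sinh (fst y) * cos (snd x - snd y)"
    by (simp add: cosh_diff)
  then have ge1: "1 \<le> cosh (fst x) * cosh (fst y) - sinh (fst x) * sinh (fst y) * cos (snd x - snd y)"
    using cosh_real_ge_1[of "fst x - fst y"] by linarith
  show "0 \<le> hyp_dist x y"
    using ge1 by (simp add: hyp_dist_def)
  show "cosh (hyp_dist x y) =
           cosh (fst x) * cosh (fst y) - sinh (fst x) * sinh (fst y) * cos (snd x - snd y)"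
    using ge1 by (simp add: hyp_dist_def)
qed

definition hyp_adj :: "real \<Rightarrow> point \<Rightarrow> point \<Rightarrow> bool" where
  "hyp_adj R x y \<longleftrightarrow> x \<noteq> y \<and> hyp_dist x y \<le> R"

definition hrg_radius :: "real \<Rightarrow> nat \<Rightarrow> real" where
  "hrg_radius C n = 2 * ln (real n) + C"

definition disk :: "real \<Rightarrow> point set" where
  "disk R = {0..R} \<times> {0..<2 * pi}"

definition radial_density :: "real \<Rightarrow> real \<Rightarrow> real \<Rightarrow> real" where
  "radial_density \<alpha> R r = \<alpha> * sinh (\<alpha> * r) / (2 * pi * (cosh (\<alpha> * R) - 1))"

definition hrg_intensity :: "real \<Rightarrow> real \<Rightarrow> nat \<Rightarrow> point measure" where
  "hrg_intensity \<alpha> C n =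
     density (restrict_space lborel (disk (hrg_radius C n)))
       (\<lambda>x. ennreal (real n * radial_density \<alpha> (hrg_radius C n) (fst x)))"

text \<open>
  A Poisson point process with finite, diffuse intensity measure \<open>\<mu>\<close>, represented as a random
  finite set \<open>V\<close> of points: counts are Poisson distributed and independent on disjoint sets.
  The Poisson weights are written out because \<open>poisson_pmf\<close> excludes rate \<open>0\<close>.
\<close>

definition poisson_point_process :: "'w measure \<Rightarrow> ('w \<Rightarrow> 'p set) \<Rightarrow> 'p measure \<Rightarrow> bool" where
  "poisson_point_process M V \<mu> \<longleftrightarrow>
     prob_space M \<and>
     (\<forall>\<omega>\<in>space M. finite (V \<omega>) \<and> V \<omega> \<subseteq> space \<mu>) \<and>
     (\<forall>A\<in>sets \<mu>. (\<lambda>\<omega>. card (V \<omega> \<inter> A)) \<in> measurable M (count_space UNIV)) \<and>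
     (\<forall>A\<in>sets \<mu>. \<forall>k. measure M {\<omega> \<in> space M. card (V \<omega> \<inter> A) = k} =
        measure \<mu> A ^ k / fact k * exp (- measure \<mu> A)) \<and>
     (\<forall>(I :: nat set) A. finite I \<longrightarrow> A ` I \<subseteq> sets \<mu> \<longrightarrow> disjoint_family_on A I \<longrightarrow>
        prob_space.indep_vars M (\<lambda>_. count_space UNIV) (\<lambda>i \<omega>. card (V \<omega> \<inter> A i)) I)"

text \<open>
  \<open>V\<close> is the random vertex set of \<open>G \<sim> \<G>(n, \<alpha>, C)\<close>; the adjacency is
  \<open>hyp_adj (hrg_radius C n)\<close>.
\<close>

definition hyperbolic_random_graph ::
    "real \<Rightarrow> real \<Rightarrow> nat \<Rightarrow> 'w measure \<Rightarrow> ('w \<Rightarrow> point set) \<Rightarrow> bool" where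
  "hyperbolic_random_graph \<alpha> C n M V \<longleftrightarrow> poisson_point_process M V (hrg_intensity \<alpha> C n)"

text \<open>
  \<open>P n\<close> holds with probability \<open>1 - o(1)\<close>.  The events \<open>X n\<close> make the notion independent of
  whether \<open>{\<omega>. P n \<omega>}\<close> itself is measurable; if it is, one may take \<open>X n\<close> to be that set.
  A statement about a typical hyperbolic random graph is one that holds a.a.s.
\<close>

definition aas :: "(nat \<Rightarrow> 'w measure) \<Rightarrow> (nat \<Rightarrow> 'w \<Rightarrow> bool) \<Rightarrow> bool" where
  "aas M P \<longleftrightarrow>
     (\<exists>X. (\<forall>n. X n \<in> sets (M n)) \<and> (\<forall>n. \<forall>\<omega>\<in>X n. P n \<omega>) \<and>
          (\<lambda>n. measure (M n) (X n)) \<longlonglongrightarrow> 1)"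

section \<open>Random colour trial with ID priority\<close>

text \<open>
  A state is a partial colouring: \<open>\<sigma> v = None\<close> means that \<open>v\<close> is not yet permanently coloured.
\<close>

type_synonym ('v, 'c) colouring = "'v \<Rightarrow> 'c option"

definition palette ::
    "'v set \<Rightarrow> ('v \<Rightarrow> 'v \<Rightarrow> bool) \<Rightarrow> 'c set \<Rightarrow> ('v, 'c) colouring \<Rightarrow> 'v \<Rightarrow> 'c set" where
  "palette V E \<Psi> \<sigma> u = \<Psi> - {c. \<exists>w\<in>V. E u w \<and> \<sigma> w = Some c}"

text \<open>A vertex with an empty palette has no candidate (\<open>None\<close>) and hence stays uncoloured.\<close>

definition candidate_pmf ::
    "'v set \<Rightarrow> ('v \<Rightarrow> 'v \<Rightarrow> bool) \<Rightarrow> 'c set \<Rightarrow> ('v, 'c) colouring \<Rightarrow> 'v \<Rightarrow> 'c option pmf" where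
  "candidate_pmf V E \<Psi> \<sigma> u =
     (if palette V E \<Psi> \<sigma> u = {} then return_pmf None
      else map_pmf Some (pmf_of_set (palette V E \<Psi> \<sigma> u)))"

text \<open>The candidates \<open>\<kappa>\<close> of all uncoloured vertices are drawn independently.\<close>

definition candidates_pmf ::
    "'v set \<Rightarrow> ('v \<Rightarrow> 'v \<Rightarrow> bool) \<Rightarrow> 'c set \<Rightarrow> ('v, 'c) colouring \<Rightarrow> ('v \<Rightarrow> 'c option) pmf" where
  "candidates_pmf V E \<Psi> \<sigma> = Pi_pmf {u \<in> V. \<sigma> u = None} None (candidate_pmf V E \<Psi> \<sigma>)"

definition adopt ::
    "'v set \<Rightarrow> ('v \<Rightarrow> 'v \<Rightarrow> bool) \<Rightarrow> ('v \<Rightarrow> nat) \<Rightarrow> ('v, 'c) colouring \<Rightarrow> ('v \<Rightarrow> 'c option) \<Rightarrow>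
       ('v, 'c) colouring" where
  "adopt V E ident \<sigma> \<kappa> u =
     (if \<sigma> u \<noteq> None then \<sigma> u
      else if \<exists>w\<in>V. E u w \<and> ident w < ident u \<and> \<kappa> w = \<kappa> u then None
      else \<kappa> u)"

definition rctid_round ::
    "'v set \<Rightarrow> ('v \<Rightarrow> 'v \<Rightarrow> bool) \<Rightarrow> 'c set \<Rightarrow> ('v \<Rightarrow> nat) \<Rightarrow> ('v, 'c) colouring \<Rightarrow>
       ('v, 'c) colouring pmf" where
  "rctid_round V E \<Psi> ident \<sigma> = map_pmf (adopt V E ident \<sigma>) (candidates_pmf V E \<Psi> \<sigma>)"

text \<open>
  The execution is the infinite random trajectory \<open>\<tau>\<close> of states, \<open>\<tau> t\<close> being the state after
  round \<open>t\<close>: the Ionescu-Tulcea measure that starts in the empty colouring and has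
  \<open>rctid_round\<close> as transition kernel.
\<close>

definition rctid_kernel ::
    "'v set \<Rightarrow> ('v \<Rightarrow> 'v \<Rightarrow> bool) \<Rightarrow> 'c set \<Rightarrow> ('v \<Rightarrow> nat) \<Rightarrow> nat \<Rightarrow> (nat \<Rightarrow> ('v, 'c) colouring) \<Rightarrow>
       ('v, 'c) colouring measure" where
  "rctid_kernel V E \<Psi> ident t \<tau> =
     measure_pmf (case t of 0 \<Rightarrow> return_pmf Map.empty | Suc s \<Rightarrow> rctid_round V E \<Psi> ident (\<tau> s))"

lemma rctid_Ionescu_Tulcea:
  "Ionescu_Tulcea (rctid_kernel V E \<Psi> ident) (\<lambda>_. count_space UNIV)"
proof (rule Ionescu_Tulcea.intro)
  fix t
  show "rctid_kernel V E \<Psi> ident t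
      \<in> measurable (PiM {0..<t} (\<lambda>_. count_space UNIV)) (subprob_algebra (count_space UNIV))"
  proof (cases t)
    case 0
    then show ?thesis
      by (simp add: rctid_kernel_def[abs_def] measure_pmf_in_subprob_algebra)
  next
    case (Suc s)
    have "(\<lambda>\<tau>. measure_pmf (rctid_round V E \<Psi> ident (\<tau> s)))
      \<in> measurable (PiM {0..<t} (\<lambda>_. count_space UNIV)) (subprob_algebra (count_space UNIV))"
      using measurable_compose[OF measurable_component_singleton[of s "{0..<t}" "\<lambda>_. count_space UNIV"],
          of "\<lambda>\<sigma>. measure_pmf (rctid_round V E \<Psi> ident \<sigma>)" "subprob_algebra (count_space UNIV)"]
      by (auto simp: Suc measure_pmf_in_subprob_algebra)
    then show ?thesis
      by (simp add: rctid_kernel_def[abs_def] Suc)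
  qed
next
  fix t \<tau>
  show "prob_space (rctid_kernel V E \<Psi> ident t \<tau>)"
    by (simp add: rctid_kernel_def prob_space_measure_pmf)
qed

definition rctid ::
    "'v set \<Rightarrow> ('v \<Rightarrow> 'v \<Rightarrow> bool) \<Rightarrow> 'c set \<Rightarrow> ('v \<Rightarrow> nat) \<Rightarrow> (nat \<Rightarrow> ('v, 'c) colouring) measure" where
  "rctid V E \<Psi> ident =
     projective_family.lim UNIV
       (Ionescu_Tulcea.CI (rctid_kernel V E \<Psi> ident) (\<lambda>_. count_space UNIV))
       (\<lambda>_. count_space UNIV)"

definition all_coloured :: "'v set \<Rightarrow> ('v, 'c) colouring \<Rightarrow> bool" where
  "all_coloured V \<sigma> \<longleftrightarrow> (\<forall>v\<in>V. \<sigma> v \<noteq> None)"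

definition terminates_after_exactly :: "'v set \<Rightarrow> nat \<Rightarrow> (nat \<Rightarrow> ('v, 'c) colouring) \<Rightarrow> bool" where
  "terminates_after_exactly V t \<tau> \<longleftrightarrow> all_coloured V (\<tau> t) \<and> (\<forall>s<t. \<not> all_coloured V (\<tau> s))"

definition never_terminates :: "'v set \<Rightarrow> (nat \<Rightarrow> ('v, 'c) colouring) \<Rightarrow> bool" where
  "never_terminates V \<tau> \<longleftrightarrow> (\<exists>v\<in>V. \<forall>t. \<tau> t v = None)"

definition rctid_prob ::
    "'v set \<Rightarrow> ('v \<Rightarrow> 'v \<Rightarrow> bool) \<Rightarrow> 'c set \<Rightarrow> ('v \<Rightarrow> nat) \<Rightarrow>
       ((nat \<Rightarrow> ('v, 'c) colouring) \<Rightarrow> bool) \<Rightarrow> real" where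
  "rctid_prob V E \<Psi> ident Q =
     measure (rctid V E \<Psi> ident) {\<tau> \<in> space (rctid V E \<Psi> ident). Q \<tau>}"

text \<open>
  Only the relative order of the IDs matters, so random IDs are a uniformly random bijection
  onto an initial segment of the naturals.  \<open>rctid_random_prob\<close> is the probability over both the
  IDs and the candidate choices.
\<close>

definition random_ids :: "'v set \<Rightarrow> ('v \<Rightarrow> nat) pmf" where
  "random_ids V = pmf_of_set {ident. ident \<in> extensional V \<and> bij_betw ident V {..<card V}}"

definition rctid_random_prob ::
    "'v set \<Rightarrow> ('v \<Rightarrow> 'v \<Rightarrow> bool) \<Rightarrow> 'c set \<Rightarrow>
       ((nat \<Rightarrow> ('v, 'c) colouring) \<Rightarrow> bool) \<Rightarrow> real" where
  "rctid_random_prob V E \<Psi> Q =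
     measure_pmf.expectation (random_ids V) (\<lambda>ident. rctid_prob V E \<Psi> ident Q)"

end

theory Submission
  imports Defs "HOL-Real_Asymp.Real_Asymp"
begin

text \<open>
  The first part rests on three properties of a typical graph: the maximum degree is \<open>n\<close> to the power
  \<open>1 / (2 * \<alpha>)\<close> and the sum of the squared degrees is of order \<open>\<Delta>\<^sup>2\<close>, both up to polylogarithmic
  factors, and there are polynomially more than \<open>\<Delta>\<close> edges.  In the first round the edges whose ends
  choose the same colour are pairwise independent events.  A second moment bound thus yields a conflict,
  and the ends of an edge \<open>uw\<close> both stay uncoloured with probability at most \<open>deg u * deg w / q\<^sup>2\<close>.
  As linearly many colours remain in every palette, the second round fails on this edge with a further
  factor \<open>O(1 / q)\<close>; the sum over all edges is polynomially small, because only few pairs of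
  vertices have degrees close to \<open>\<Delta>\<close>.

  For the second part consider the more than logarithmically many vertices of degree at least
  \<open>\<Delta> / ln n\<close>, up to smaller factors, that are closest to the centre.  These hubs form a clique, which settles
  the case of few colours.  Otherwise each hub \<open>v\<close> has a large independent set \<open>W v\<close> of neighbours close to
  the boundary, such that every other vertex is adjacent to a small part of \<open>W v\<close> only.  The sets are disjoint, so with
  random IDs some hub exceeds half of its set in ID, except with probability \<open>2\<close> to the minus number of
  hubs.  For this hub every colour is adopted in the first round by a member of \<open>W v\<close> with smaller ID, so
  that \<open>v\<close> is left uncoloured with an empty palette.

  The properties of the typical graph follow from Poisson tail bounds for finitely many explicit regions of the
  disk, chosen such that all neighbourhoods are controlled by them simultaneously.
\<close>

section \<open>The law of an execution\<close>

text \<open>The second part is decided by powers of \<open>ln n\<close>. Up to constants a hub owns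
  \<open>n powr (1 / (2 * \<alpha>)) * ln n powr - \<sigma>\<close> leaves with
  \<open>\<sigma> = 1 + (1 + \<tau>) / (2 * \<alpha>)\<close>: one logarithm is the width of an
  angular cell that surely contains a vertex, the rest is the price for descending to a depth that
  has \<open>ln n powr (1 + \<tau>)\<close> hubs. A superpolynomially small error asks for more than
  \<open>ln n\<close> leaves per colour, by a power of \<open>ln n\<close>. With \<Delta> over
  \<open>ln n\<close> cubed colours this amounts to \<open>1 + \<sigma> < 3\<close> up to multiples
  of \<tau>, which \<open>\<alpha> > 1 / 2\<close> provides; \<tau> is chosen to fit into the gap.
  In the first part the critical comparison is polynomial: at least
  \<open>n powr (3 / 2 - \<alpha>)\<close> edges up to logarithms against
  \<open>n powr (1 / (2 * \<alpha>))\<close> colours. The exponents differ by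
  \<open>(2 * \<alpha> - 1) * (1 - \<alpha>) / (2 * \<alpha>)\<close>, positive exactly for
  \<open>1 / 2 < \<alpha> < 1\<close>. The first part holds for every injective assignment of IDs.
  The second averages over IDs, since a vertex that precedes all its neighbours keeps its first
  candidate.\<close>

primrec rctid_state ::
    "'v set \<Rightarrow> ('v \<Rightarrow> 'v \<Rightarrow> bool) \<Rightarrow> 'c set \<Rightarrow> ('v \<Rightarrow> nat) \<Rightarrow> nat \<Rightarrow> ('v, 'c) colouring pmf" where
  "rctid_state V E \<Psi> ident 0 = return_pmf Map.empty"
| "rctid_state V E \<Psi> ident (Suc t) = bind_pmf (rctid_state V E \<Psi> ident t) (rctid_round V E \<Psi> ident)"

context
  fixes V :: "'v set" and E :: "'v \<Rightarrow> 'v \<Rightarrow> bool" and \<Psi> :: "'c set" and ident :: "'v \<Rightarrow> nat"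
begin

interpretation IT: Ionescu_Tulcea "rctid_kernel V E \<Psi> ident" "\<lambda>_. count_space UNIV"
  by (rule rctid_Ionescu_Tulcea)

lemma rctid_eq: "rctid V E \<Psi> ident = IT.PF.lim"
  by (simp add: rctid_def)

lemma sets_rctid [measurable_cong]:
  "sets (rctid V E \<Psi> ident) = sets (PiM UNIV (\<lambda>_. count_space UNIV))"
  by (simp add: rctid_eq)

lemma space_rctid [simp]: "space (rctid V E \<Psi> ident) = UNIV"
  by (simp add: rctid_eq space_PiM)

lemma measurable_rctid_component [measurable]:
  "(\<lambda>\<tau>. \<tau> t) \<in> measurable (rctid V E \<Psi> ident) (count_space UNIV)"
  by (simp add: measurable_cong_sets[OF sets_rctid refl])

lemma sets_rctid_component [measurable]: "{\<tau>. P (\<tau> t)} \<in> sets (rctid V E \<Psi> ident)"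
proof -
  have "(\<lambda>\<tau>. \<tau> t) -` {\<sigma>. P \<sigma>} \<inter> space (rctid V E \<Psi> ident) \<in> sets (rctid V E \<Psi> ident)"
    by (rule measurable_sets[OF measurable_rctid_component]) simp
  then show ?thesis by (simp add: vimage_def)
qed

text \<open>The projective limit is determined by its finite marginals. On an initial segment of
  times the marginal is the composition of the first \<open>n\<close> kernels, so an integral over a
  prefix can be unrolled one kernel at a time.\<close>

lemma nn_integral_rctid_prefix:
  assumes f: "f \<in> borel_measurable (PiM {0..<n} (\<lambda>_. count_space UNIV))"
  shows "(\<integral>\<^sup>+\<tau>. f (restrict \<tau> {0..<n}) \<partial>rctid V E \<Psi> ident) = (\<integral>\<^sup>+\<omega>. f \<omega> \<partial>IT.C 0 n (\<lambda>_. undefined))"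
proof -
  have eq: "IT.CI {0..<n} = IT.C 0 n (\<lambda>_. undefined)"
  proof (rule measure_eqI)
    show "sets (IT.CI {0..<n}) = sets (IT.C 0 n (\<lambda>_. undefined))"
      by (simp add: IT.CI_def IT.sets_C)
    fix A assume A: "A \<in> sets (IT.CI {0..<n})"
    then have A': "A \<in> sets (PiM {0..<n} (\<lambda>_. count_space UNIV))"
      by (simp add: IT.CI_def)
    have "IT.CI {0..<n} A = IT.C 0 n (\<lambda>_. undefined)
        (prod_emb {0..<n} (\<lambda>_. count_space UNIV) {0..<n} A)"
      by (rule IT.emeasure_CI[OF order_refl A'])
    then show "IT.CI {0..<n} A = IT.C 0 n (\<lambda>_. undefined) A"
      using prod_emb_id[of A "{0..<n}" "\<lambda>_. count_space UNIV"] sets.sets_into_space[OF A']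
      by (simp add: space_PiM)
  qed
  have "(\<integral>\<^sup>+\<omega>. f \<omega> \<partial>distr IT.PF.lim (PiM {0..<n} (\<lambda>_. count_space UNIV)) (\<lambda>x. restrict x {0..<n}))
     = (\<integral>\<^sup>+\<tau>. f (restrict \<tau> {0..<n}) \<partial>IT.PF.lim)"
    using f by (intro nn_integral_distr)
      (auto simp: measurable_cong_sets[OF IT.PF.sets_lim refl] intro!: measurable_restrict_subset)
  then show ?thesis
    using IT.distr_lim[of "{0..<n}"] by (simp add: rctid_eq eq)
qed

lemma nn_integral_C_Suc:
  assumes f: "f \<in> borel_measurable (PiM {0..<Suc n} (\<lambda>_. count_space UNIV))"
  shows "(\<integral>\<^sup>+\<omega>. f \<omega> \<partial>IT.C 0 (Suc n) (\<lambda>_. undefined)) =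
    (\<integral>\<^sup>+\<omega>. (\<integral>\<^sup>+x. f (fun_upd \<omega> n x) \<partial>rctid_kernel V E \<Psi> ident n \<omega>) \<partial>IT.C 0 n (\<lambda>_. undefined))"
proof -
  have sp: "(\<lambda>_. undefined) \<in> space (PiM {0..<0} (\<lambda>_. count_space UNIV))"
    by (auto simp: space_PiM PiE_iff extensional_def)
  have "(\<integral>\<^sup>+\<omega>. f \<omega> \<partial>IT.C 0 (Suc n) (\<lambda>_. undefined)) =
     (\<integral>\<^sup>+\<omega>. (\<integral>\<^sup>+x. f x \<partial>IT.eP n \<omega>) \<partial>IT.C 0 n (\<lambda>_. undefined))"
    using f IT.measurable_eP[of n] IT.sets_C[OF sp, of n]
    by (simp, subst nn_integral_bind[where B="PiM {0..<Suc n} (\<lambda>_. count_space UNIV)"])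
       (auto simp: measurable_cong_sets[OF IT.sets_C[OF sp, of n] refl])
  also have "\<dots> = (\<integral>\<^sup>+\<omega>. (\<integral>\<^sup>+x. f (fun_upd \<omega> n x) \<partial>rctid_kernel V E \<Psi> ident n \<omega>) \<partial>IT.C 0 n (\<lambda>_. undefined))"
    using f by (intro nn_integral_cong IT.nn_integral_eP) (simp_all add: IT.space_C[OF sp])
  finally show ?thesis .
qed

lemma nn_integral_C_last:
  "(\<integral>\<^sup>+\<omega>. g (\<omega> t) \<partial>IT.C 0 (Suc t) (\<lambda>_. undefined)) =
     (\<integral>\<^sup>+\<sigma>. g \<sigma> \<partial>rctid_state V E \<Psi> ident t)"
proof (induction t arbitrary: g)
  case 0
  have "(\<integral>\<^sup>+\<omega>. g (\<omega> 0) \<partial>IT.C 0 (Suc 0) (\<lambda>_. undefined)) =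
     (\<integral>\<^sup>+\<omega>. (\<integral>\<^sup>+x. g x \<partial>rctid_kernel V E \<Psi> ident 0 \<omega>) \<partial>IT.C 0 0 (\<lambda>_. undefined))"
    by (subst nn_integral_C_Suc)
       (auto intro!: measurable_compose[OF measurable_component_singleton])
  also have "\<dots> = g Map.empty"
    using prob_space.emeasure_space_1[OF IT.prob_space_C[of "\<lambda>_. undefined" 0 0]]
    by (simp add: rctid_kernel_def space_PiM PiE_iff del: IT.C.simps)
  finally show ?case by simp
next
  case (Suc t)
  have "(\<integral>\<^sup>+\<omega>. g (\<omega> (Suc t)) \<partial>IT.C 0 (Suc (Suc t)) (\<lambda>_. undefined)) =
     (\<integral>\<^sup>+\<omega>. (\<integral>\<^sup>+x. g x \<partial>rctid_round V E \<Psi> ident (\<omega> t)) \<partial>IT.C 0 (Suc t) (\<lambda>_. undefined))"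
    by (subst nn_integral_C_Suc)
       (auto intro!: measurable_compose[OF measurable_component_singleton] simp: rctid_kernel_def)
  also have "\<dots> = (\<integral>\<^sup>+\<sigma>. (\<integral>\<^sup>+x. g x \<partial>rctid_round V E \<Psi> ident \<sigma>) \<partial>rctid_state V E \<Psi> ident t)"
    by (rule Suc.IH)
  also have "\<dots> = (\<integral>\<^sup>+\<sigma>. g \<sigma> \<partial>rctid_state V E \<Psi> ident (Suc t))"
    by simp
  finally show ?case .
qed

text \<open>The Markov property for two consecutive times. Taking \<open>k = 1\<close> gives the law
  of a single state, taking indicators shows that impossible transitions have measure zero.\<close>

lemma nn_integral_rctid_pair:
  "(\<integral>\<^sup>+\<tau>. h (\<tau> t) * k (\<tau> (Suc t)) \<partial>rctid V E \<Psi> ident) =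
     (\<integral>\<^sup>+\<sigma>. h \<sigma> * (\<integral>\<^sup>+x. k x \<partial>rctid_round V E \<Psi> ident \<sigma>) \<partial>rctid_state V E \<Psi> ident t)"
proof -
  have m: "(\<lambda>\<omega>. h (\<omega> t) * k (\<omega> (Suc t)))
      \<in> borel_measurable (PiM {0..<Suc (Suc t)} (\<lambda>_. count_space UNIV))"
    by (intro borel_measurable_times_ennreal)
       (auto intro!: measurable_compose[OF measurable_component_singleton])
  have "(\<integral>\<^sup>+\<tau>. h (\<tau> t) * k (\<tau> (Suc t)) \<partial>rctid V E \<Psi> ident) =
    (\<integral>\<^sup>+\<omega>. h (\<omega> t) * k (\<omega> (Suc t)) \<partial>IT.C 0 (Suc (Suc t)) (\<lambda>_. undefined))"
    using nn_integral_rctid_prefix[OF m] by simp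
  also have "\<dots> = (\<integral>\<^sup>+\<omega>. h (\<omega> t) * (\<integral>\<^sup>+x. k x \<partial>rctid_round V E \<Psi> ident (\<omega> t))
      \<partial>IT.C 0 (Suc t) (\<lambda>_. undefined))"
    by (subst nn_integral_C_Suc[OF m]) (simp add: rctid_kernel_def nn_integral_cmult)
  also have "\<dots> = (\<integral>\<^sup>+\<sigma>. h \<sigma> * (\<integral>\<^sup>+x. k x \<partial>rctid_round V E \<Psi> ident \<sigma>) \<partial>rctid_state V E \<Psi> ident t)"
    by (rule nn_integral_C_last[where g="\<lambda>\<sigma>. h \<sigma> * (\<integral>\<^sup>+x. k x \<partial>rctid_round V E \<Psi> ident \<sigma>)"])
  finally show ?thesis .
qed

lemma emeasure_rctid_state:
  "emeasure (rctid V E \<Psi> ident) {\<tau>. P (\<tau> t)} = emeasure (rctid_state V E \<Psi> ident t) {\<sigma>. P \<sigma>}"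
proof -
  have "emeasure (rctid V E \<Psi> ident) {\<tau>. P (\<tau> t)} =
    (\<integral>\<^sup>+\<tau>. indicator {\<tau>. P (\<tau> t)} \<tau> \<partial>rctid V E \<Psi> ident)"
    by (rule nn_integral_indicator[symmetric]) simp
  also have "\<dots> = (\<integral>\<^sup>+\<tau>. indicator {\<sigma>. P \<sigma>} (\<tau> t) * 1 \<partial>rctid V E \<Psi> ident)"
    by (intro nn_integral_cong) (auto simp: indicator_def)
  also have "\<dots> = (\<integral>\<^sup>+\<sigma>. indicator {\<sigma>. P \<sigma>} \<sigma> \<partial>rctid_state V E \<Psi> ident t)"
    by (subst nn_integral_rctid_pair[where k="\<lambda>_. 1"]) (simp add: measure_pmf.emeasure_space_1)
  finally show ?thesis by simp
qed

lemma prob_space_rctid: "prob_space (rctid V E \<Psi> ident)"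
  using emeasure_rctid_state[of "\<lambda>_. True" 0]
  by (intro prob_spaceI) simp

lemma measure_rctid_state:
  "measure (rctid V E \<Psi> ident) {\<tau>. P (\<tau> t)} = measure_pmf.prob (rctid_state V E \<Psi> ident t) {\<sigma>. P \<sigma>}"
  by (simp add: measure_def emeasure_rctid_state)

text \<open>Allows pathwise arguments: invariants of a round hold along almost every trajectory.
  There may be uncountably many states, so the exceptional transitions are collected over the
  countable support of the state at time \<open>t\<close>.\<close>

lemma AE_rctid_step:
  "AE \<tau> in rctid V E \<Psi> ident. \<forall>t. \<tau> (Suc t) \<in> set_pmf (rctid_round V E \<Psi> ident (\<tau> t))"
proof (subst AE_all_countable, rule allI)
  fix t
  let ?M = "rctid V E \<Psi> ident" and ?S = "rctid_state V E \<Psi> ident t"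
  have 1: "AE \<tau> in ?M. \<tau> t \<in> set_pmf ?S"
  proof (rule AE_I[where N="{\<tau>. \<tau> t \<notin> set_pmf ?S}"])
    show "emeasure ?M {\<tau>. \<tau> t \<notin> set_pmf ?S} = 0"
      by (subst emeasure_rctid_state) (auto simp: measure_pmf.emeasure_eq_measure measure_pmf_zero_iff)
  qed auto
  have 2: "AE \<tau> in ?M. \<not> (\<tau> t = \<sigma> \<and> \<tau> (Suc t) \<notin> set_pmf (rctid_round V E \<Psi> ident \<sigma>))" for \<sigma>
  proof (rule AE_I[where N="{\<tau>. \<tau> t = \<sigma>} \<inter> {\<tau>. \<tau> (Suc t) \<notin> set_pmf (rctid_round V E \<Psi> ident \<sigma>)}"])
    let ?N = "{\<tau>. \<tau> t = \<sigma>} \<inter> {\<tau>. \<tau> (Suc t) \<notin> set_pmf (rctid_round V E \<Psi> ident \<sigma>)}"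
    show m: "?N \<in> sets ?M"
      by (intro sets.Int sets_rctid_component)
    have "emeasure ?M ?N = (\<integral>\<^sup>+\<tau>. indicator {\<sigma>} (\<tau> t) *
        indicator (- set_pmf (rctid_round V E \<Psi> ident \<sigma>)) (\<tau> (Suc t)) \<partial>?M)"
      by (subst nn_integral_indicator[OF m, symmetric], intro nn_integral_cong)
         (auto simp: indicator_def)
    also have "\<dots> = (\<integral>\<^sup>+\<sigma>'. 0 \<partial>?S)"
      by (subst nn_integral_rctid_pair, intro nn_integral_cong)
         (auto simp: indicator_def measure_pmf.emeasure_eq_measure measure_pmf_zero_iff)
    finally show "emeasure ?M ?N = 0" by simp
  qed auto
  have "AE \<tau> in ?M. \<forall>\<sigma>\<in>set_pmf ?S. \<not> (\<tau> t = \<sigma> \<and> \<tau> (Suc t) \<notin> set_pmf (rctid_round V E \<Psi> ident \<sigma>))"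
    using 2 by (subst AE_ball_countable) auto
  with 1 show "AE \<tau> in ?M. \<tau> (Suc t) \<in> set_pmf (rctid_round V E \<Psi> ident (\<tau> t))"
    by eventually_elim auto
qed

lemma AE_rctid_start: "AE \<tau> in rctid V E \<Psi> ident. \<tau> 0 = Map.empty"
proof (rule AE_I[where N="{\<tau>. \<tau> 0 \<noteq> Map.empty}"])
  show "emeasure (rctid V E \<Psi> ident) {\<tau>. \<tau> 0 \<noteq> Map.empty} = 0"
    by (subst emeasure_rctid_state) simp
qed auto

end

section \<open>Products of probability mass functions\<close>

text \<open>Chebyshev's inequality at half the mean \<open>\<mu>\<close>: when pairwise
  intersections are no likelier than under independence, the variance is at most
  \<open>\<mu>\<close>. Applied to conflict edges and to the colours that a neighbourhood
  avoids.\<close>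

lemma (in prob_space) second_moment_count:
  assumes I: "finite I" "I \<noteq> {}" and r: "0 < r"
    and A: "\<And>i. i \<in> I \<Longrightarrow> A i \<in> events"
    and p1: "\<And>i. i \<in> I \<Longrightarrow> prob (A i) = r"
    and p2: "\<And>i j. i \<in> I \<Longrightarrow> j \<in> I \<Longrightarrow> i \<noteq> j \<Longrightarrow> prob (A i \<inter> A j) \<le> r\<^sup>2"
  shows "prob {x \<in> space M. real (card {i \<in> I. x \<in> A i}) \<le> real (card I) * r / 2}
           \<le> 4 / (real (card I) * r)"
proof -
  define X where "X x = (\<Sum>i\<in>I. indicat_real (A i) x)" for x
  define \<mu> where "\<mu> = real (card I) * r"
  have \<mu>: "0 < \<mu>"
    using I r by (simp add: \<mu>_def card_gt_0_iff)
  have X_card: "X x = real (card {i \<in> I. x \<in> A i})" for x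
    unfolding X_def using I(1) by (simp add: indicator_def sum.If_cases Int_def)
  have meas [measurable]: "X \<in> borel_measurable M"
    unfolding X_def using A by measurable
  have bnd: "\<bar>X x\<bar> \<le> real (card I)" for x
    unfolding X_card by (simp add: card_mono I(1))
  have EX: "expectation X = \<mu>"
    unfolding X_def using A p1
    by (subst Bochner_Integration.integral_sum) (auto simp: \<mu>_def emeasure_eq_measure)
  have X2: "(X x)\<^sup>2 = (\<Sum>i\<in>I. \<Sum>j\<in>I. indicat_real (A i \<inter> A j) x)" for x
    by (simp add: X_def power2_eq_square sum_product indicator_inter_arith)
  have "expectation (\<lambda>x. (X x)\<^sup>2) = (\<Sum>i\<in>I. \<Sum>j\<in>I. prob (A i \<inter> A j))"
    unfolding X2 using A by (simp add: emeasure_eq_measure Bochner_Integration.integral_sum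
        integrable_real_indicator sets.Int)
  also have "\<dots> \<le> (\<Sum>i\<in>I. \<Sum>j\<in>I. (if i = j then r else 0) + r\<^sup>2)"
    by (intro sum_mono) (use p1 p2 r in \<open>auto intro: order_trans[OF _ zero_le_power2]\<close>)
  also have "\<dots> = \<mu> + \<mu>\<^sup>2"
    using I(1) by (simp add: sum.distrib \<mu>_def power2_eq_square algebra_simps)
  finally have E2: "expectation (\<lambda>x. (X x)\<^sup>2) \<le> \<mu> + \<mu>\<^sup>2" .
  have sq: "integrable M (\<lambda>x. (X x)\<^sup>2)"
  proof (rule integrable_const_bound[where B="(real (card I))\<^sup>2"])
    show "AE x in M. norm ((X x)\<^sup>2) \<le> (real (card I))\<^sup>2"
      using power_mono[OF bnd, where n=2] by simp
  qed measurable
  have int: "integrable M X"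
    by (rule integrable_const_bound[where B="real (card I)"]) (use bnd in auto)
  have var: "variance X \<le> \<mu>"
    using variance_eq[OF int sq] E2 EX by simp
  have "prob {x \<in> space M. real (card {i \<in> I. x \<in> A i}) \<le> \<mu> / 2}
      \<le> prob {x \<in> space M. \<bar>X x - expectation X\<bar> \<ge> \<mu> / 2}"
    by (intro finite_measure_mono) (use \<mu> in \<open>auto simp: EX X_card[symmetric] abs_if\<close>)
  also have "\<dots> \<le> variance X / (\<mu> / 2)\<^sup>2"
    by (rule Chebyshev_inequality) (use sq \<mu> in auto)
  also have "\<dots> \<le> \<mu> / (\<mu> / 2)\<^sup>2"
    by (intro divide_right_mono var) auto
  also have "\<dots> = 4 / \<mu>"
    using \<mu> by (simp add: power2_eq_square field_simps)
  finally show ?thesis by (simp add: \<mu>_def)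
qed

text \<open>Redrawing the coordinates in \<open>U\<close> does not change a product distribution.
  This serves to condition on the coordinates outside \<open>U\<close> while those in
  \<open>U\<close> are fresh.\<close>

lemma Pi_pmf_resample:
  assumes A: "finite A" and U: "U \<subseteq> A"
  shows "Pi_pmf A d p =
    bind_pmf (Pi_pmf A d p) (\<lambda>f. map_pmf (\<lambda>h x. if x \<in> U then h x else f x) (Pi_pmf U d p))"
proof -
  have fin: "finite U" "finite (A - U)" and eq: "A = U \<union> (A - U)"
    using assms by (auto dest: finite_subset)
  have "Pi_pmf (U \<union> (A - U)) d p =
    bind_pmf (Pi_pmf (U \<union> (A - U)) d p) (\<lambda>f. map_pmf (\<lambda>h x. if x \<in> U then h x else f x) (Pi_pmf U d p))"
    by (subst (1 2) Pi_pmf_union[OF fin])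
       (auto simp: pair_pmf_def map_pmf_def bind_assoc_pmf bind_return_pmf if_distrib cong: if_cong,
        subst bind_commute_pmf, simp)
  then show ?thesis
    using eq by simp
qed

lemma measure_bind_pmf_le:
  assumes le: "\<And>x. x \<in> set_pmf p \<Longrightarrow> measure_pmf.prob (f x) S \<le> g x"
    and int: "integrable (measure_pmf p) g"
  shows "measure_pmf.prob (bind_pmf p f) S \<le> measure_pmf.expectation p g"
proof -
  have "measure_pmf.prob (bind_pmf p f) S = measure_pmf.expectation p (\<lambda>x. measure_pmf.prob (f x) S)"
    unfolding measure_pmf_bind
    by (subst measure_pmf.measure_bind[where N="count_space UNIV"]) (auto simp: measure_pmf_in_subprob_algebra)
  also have "\<dots> \<le> measure_pmf.expectation p g"
    using le by (intro integral_mono_AE int measure_pmf.integrable_const_bound[where B=1])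
      (auto simp: AE_measure_pmf_iff)
  finally show ?thesis .
qed

text \<open>Deferred decisions: \<open>g\<close> and \<open>H\<close> ignore coordinate
  \<open>v\<close>, so this coordinate may be drawn last, and then it hits a prescribed value with
  probability at most \<open>c\<close>.\<close>

lemma prob_Pi_coord_le:
  assumes A: "finite A" and v: "v \<in> A" and c: "\<And>y. pmf (p v) y \<le> c"
    and g: "\<And>f y. g (f(v := y)) = g f" and H: "\<And>f y. H (f(v := y)) = H f"
  shows "measure_pmf.prob (Pi_pmf A d p) {f. f v = g f \<and> H f}
      \<le> c * measure_pmf.prob (Pi_pmf A d p) {f. H f}"
proof -
  let ?K = "Pi_pmf A d p" and ?S = "{f. f v = g f \<and> H f}"
  have upd: "(\<lambda>x. if x = v then h x else f x) = f(v := h v)" for h f :: "'a \<Rightarrow> 'b"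
    by auto
  have "?K = bind_pmf ?K (\<lambda>f. map_pmf (\<lambda>h. f(v := h v)) (Pi_pmf {v} d p))"
    by (subst Pi_pmf_resample[OF A, of "{v}"]) (use v in \<open>simp_all add: upd\<close>)
  also have "\<dots> = bind_pmf ?K (\<lambda>f. map_pmf (\<lambda>y. f(v := y)) (p v))"
    by (simp add: Pi_pmf_singleton pmf.map_comp o_def)
  finally have eq: "?K = \<dots>" .
  have "measure_pmf.prob ?K ?S =
     measure_pmf.prob (bind_pmf ?K (\<lambda>f. map_pmf (\<lambda>y. f(v := y)) (p v))) ?S"
    using eq by simp
  also have "\<dots> \<le> measure_pmf.expectation ?K (\<lambda>f. c * indicator {f. H f} f)"
  proof (rule measure_bind_pmf_le)
    fix f
    have "measure_pmf.prob (map_pmf (\<lambda>y. f(v := y)) (p v)) ?S =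
      measure_pmf.prob (p v) {y. y = g f \<and> H f}"
      by (simp add: vimage_def g H)
    also have "\<dots> = (if H f then pmf (p v) (g f) else 0)"
      by (auto simp: measure_pmf_single)
    finally show "measure_pmf.prob (map_pmf (\<lambda>y. f(v := y)) (p v)) ?S \<le> c * indicator {f. H f} f"
      using c[of "g f"] by auto
  qed (intro integrable_mult_right integrable_real_indicator; simp add: measure_pmf.emeasure_eq_measure)
  also have "\<dots> = c * measure_pmf.prob ?K {f. H f}"
    by simp
  finally show ?thesis .
qed

text \<open>The second moment bound wants an exact probability, the same for every edge; hence the
  event is split into disjoint events according to the common value.\<close>

lemma prob_Pi_coord_eq:
  assumes A: "finite A" and v: "v \<in> A" and u: "u \<in> A" "u \<noteq> v" and S: "finite S" "S \<noteq> {}"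
    and p: "p u = map_pmf Some (pmf_of_set S)" "p v = map_pmf Some (pmf_of_set S)"
  shows "measure_pmf.prob (Pi_pmf A d p) {f. f u = f v} = 1 / real (card S)"
proof -
  let ?K = "Pi_pmf A d p"
  let ?B = "\<lambda>i x. if x = u \<or> x = v then {Some i} else UNIV"
  have B: "measure_pmf.prob ?K (Pi A (?B i)) = (1 / real (card S))\<^sup>2" if i: "i \<in> S" for i
  proof -
    have pm: "measure_pmf.prob (map_pmf Some (pmf_of_set S)) {Some i} = 1 / real (card S)"
      using S i by (simp add: measure_pmf_single pmf_map_inj')
    have "measure_pmf.prob ?K (Pi A (?B i)) = (\<Prod>x\<in>A. measure_pmf.prob (p x) (?B i x))"
      by (rule measure_Pi_pmf_Pi[OF A])
    also have "\<dots> = (\<Prod>x\<in>{u,v}. measure_pmf.prob (p x) (?B i x))"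
      by (rule prod.mono_neutral_right) (use A u v in auto)
    also have "\<dots> = (1 / real (card S))\<^sup>2"
      using u p pm by (simp add: power2_eq_square)
    finally show ?thesis .
  qed
  have ae: "AE f in ?K. f u \<in> Some ` S"
  proof (rule AE_pmfI)
    fix f assume "f \<in> set_pmf ?K"
    then have "f u \<in> set_pmf (p u)"
      using set_Pi_pmf[OF A, of d p] u by (auto simp: PiE_dflt_def)
    then show "f u \<in> Some ` S"
      using p S by simp
  qed
  have "measure_pmf.prob ?K {f. f u = f v} = measure_pmf.prob ?K (\<Union>i\<in>S. Pi A (?B i))"
  proof (rule measure_pmf.finite_measure_eq_AE)
    show "AE f in ?K. f \<in> {f. f u = f v} \<longleftrightarrow> f \<in> (\<Union>i\<in>S. Pi A (?B i))"
      using ae by eventually_elim (use u v in \<open>auto simp: Pi_iff\<close>)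
  qed auto
  also have "\<dots> = (\<Sum>i\<in>S. measure_pmf.prob ?K (Pi A (?B i)))"
  proof (rule measure_pmf.finite_measure_finite_Union)
    show "disjoint_family_on (\<lambda>i. Pi A (?B i)) S"
      unfolding disjoint_family_on_def using u(1) by (force simp: Pi_iff)
  qed (use S in auto)
  also have "\<dots> = 1 / real (card S)"
    using B S by (simp add: power2_eq_square)
  finally show ?thesis .
qed

text \<open>The union bound across two rounds. Given a good outcome \<open>x\<close> of the first
  round, failure in the second is at most a weighted count of first-round events that hold at
  \<open>x\<close>; averaging over \<open>x\<close> turns the indicators into probabilities.\<close>

lemma measure_bind_pmf_union_le:
  assumes I: "finite I" and ab: "\<And>i. i \<in> I \<Longrightarrow> 0 \<le> a i"
    and le: "\<And>x. x \<in> set_pmf p \<Longrightarrow> \<not> B x \<Longrightarrow> measure_pmf.prob (f x) S \<le> (\<Sum>i\<in>I. a i * indicator {x. P i x} x)"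
  shows "measure_pmf.prob (bind_pmf p f) S \<le>
    measure_pmf.prob p {x. B x} + (\<Sum>i\<in>I. a i * measure_pmf.prob p {x. P i x})"
proof -
  have int: "integrable (measure_pmf p) (indicat_real T)" for T
    by (intro integrable_real_indicator) (simp_all add: measure_pmf.emeasure_eq_measure)
  have "measure_pmf.prob (bind_pmf p f) S \<le>
    measure_pmf.expectation p (\<lambda>x. indicator {x. B x} x + (\<Sum>i\<in>I. a i * indicator {x. P i x} x))"
  proof (rule measure_bind_pmf_le)
    fix x assume x: "x \<in> set_pmf p"
    have nn: "0 \<le> (\<Sum>i\<in>I. a i * indicat_real {x. P i x} x)"
      using ab by (intro sum_nonneg) simp
    show "measure_pmf.prob (f x) S \<le> indicator {x. B x} x + (\<Sum>i\<in>I. a i * indicator {x. P i x} x)"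
      using le[OF x] nn by (cases "B x") (auto intro: order_trans[OF measure_pmf.prob_le_1])
  qed (intro Bochner_Integration.integrable_add Bochner_Integration.integrable_sum
         integrable_mult_right int)
  also have "\<dots> = measure_pmf.prob p {x. B x} + (\<Sum>i\<in>I. a i * measure_pmf.prob p {x. P i x})"
    by (subst Bochner_Integration.integral_add)
       (auto intro!: int Bochner_Integration.integrable_sum integrable_mult_right
             simp: Bochner_Integration.integral_sum int)
  finally show ?thesis .
qed

section \<open>Termination after two rounds\<close>

locale rctid_graph =
  fixes V :: "'v set" and E :: "'v \<Rightarrow> 'v \<Rightarrow> bool" and \<Psi> :: "'c set" and ident :: "'v \<Rightarrow> nat"
  assumes finite_V: "finite V" and E_sym: "E u w \<Longrightarrow> E w u" and E_irrefl: "\<not> E u u"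
    and finite_colours: "finite \<Psi>" and inj_ident: "inj_on ident V"
begin

text \<open>Each edge occurs once, directed towards the smaller ID, so that its first end is the one
  that yields in a conflict.\<close>

definition edges :: "('v \<times> 'v) set" where
  "edges = {(u, w). u \<in> V \<and> w \<in> V \<and> E u w \<and> ident w < ident u}"

lemma finite_edges: "finite edges"
  by (rule finite_subset[of _ "V \<times> V"]) (auto simp: edges_def finite_V)

lemma edges_union_swap: "edges \<union> prod.swap ` edges = (SIGMA u:V. {w \<in> V. E u w})"
proof -
  have "ident u < ident w \<or> ident w < ident u" if "u \<in> V" "w \<in> V" "E u w" for u w
    using that inj_ident E_irrefl by (metis inj_on_contraD linorder_less_linear)
  then show ?thesis
    using E_sym by (fastforce simp: edges_def image_iff)
qed

text \<open>The handshake argument: every vertex lies on as many edges as its degree says. The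
  weight 1 yields twice the number of edges, the degree as weight yields the sum of squared
  degrees.\<close>

lemma sum_edges:
  fixes f :: "'v \<Rightarrow> 'b::comm_semiring_1"
  shows "(\<Sum>(u, w)\<in>edges. f u + f w) = (\<Sum>u\<in>V. of_nat (vertex_degree V E u) * f u)"
proof -
  have "(\<Sum>(u, w)\<in>edges. f u + f w) = (\<Sum>e\<in>edges. f (fst e)) + (\<Sum>e\<in>prod.swap ` edges. f (fst e))"
    by (simp add: case_prod_beta sum.distrib sum.reindex)
  also have "\<dots> = (\<Sum>e\<in>edges \<union> prod.swap ` edges. f (fst e))"
    by (intro sum.union_disjoint[symmetric] finite_imageI finite_edges) (auto simp: edges_def)
  also have "\<dots> = (\<Sum>(u, w)\<in>(SIGMA u:V. {w \<in> V. E u w}). f u)"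
    by (simp add: edges_union_swap case_prod_beta)
  also have "\<dots> = (\<Sum>u\<in>V. \<Sum>w\<in>{w \<in> V. E u w}. f u)"
    using finite_V by (subst sum.Sigma) auto
  finally show ?thesis
    by (simp add: vertex_degree_def)
qed

lemma card_edges: "2 * card edges = (\<Sum>u\<in>V. vertex_degree V E u)"
  using sum_edges[of "\<lambda>_. 1 :: nat"] by simp

section \<open>Colour conflicts in the first two rounds\<close>

definition first_candidates :: "('v \<Rightarrow> 'c option) pmf" where
  "first_candidates = Pi_pmf V None (\<lambda>_. map_pmf Some (pmf_of_set \<Psi>))"

lemma rctid_state_1:
  assumes "\<Psi> \<noteq> {}"
  shows "rctid_state V E \<Psi> ident (Suc 0) = map_pmf (adopt V E ident Map.empty) first_candidates"
proof -
  have "candidates_pmf V E \<Psi> Map.empty = first_candidates"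
    using assms by (simp add: candidates_pmf_def first_candidates_def candidate_pmf_def[abs_def] palette_def)
  then show ?thesis
    by (simp add: bind_return_pmf rctid_round_def)
qed

lemma first_candidates_Some:
  assumes "\<Psi> \<noteq> {}" and "\<kappa> \<in> set_pmf first_candidates" and "u \<in> V"
  obtains c where "c \<in> \<Psi>" "\<kappa> u = Some c"
proof -
  have "\<kappa> u \<in> Some ` \<Psi>"
    using assms finite_colours set_Pi_pmf[OF finite_V, of None "\<lambda>_. map_pmf Some (pmf_of_set \<Psi>)"]
    by (auto simp: first_candidates_def PiE_dflt_def)
  then show ?thesis using that by auto
qed

lemma pmf_candidate_le:
  assumes "\<Psi> \<noteq> {}"
  shows "pmf (map_pmf Some (pmf_of_set \<Psi>)) y \<le> 1 / real (card \<Psi>)"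
proof (cases y)
  case None
  then show ?thesis by (simp add: pmf_eq_0_set_pmf[THEN iffD2] assms finite_colours)
next
  case (Some c)
  then show ?thesis
    using assms finite_colours by (simp add: pmf_map_inj' indicator_def)
qed

lemma prob_same_candidate:
  assumes "\<Psi> \<noteq> {}" "u \<in> V" "w \<in> V" "u \<noteq> w"
  shows "measure_pmf.prob first_candidates {\<kappa>. \<kappa> u = \<kappa> w} = 1 / real (card \<Psi>)"
  unfolding first_candidates_def
  by (rule prob_Pi_coord_eq) (use assms finite_V finite_colours in auto)

text \<open>Of two distinct edges, one has an end outside the other. Drawing this end last
  contributes the second factor \<open>1 / card \<Psi>\<close>, even if the edges share a
  vertex.\<close>

lemma prob_same_candidate_twice:
  assumes ne: "\<Psi> \<noteq> {}" and V: "u \<in> V" "x \<in> V" "w \<in> V" "y \<in> V" and "u \<noteq> x" "w \<noteq> y"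
    and d: "{u, x} \<noteq> {w, y}"
  shows "measure_pmf.prob first_candidates {\<kappa>. \<kappa> u = \<kappa> x \<and> \<kappa> w = \<kappa> y} \<le> (1 / real (card \<Psi>))\<^sup>2"
proof -
  let ?q = "real (card \<Psi>)"
  have *: "measure_pmf.prob first_candidates {\<kappa>. \<kappa> v = \<kappa> v' \<and> \<kappa> u = \<kappa> x} \<le> (1 / ?q)\<^sup>2"
    if v: "v \<in> V" "v \<notin> {u, x}" "v \<noteq> v'" for v v'
  proof -
    have "measure_pmf.prob first_candidates {\<kappa>. \<kappa> v = \<kappa> v' \<and> \<kappa> u = \<kappa> x}
      \<le> 1 / ?q * measure_pmf.prob first_candidates {\<kappa>. \<kappa> u = \<kappa> x}"
      unfolding first_candidates_def
      by (rule prob_Pi_coord_le[OF finite_V]) (use v pmf_candidate_le[OF ne] in auto)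
    also have "\<dots> = (1 / ?q)\<^sup>2"
      using assms by (subst prob_same_candidate) (auto simp: power2_eq_square)
    finally show ?thesis .
  qed
  consider "w \<notin> {u, x}" | "y \<notin> {u, x}"
    using d \<open>u \<noteq> x\<close> \<open>w \<noteq> y\<close> by blast
  then show ?thesis
  proof cases
    case 1
    have eq: "{\<kappa>. \<kappa> u = \<kappa> x \<and> \<kappa> w = \<kappa> y} = {\<kappa>. \<kappa> w = \<kappa> y \<and> \<kappa> u = \<kappa> x}"
      by auto
    show ?thesis unfolding eq using *[of w y] 1 assms by blast
  next
    case 2
    have eq: "{\<kappa>. \<kappa> u = \<kappa> x \<and> \<kappa> w = \<kappa> y} = {\<kappa>. \<kappa> y = \<kappa> w \<and> \<kappa> u = \<kappa> x}"
      by auto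
    show ?thesis unfolding eq using *[of y w] 2 assms by blast
  qed
qed

text \<open>A single edge whose ends agree already leaves a vertex uncoloured. So success in one
  round means that the number of such edges, of mean \<open>card edges / card \<Psi>\<close>, is
  zero.\<close>

lemma prob_coloured_after_1_le:
  assumes ne: "\<Psi> \<noteq> {}" and ed: "edges \<noteq> {}"
  shows "measure_pmf.prob (rctid_state V E \<Psi> ident (Suc 0)) {\<sigma>. all_coloured V \<sigma>}
     \<le> 4 * real (card \<Psi>) / real (card edges)"
proof -
  let ?q = "real (card \<Psi>)"
  let ?A = "\<lambda>(u, w). {\<kappa>. \<kappa> u = \<kappa> w} :: ('v \<Rightarrow> 'c option) set"
  have q: "0 < ?q"
    using ne finite_colours by (simp add: card_gt_0_iff)
  have "measure_pmf.prob (rctid_state V E \<Psi> ident (Suc 0)) {\<sigma>. all_coloured V \<sigma>} =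
    measure_pmf.prob first_candidates {\<kappa>. all_coloured V (adopt V E ident Map.empty \<kappa>)}"
    using ne by (simp add: rctid_state_1 vimage_def del: rctid_state.simps)
  also have "\<dots> \<le> measure_pmf.prob first_candidates
      {\<kappa> \<in> space (measure_pmf first_candidates). real (card {e \<in> edges. \<kappa> \<in> ?A e}) \<le> real (card edges) * (1 / ?q) / 2}"
  proof (rule measure_pmf.finite_measure_mono)
    show "{\<kappa>. all_coloured V (adopt V E ident Map.empty \<kappa>)} \<subseteq>
      {\<kappa> \<in> space (measure_pmf first_candidates). real (card {e \<in> edges. \<kappa> \<in> ?A e}) \<le> real (card edges) * (1 / ?q) / 2}"
    proof
      fix \<kappa> :: "'v \<Rightarrow> 'c option" assume "\<kappa> \<in> {\<kappa>. all_coloured V (adopt V E ident Map.empty \<kappa>)}"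
      then have "adopt V E ident Map.empty \<kappa> u \<noteq> None" if "u \<in> V" for u
        using that by (auto simp: all_coloured_def)
      then have "\<kappa> u \<noteq> \<kappa> w" if "(u, w) \<in> edges" for u w
        using that unfolding edges_def adopt_def by (smt (verit) case_prodD mem_Collect_eq)
      then have "{e \<in> edges. \<kappa> \<in> ?A e} = {}" by auto
      then have c0: "card {e \<in> edges. \<kappa> \<in> ?A e} = 0" by (simp only: card.empty)
      then show "\<kappa> \<in> {\<kappa> \<in> space (measure_pmf first_candidates).
          real (card {e \<in> edges. \<kappa> \<in> ?A e}) \<le> real (card edges) * (1 / ?q) / 2}"
        unfolding mem_Collect_eq c0 by simp
    qed
  qed simp
  also have "\<dots> \<le> 4 / (real (card edges) * (1 / ?q))"
  proof (rule measure_pmf.second_moment_count[OF finite_edges ed])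
    fix e assume "e \<in> edges"
    then show "measure_pmf.prob first_candidates (?A e) = 1 / ?q"
      using E_irrefl by (cases e) (auto simp: edges_def intro!: prob_same_candidate[OF ne])
  next
    fix e f assume ef: "e \<in> edges" "f \<in> edges" "e \<noteq> f"
    obtain u x w y where "e = (u, x)" "f = (w, y)" by fastforce
    moreover from this ef have "u \<noteq> x" "w \<noteq> y"
      using E_irrefl by (auto simp: edges_def)
    moreover from \<open>e = (u, x)\<close> \<open>f = (w, y)\<close> ef have "{u, x} \<noteq> {w, y}"
      by (auto simp: edges_def doubleton_eq_iff)
    ultimately show "measure_pmf.prob first_candidates (?A e \<inter> ?A f) \<le> (1 / ?q)\<^sup>2"
      using ef prob_same_candidate_twice[OF ne, of u x w y]
      by (simp add: edges_def Int_def)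
  qed (use q in auto)
  also have "\<dots> = 4 * ?q / real (card edges)"
    by simp
  finally show ?thesis .
qed

lemma uncoloured_after_1:
  assumes "\<kappa> u \<noteq> None" and "adopt V E ident Map.empty \<kappa> u = None"
  obtains x where "x \<in> V" "E u x" "ident x < ident u" "\<kappa> u = \<kappa> x"
  using assms by (auto simp: adopt_def split: if_splits)

text \<open>As \<open>w\<close> has the smaller ID, the conflict of \<open>w\<close> is not caused by \<open>u\<close>, so the conflicts of \<open>u\<close> and \<open>w\<close>
  happen on two distinct edges.\<close>

lemma prob_both_uncoloured_le:
  assumes ne: "\<Psi> \<noteq> {}" and e: "(u, w) \<in> edges"
  shows "measure_pmf.prob (rctid_state V E \<Psi> ident (Suc 0)) {\<sigma>. \<sigma> u = None \<and> \<sigma> w = None}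
     \<le> min 1 (real (vertex_degree V E u) * real (vertex_degree V E w) / (real (card \<Psi>))\<^sup>2)"
proof -
  let ?q = "real (card \<Psi>)"
  let ?X = "{x \<in> V. E u x}" and ?Y = "{y \<in> V. E w y \<and> ident y < ident w}"
  have uw: "u \<in> V" "w \<in> V" "E u w" "ident w < ident u"
    using e by (auto simp: edges_def)
  have fin: "finite ?X" "finite ?Y" using finite_V by auto
  have "measure_pmf.prob (rctid_state V E \<Psi> ident (Suc 0)) {\<sigma>. \<sigma> u = None \<and> \<sigma> w = None} =
    measure_pmf.prob first_candidates {\<kappa>. adopt V E ident Map.empty \<kappa> u = None \<and> adopt V E ident Map.empty \<kappa> w = None}"
    using ne by (simp add: rctid_state_1 vimage_def del: rctid_state.simps)
  also have "\<dots> \<le> measure_pmf.prob first_candidates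
      (\<Union>(x, y)\<in>?X \<times> ?Y. {\<kappa>. \<kappa> u = \<kappa> x \<and> \<kappa> w = \<kappa> y})"
  proof (rule measure_pmf.finite_measure_mono_AE)
    show "AE \<kappa> in measure_pmf first_candidates.
      \<kappa> \<in> {\<kappa>. adopt V E ident Map.empty \<kappa> u = None \<and> adopt V E ident Map.empty \<kappa> w = None} \<longrightarrow>
      \<kappa> \<in> (\<Union>(x, y)\<in>?X \<times> ?Y. {\<kappa>. \<kappa> u = \<kappa> x \<and> \<kappa> w = \<kappa> y})"
    proof (rule AE_pmfI, rule impI)
      fix \<kappa> assume \<kappa>: "\<kappa> \<in> set_pmf first_candidates" and
        un: "\<kappa> \<in> {\<kappa>. adopt V E ident Map.empty \<kappa> u = None \<and> adopt V E ident Map.empty \<kappa> w = None}"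
      have nn: "\<kappa> u \<noteq> None" "\<kappa> w \<noteq> None"
        using first_candidates_Some[OF ne \<kappa>] uw by (metis option.distinct(1))+
      obtain x where "x \<in> V" "E u x" "ident x < ident u" "\<kappa> u = \<kappa> x"
        using uncoloured_after_1[of \<kappa> u, OF nn(1)] un by auto
      moreover obtain y where "y \<in> V" "E w y" "ident y < ident w" "\<kappa> w = \<kappa> y"
        using uncoloured_after_1[of \<kappa> w, OF nn(2)] un by auto
      ultimately show "\<kappa> \<in> (\<Union>(x, y)\<in>?X \<times> ?Y. {\<kappa>. \<kappa> u = \<kappa> x \<and> \<kappa> w = \<kappa> y})"
        by auto
    qed
  qed simp
  also have "\<dots> \<le> (\<Sum>xy\<in>?X \<times> ?Y. measure_pmf.prob first_candidates
      (case xy of (x, y) \<Rightarrow> {\<kappa>. \<kappa> u = \<kappa> x \<and> \<kappa> w = \<kappa> y}))"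
    using fin by (intro measure_pmf.finite_measure_subadditive_finite) auto
  also have "\<dots> \<le> (\<Sum>xy\<in>?X \<times> ?Y. (1 / ?q)\<^sup>2)"
  proof (rule sum_mono)
    fix xy assume "xy \<in> ?X \<times> ?Y"
    then obtain x y where xy: "xy = (x, y)" "x \<in> V" "E u x" "y \<in> V" "E w y" "ident y < ident w"
      by auto
    have "{u, x} \<noteq> {w, y}"
      using uw xy E_irrefl by (auto simp: doubleton_eq_iff)
    then show "measure_pmf.prob first_candidates
      (case xy of (x, y) \<Rightarrow> {\<kappa>. \<kappa> u = \<kappa> x \<and> \<kappa> w = \<kappa> y}) \<le> (1 / ?q)\<^sup>2"
      using prob_same_candidate_twice[OF ne, of u x w y] uw xy E_irrefl by auto
  qed
  also have "\<dots> = real (card ?X) * real (card ?Y) / ?q\<^sup>2"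
    by (simp add: card_cartesian_product power_divide)
  also have "\<dots> \<le> real (vertex_degree V E u) * real (vertex_degree V E w) / ?q\<^sup>2"
    unfolding vertex_degree_def using finite_V
    by (intro divide_right_mono mult_left_mono) (auto intro!: card_mono)
  finally show ?thesis
    by (simp add: measure_pmf.prob_le_1)
qed

lemma card_palette_ge:
  "card \<Psi> - vertex_degree V E u \<le> card (palette V E \<Psi> \<sigma> u)"
proof -
  have "{c. \<exists>w\<in>V. E u w \<and> \<sigma> w = Some c} \<subseteq> (the \<circ> \<sigma>) ` {w \<in> V. E u w}"
    by force
  then have f: "finite {c. \<exists>w\<in>V. E u w \<and> \<sigma> w = Some c}"
    and "card {c. \<exists>w\<in>V. E u w \<and> \<sigma> w = Some c} \<le> vertex_degree V E u"
    unfolding vertex_degree_def using finite_V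
    by (auto intro: finite_subset order_trans[OF card_mono card_image_le])
  then show ?thesis
    unfolding palette_def using diff_card_le_card_Diff[OF f, of \<Psi>] by linarith
qed

text \<open>A colour that no neighbour even proposes stays in the palette, and
  \<open>card \<Psi> * (1 - 1 / card \<Psi>) ^ deg\<close> such colours are expected. By
  \<open>deg\<close> this is at least \<open>2 * c * card \<Psi>\<close>, so a small palette is a
  drop below half the mean.\<close>

lemma prob_small_palette_le:
  assumes c: "0 < c" and u: "u \<in> V"
    and deg: "2 * c \<le> (1 - 1 / real (card \<Psi>)) ^ vertex_degree V E u"
    and q: "2 \<le> card \<Psi>"
  shows "measure_pmf.prob (rctid_state V E \<Psi> ident (Suc 0)) {\<sigma>. real (card (palette V E \<Psi> \<sigma> u)) \<le> c * real (card \<Psi>)}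
     \<le> 2 / (real (card \<Psi>) * c)"
proof -
  let ?q = "real (card \<Psi>)"
  define N where "N = {w \<in> V. E u w}"
  define r where "r = (1 - 1 / ?q) ^ card N"
  let ?A = "\<lambda>i. {\<kappa>. \<forall>w\<in>N. \<kappa> w \<noteq> Some i} :: ('v \<Rightarrow> 'c option) set"
  have ne: "\<Psi> \<noteq> {}" and N: "N \<subseteq> V" using q by (auto simp: N_def)
  have r: "2 * c \<le> r" using deg by (simp add: r_def N_def vertex_degree_def)
  have avoid: "measure_pmf.prob first_candidates {\<kappa>. \<forall>w\<in>N. \<kappa> w \<notin> Some ` S} = (1 - real (card S) / ?q) ^ card N"
    if S: "S \<subseteq> \<Psi>" for S
  proof -
    have one: "measure_pmf.prob (map_pmf Some (pmf_of_set \<Psi>)) (- Some ` S) = 1 - real (card S) / ?q"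
    proof -
      have fS: "finite S" using S finite_colours by (rule finite_subset)
      have "measure_pmf.prob (map_pmf Some (pmf_of_set \<Psi>)) (- Some ` S) = real (card (\<Psi> \<inter> - S)) / ?q"
      proof -
        have "Some -` (- Some ` S) = - S" by auto
        then show ?thesis using ne finite_colours by (simp add: measure_pmf_of_set)
      qed
      also have "\<Psi> \<inter> - S = \<Psi> - S" by auto
      also have "real (card (\<Psi> - S)) / ?q = 1 - real (card S) / ?q"
        using S fS finite_colours q by (subst card_Diff_subset) (auto simp: of_nat_diff card_mono diff_divide_distrib)
      finally show ?thesis .
    qed
    have "{\<kappa>. \<forall>w\<in>N. \<kappa> w \<notin> Some ` S} = Pi V (\<lambda>w. if w \<in> N then - Some ` S else UNIV)"
      using N by (force simp: Pi_iff)
    then have "measure_pmf.prob first_candidates {\<kappa>. \<forall>w\<in>N. \<kappa> w \<notin> Some ` S} =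
      (\<Prod>w\<in>V. measure_pmf.prob (map_pmf Some (pmf_of_set \<Psi>)) (if w \<in> N then - Some ` S else UNIV))"
      unfolding first_candidates_def by (simp only: measure_Pi_pmf_Pi[OF finite_V])
    also have "\<dots> = (\<Prod>w\<in>N. measure_pmf.prob (map_pmf Some (pmf_of_set \<Psi>)) (- Some ` S))"
      using N finite_V by (intro prod.mono_neutral_cong_right) auto
    finally show ?thesis using one by simp
  qed
  have "measure_pmf.prob (rctid_state V E \<Psi> ident (Suc 0)) {\<sigma>. real (card (palette V E \<Psi> \<sigma> u)) \<le> c * ?q} =
    measure_pmf.prob first_candidates {\<kappa>. real (card (palette V E \<Psi> (adopt V E ident Map.empty \<kappa>) u)) \<le> c * ?q}"
    using ne by (simp add: rctid_state_1 vimage_def del: rctid_state.simps)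
  also have "\<dots> \<le> measure_pmf.prob first_candidates
      {\<kappa> \<in> space (measure_pmf first_candidates). real (card {i \<in> \<Psi>. \<kappa> \<in> ?A i}) \<le> ?q * r / 2}"
  proof (rule measure_pmf.finite_measure_mono)
    have "real (card {i \<in> \<Psi>. \<kappa> \<in> ?A i}) \<le> real (card (palette V E \<Psi> (adopt V E ident Map.empty \<kappa>) u))" for \<kappa>
      unfolding of_nat_le_iff
      by (rule card_mono) (use finite_colours in \<open>auto simp: palette_def adopt_def N_def split: if_splits\<close>)
    moreover have "c * ?q \<le> ?q * r / 2" using r q by simp
    ultimately show "{\<kappa>. real (card (palette V E \<Psi> (adopt V E ident Map.empty \<kappa>) u)) \<le> c * ?q} \<subseteq>
      {\<kappa> \<in> space (measure_pmf first_candidates). real (card {i \<in> \<Psi>. \<kappa> \<in> ?A i}) \<le> ?q * r / 2}"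
      by (smt (verit, best) Collect_mono UNIV_I mem_Collect_eq space_measure_pmf)
  qed simp
  also have "\<dots> \<le> 4 / (?q * r)"
  proof (rule measure_pmf.second_moment_count[OF finite_colours ne])
    show "0 < r" using c r by simp
    show "measure_pmf.prob first_candidates (?A i) = r" if "i \<in> \<Psi>" for i
      using avoid[of "{i}"] that by (simp add: r_def)
    fix i j assume ij: "i \<in> \<Psi>" "j \<in> \<Psi>" "i \<noteq> j"
    have eq: "?A i \<inter> ?A j = {\<kappa>. \<forall>w\<in>N. \<kappa> w \<notin> Some ` {i, j}}" by auto
    have "measure_pmf.prob first_candidates (?A i \<inter> ?A j) = (1 - 2 / ?q) ^ card N"
      unfolding eq using avoid[of "{i, j}"] ij by simp
    \<comment> \<open>Negative correlation: avoiding two colours is no likelier than if the two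
      events were independent. The bound \<open>2 \<le> card \<Psi>\<close> keeps the base
      \<open>1 - 2 / ?q\<close> nonnegative.\<close>
    also have "\<dots> \<le> ((1 - 1 / ?q)\<^sup>2) ^ card N"
      by (rule power_mono) (use q in \<open>auto simp: power2_eq_square field_simps\<close>)
    also have "\<dots> = r\<^sup>2"
      by (simp add: r_def power_mult[symmetric] mult.commute)
    finally show "measure_pmf.prob first_candidates (?A i \<inter> ?A j) \<le> r\<^sup>2" .
  qed auto
  also have "\<dots> \<le> 4 / (?q * (2 * c))"
    using r c q by (intro divide_left_mono mult_left_mono mult_pos_pos) auto
  finally show ?thesis by (simp add: mult.commute del: rctid_state.simps)
qed

text \<open>With nonempty palettes an uncoloured vertex fails only because a neighbour of smaller ID
  proposes the same colour, and this neighbour is itself uncoloured. Hence only edges with two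
  uncoloured ends count, each with probability at most \<open>1 / p\<close>.\<close>

lemma prob_round_uncoloured_le:
  assumes p: "0 < p" "\<And>u. u \<in> V \<Longrightarrow> p \<le> real (card (palette V E \<Psi> \<sigma> u))"
  shows "measure_pmf.prob (rctid_round V E \<Psi> ident \<sigma>) {\<sigma>'. \<not> all_coloured V \<sigma>'}
     \<le> (\<Sum>e\<in>edges. 1 / p * indicator {\<sigma>. \<sigma> (fst e) = None \<and> \<sigma> (snd e) = None} \<sigma>)"
proof -
  define U where "U = {u \<in> V. \<sigma> u = None}"
  define K where "K = candidates_pmf V E \<Psi> \<sigma>"
  define F where "F = {e \<in> edges. \<sigma> (fst e) = None \<and> \<sigma> (snd e) = None}"
  have fin: "finite U" "finite F" using finite_V finite_edges by (auto simp: U_def F_def)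
  have pal: "palette V E \<Psi> \<sigma> u \<noteq> {}" "finite (palette V E \<Psi> \<sigma> u)" if "u \<in> V" for u
  proof -
    have "0 < card (palette V E \<Psi> \<sigma> u)"
      using p(1) p(2)[OF that] by linarith
    then show "palette V E \<Psi> \<sigma> u \<noteq> {}" "finite (palette V E \<Psi> \<sigma> u)"
      by (simp_all add: card_gt_0_iff)
  qed
  have cand: "candidate_pmf V E \<Psi> \<sigma> u = map_pmf Some (pmf_of_set (palette V E \<Psi> \<sigma> u))" if "u \<in> V" for u
    using pal[OF that] by (simp add: candidate_pmf_def)
  have K_eq: "K = Pi_pmf U None (candidate_pmf V E \<Psi> \<sigma>)"
    by (simp add: K_def candidates_pmf_def U_def)
  have K_set: "\<kappa> u \<noteq> None" if "\<kappa> \<in> set_pmf K" "u \<in> U" for \<kappa> u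
  proof -
    have "\<kappa> u \<in> set_pmf (candidate_pmf V E \<Psi> \<sigma> u)"
      using that set_Pi_pmf[OF fin(1), of None "candidate_pmf V E \<Psi> \<sigma>"] by (auto simp: K_eq PiE_dflt_def)
    then show ?thesis using that cand[of u] pal[of u] by (auto simp: U_def)
  qed
  have K_out: "\<kappa> u = None" if "\<kappa> \<in> set_pmf K" "u \<notin> U" for \<kappa> u
    using that set_Pi_pmf_subset[OF fin(1), of None "candidate_pmf V E \<Psi> \<sigma>"] by (auto simp: K_eq)
  have "measure_pmf.prob (rctid_round V E \<Psi> ident \<sigma>) {\<sigma>'. \<not> all_coloured V \<sigma>'} =
    measure_pmf.prob K {\<kappa>. \<not> all_coloured V (adopt V E ident \<sigma> \<kappa>)}"
    by (simp add: rctid_round_def K_def vimage_def)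
  also have "\<dots> \<le> measure_pmf.prob K (\<Union>e\<in>F. {\<kappa>. \<kappa> (fst e) = \<kappa> (snd e)})"
  proof (rule measure_pmf.finite_measure_mono_AE)
    show "AE \<kappa> in measure_pmf K. \<kappa> \<in> {\<kappa>. \<not> all_coloured V (adopt V E ident \<sigma> \<kappa>)} \<longrightarrow>
        \<kappa> \<in> (\<Union>e\<in>F. {\<kappa>. \<kappa> (fst e) = \<kappa> (snd e)})"
    proof (rule AE_pmfI, rule impI)
      fix \<kappa> assume \<kappa>: "\<kappa> \<in> set_pmf K" and "\<kappa> \<in> {\<kappa>. \<not> all_coloured V (adopt V E ident \<sigma> \<kappa>)}"
      then obtain u where u: "u \<in> V" "adopt V E ident \<sigma> \<kappa> u = None"
        by (auto simp: all_coloured_def)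
      then have "u \<in> U" by (auto simp: U_def adopt_def split: if_splits)
      with K_set[OF \<kappa>] have nn: "\<kappa> u \<noteq> None" by auto
      then obtain w where w: "w \<in> V" "E u w" "ident w < ident u" "\<kappa> w = \<kappa> u"
        using u by (auto simp: adopt_def split: if_splits)
      \<comment> \<open>Coloured vertices draw no candidate: outside \<open>U\<close> the value is
        the default \<open>None\<close>, which differs from the proposal of
        \<open>u\<close>.\<close>
      then have "w \<in> U" using K_out[OF \<kappa>, of w] nn by metis
      then show "\<kappa> \<in> (\<Union>e\<in>F. {\<kappa>. \<kappa> (fst e) = \<kappa> (snd e)})"
        using w u \<open>u \<in> U\<close> by (intro UN_I[of "(u, w)"]) (auto simp: F_def edges_def U_def)
    qed
  qed simp
  also have "\<dots> \<le> (\<Sum>e\<in>F. measure_pmf.prob K {\<kappa>. \<kappa> (fst e) = \<kappa> (snd e)})"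
    using fin by (intro measure_pmf.finite_measure_subadditive_finite) auto
  also have "\<dots> \<le> (\<Sum>e\<in>F. 1 / p)"
  proof (rule sum_mono)
    fix e assume e: "e \<in> F"
    obtain u w where [simp]: "e = (u, w)" by fastforce
    have uw: "u \<in> U" "w \<in> U" "u \<noteq> w" "u \<in> V"
      using e by (auto simp: F_def edges_def U_def)
    have "pmf (candidate_pmf V E \<Psi> \<sigma> u) y \<le> 1 / p" for y
    proof -
      have "pmf (candidate_pmf V E \<Psi> \<sigma> u) y \<le> 1 / real (card (palette V E \<Psi> \<sigma> u))"
        using pal[OF uw(4)] uw(4)
        by (cases y) (auto simp: cand pmf_map_inj' indicator_def pmf_eq_0_set_pmf[THEN iffD2])
      also have "\<dots> \<le> 1 / p"
        using p(1) p(2)[OF uw(4)] by (intro divide_left_mono) auto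
      finally show ?thesis .
    qed
    then have "measure_pmf.prob K {\<kappa>. \<kappa> u = \<kappa> w \<and> True} \<le> 1 / p * measure_pmf.prob K {\<kappa>. True}"
      unfolding K_eq by (intro prob_Pi_coord_le fin) (use uw in auto)
    then show "measure_pmf.prob K {\<kappa>. \<kappa> (fst e) = \<kappa> (snd e)} \<le> 1 / p"
      by simp
  qed
  also have "\<dots> = (\<Sum>e\<in>edges. 1 / p * indicator {\<sigma>. \<sigma> (fst e) = None \<and> \<sigma> (snd e) = None} \<sigma>)"
    unfolding F_def using finite_edges
    by (subst sum.inter_filter) (auto intro!: sum.cong simp: indicator_def)
  finally show ?thesis .
qed

text \<open>The subtracted terms account for a first round without conflict, for a palette falling
  to the share \<open>c\<close>, and for a conflict between two vertices left over for the second
  round. The last one gains a factor \<open>1 / (c * card \<Psi>)\<close> over the probability that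
  both ends are left over.\<close>

theorem prob_exactly_2_ge:
  assumes c: "0 < c" "c \<le> 1 / 2" and q: "2 \<le> card \<Psi>" and ed: "edges \<noteq> {}"
    and deg: "\<And>u. u \<in> V \<Longrightarrow> 2 * c \<le> (1 - 1 / real (card \<Psi>)) ^ vertex_degree V E u"
  shows "1 - 4 * real (card \<Psi>) / real (card edges)
      - real (card {u \<in> V. card \<Psi> \<le> 2 * vertex_degree V E u}) * (2 / (real (card \<Psi>) * c))
      - (\<Sum>(u, w)\<in>edges. min 1 (real (vertex_degree V E u) * real (vertex_degree V E w) / (real (card \<Psi>))\<^sup>2))
          / (c * real (card \<Psi>))
    \<le> rctid_prob V E \<Psi> ident (terminates_after_exactly V 2)"
proof -
  let ?q = "real (card \<Psi>)" and ?M = "rctid V E \<Psi> ident" and ?S = "rctid_state V E \<Psi> ident"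
  let ?bad = "\<lambda>\<sigma>. \<exists>u\<in>V. real (card (palette V E \<Psi> \<sigma> u)) \<le> c * ?q"
  let ?B = "{u \<in> V. card \<Psi> \<le> 2 * vertex_degree V E u}"
  interpret M: prob_space ?M by (rule prob_space_rctid)
  have ne: "\<Psi> \<noteq> {}" and V: "V \<noteq> {}" using q ed by (auto simp: edges_def)
  have "measure_pmf.prob (?S 1) {\<sigma>. ?bad \<sigma>} \<le> measure_pmf.prob (?S 1)
      (\<Union>u\<in>?B. {\<sigma>. real (card (palette V E \<Psi> \<sigma> u)) \<le> c * ?q})"
  proof (intro measure_pmf.finite_measure_mono subsetI)
    fix \<sigma> assume "\<sigma> \<in> {\<sigma>. ?bad \<sigma>}"
    then obtain u where u: "u \<in> V" "real (card (palette V E \<Psi> \<sigma> u)) \<le> c * ?q" by auto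
    \<comment> \<open>For \<open>c \<le> 1 / 2\<close> a vertex of degree below half the number of
      colours cannot have a small palette; only the few others enter the union bound.\<close>
    have "c * ?q \<le> 1 / 2 * ?q" using c by (intro mult_right_mono) auto
    then have "card \<Psi> \<le> 2 * vertex_degree V E u"
      using u(2) card_palette_ge[of u \<sigma>] by linarith
    then show "\<sigma> \<in> (\<Union>u\<in>?B. {\<sigma>. real (card (palette V E \<Psi> \<sigma> u)) \<le> c * ?q})"
      using u by auto
  qed simp
  also have "\<dots> \<le> (\<Sum>u\<in>?B. measure_pmf.prob (?S 1) {\<sigma>. real (card (palette V E \<Psi> \<sigma> u)) \<le> c * ?q})"
    using finite_V by (intro measure_pmf.finite_measure_subadditive_finite) auto
  also have "\<dots> \<le> (\<Sum>u\<in>?B. 2 / (?q * c))"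
    using prob_small_palette_le[OF c(1) _ deg q] by (intro sum_mono) (simp del: rctid_state.simps)
  finally have bad: "measure_pmf.prob (?S 1) {\<sigma>. ?bad \<sigma>} \<le> real (card ?B) * (2 / (?q * c))"
    by simp
  have "measure_pmf.prob (?S 2) {\<sigma>. \<not> all_coloured V \<sigma>} =
     measure_pmf.prob (bind_pmf (?S 1) (rctid_round V E \<Psi> ident)) {\<sigma>. \<not> all_coloured V \<sigma>}"
    by (simp add: numeral_2_eq_2)
  also have "\<dots> \<le> measure_pmf.prob (?S 1) {\<sigma>. ?bad \<sigma>} +
     (\<Sum>e\<in>edges. 1 / (c * ?q) * measure_pmf.prob (?S 1) {\<sigma>. \<sigma> (fst e) = None \<and> \<sigma> (snd e) = None})"
    using c q by (intro measure_bind_pmf_union_le finite_edges prob_round_uncoloured_le)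
       (auto intro: less_imp_le simp: not_le)
  also have "\<dots> \<le> real (card ?B) * (2 / (?q * c)) + (\<Sum>e\<in>edges. 1 / (c * ?q) *
      min 1 (real (vertex_degree V E (fst e)) * real (vertex_degree V E (snd e)) / ?q\<^sup>2))"
    using bad c prob_both_uncoloured_le[OF ne]
    by (intro add_mono sum_mono mult_left_mono) (auto simp del: rctid_state.simps simp: split_beta)
  also have "\<dots> = real (card ?B) * (2 / (?q * c)) +
     (\<Sum>(u, w)\<in>edges. min 1 (real (vertex_degree V E u) * real (vertex_degree V E w) / ?q\<^sup>2)) / (c * ?q)"
    by (simp add: split_beta sum_divide_distrib)
  finally have s2: "measure_pmf.prob (?S 2) {\<sigma>. \<not> all_coloured V \<sigma>} \<le> \<dots>" .
  have s1: "measure_pmf.prob (?S 1) {\<sigma>. all_coloured V \<sigma>} \<le> 4 * ?q / real (card edges)"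
    using prob_coloured_after_1_le[OF ne ed] by (simp del: rctid_state.simps)
  have s0: "measure_pmf.prob (?S 0) {\<sigma>. all_coloured V \<sigma>} = 0"
    using V by (simp add: all_coloured_def)
  have ex: "{\<tau>. terminates_after_exactly V 2 \<tau>} =
     UNIV - (({\<tau>. \<not> all_coloured V (\<tau> 2)} \<union> {\<tau>. all_coloured V (\<tau> 1)}) \<union> {\<tau>. all_coloured V (\<tau> 0)})"
    by (auto simp: terminates_after_exactly_def less_2_cases_iff)
  have "1 - rctid_prob V E \<Psi> ident (terminates_after_exactly V 2) =
     measure ?M (({\<tau>. \<not> all_coloured V (\<tau> 2)} \<union> {\<tau>. all_coloured V (\<tau> 1)}) \<union> {\<tau>. all_coloured V (\<tau> 0)})"
    unfolding rctid_prob_def using M.prob_compl[of "({\<tau>. \<not> all_coloured V (\<tau> 2)} \<union> {\<tau>. all_coloured V (\<tau> 1)}) \<union> {\<tau>. all_coloured V (\<tau> 0)}"]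
    by (simp add: ex)
  also have "\<dots> \<le> measure ?M {\<tau>. \<not> all_coloured V (\<tau> 2)} + measure ?M {\<tau>. all_coloured V (\<tau> 1)}
      + measure ?M {\<tau>. all_coloured V (\<tau> 0)}"
    by (intro order_trans[OF measure_Un_le] add_mono) auto
  finally show ?thesis
    using s0 s1 s2
      measure_rctid_state[of V E \<Psi> ident "\<lambda>\<sigma>. \<not> all_coloured V \<sigma>" 2]
      measure_rctid_state[of V E \<Psi> ident "all_coloured V" 1]
      measure_rctid_state[of V E \<Psi> ident "all_coloured V" 0]
    by linarith
qed

text \<open>The pairs of adjacent vertices are split at the degree \<open>T\<close>: pairs above it are few by Markov's
  inequality, and the others have a small product of degrees.\<close>

lemma prob_exactly_2_ge_moments:
  fixes T :: real
  defines "S \<equiv> (\<Sum>u\<in>V. (real (vertex_degree V E u))\<^sup>2)"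
  assumes c: "0 < c" "c \<le> 1 / 2" and q: "2 \<le> card \<Psi>" and ed: "edges \<noteq> {}" and T: "0 < T"
    and deg: "\<And>u. u \<in> V \<Longrightarrow> 2 * c \<le> (1 - 1 / real (card \<Psi>)) ^ vertex_degree V E u"
  shows "1 - 4 * real (card \<Psi>) / real (card edges) - 8 * S / (c * real (card \<Psi>) ^ 3)
      - S\<^sup>2 / (T ^ 4 * c * real (card \<Psi>)) - T * S / (c * real (card \<Psi>) ^ 3)
    \<le> rctid_prob V E \<Psi> ident (terminates_after_exactly V 2)"
proof -
  let ?q = "real (card \<Psi>)" and ?d = "\<lambda>u. real (vertex_degree V E u)"
  have q0: "0 < ?q" using q by simp
  have markov: "real (card {u \<in> V. t \<le> ?d u}) \<le> S / t\<^sup>2" if t: "0 < t" for t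
  proof -
    have "real (card {u \<in> V. t \<le> ?d u}) * t\<^sup>2 = (\<Sum>u\<in>{u \<in> V. t \<le> ?d u}. t\<^sup>2)"
      by simp
    also have "\<dots> \<le> (\<Sum>u\<in>{u \<in> V. t \<le> ?d u}. (?d u)\<^sup>2)"
      using t by (intro sum_mono power_mono) auto
    also have "\<dots> \<le> S"
      unfolding S_def using finite_V by (intro sum_mono2) auto
    finally show ?thesis using t by (simp add: pos_le_divide_eq)
  qed
  have "real (card {u \<in> V. card \<Psi> \<le> 2 * vertex_degree V E u}) \<le> real (card {u \<in> V. ?q / 2 \<le> ?d u})"
    using finite_V by (intro of_nat_mono card_mono) auto
  also have "\<dots> \<le> 4 * S / ?q\<^sup>2"
    using markov[of "?q / 2"] q0 by (simp add: power_divide mult.commute)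
  finally have "real (card {u \<in> V. card \<Psi> \<le> 2 * vertex_degree V E u}) * (2 / (?q * c)) \<le> 4 * S / ?q\<^sup>2 * (2 / (?q * c))"
    using c q0 by (intro mult_right_mono) auto
  also have "\<dots> = 8 * S / (c * ?q ^ 3)"
    by (simp add: power2_eq_square power3_eq_cube mult_ac)
  finally have 1: "real (card {u \<in> V. card \<Psi> \<le> 2 * vertex_degree V E u}) * (2 / (?q * c)) \<le> 8 * S / (c * ?q ^ 3)" .
  define H where "H = {u \<in> V. T \<le> ?d u}"
  have fH: "finite H" using finite_V by (simp add: H_def)
  have "(\<Sum>(u, w)\<in>edges. min 1 (?d u * ?d w / ?q\<^sup>2)) \<le>
     (\<Sum>e\<in>edges. indicator (H \<times> H) e + T / ?q\<^sup>2 * (case e of (u, w) \<Rightarrow> ?d u + ?d w))"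
  proof (rule sum_mono)
    fix e assume e: "e \<in> edges"
    obtain u w where [simp]: "e = (u, w)" by fastforce
    have nn: "0 \<le> T / ?q\<^sup>2 * (?d u + ?d w)" using T by simp
    show "(case e of (u, w) \<Rightarrow> min 1 (?d u * ?d w / ?q\<^sup>2)) \<le>
      indicator (H \<times> H) e + T / ?q\<^sup>2 * (case e of (u, w) \<Rightarrow> ?d u + ?d w)"
    proof (cases "e \<in> H \<times> H")
      case True then show ?thesis using nn by simp
    next
      case False
      then have "?d u \<le> T \<or> ?d w \<le> T" using e by (auto simp: H_def edges_def)
      \<comment> \<open>If one degree is at most \<open>T\<close>, the product is at most
        \<open>T\<close> times the other and hence \<open>T\<close> times their sum, whose total
        over all edges is evaluated by \<open>sum_edges\<close>.\<close>
      then have "?d u * ?d w \<le> T * (?d u + ?d w)"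
      proof
        assume "?d u \<le> T"
        then have "?d u * ?d w \<le> T * ?d w" by (intro mult_right_mono) auto
        also have "\<dots> \<le> T * (?d u + ?d w)" using T by (intro mult_left_mono) auto
        finally show ?thesis .
      next
        assume "?d w \<le> T"
        then have "?d u * ?d w \<le> ?d u * T" by (intro mult_left_mono) auto
        also have "\<dots> \<le> T * (?d u + ?d w)" using T by (simp add: algebra_simps)
        finally show ?thesis .
      qed
      then have "?d u * ?d w / ?q\<^sup>2 \<le> T * (?d u + ?d w) / ?q\<^sup>2"
        by (intro divide_right_mono) auto
      then show ?thesis using False by simp
    qed
  qed
  also have "\<dots> = real (card (edges \<inter> H \<times> H)) + T / ?q\<^sup>2 * S"
  proof -
    have "(\<Sum>e\<in>edges. indicat_real (H \<times> H) e) = real (card (edges \<inter> H \<times> H))"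
      using finite_edges by (simp add: indicator_def sum.If_cases)
    then show ?thesis
      unfolding sum.distrib sum_distrib_left[symmetric] sum_edges[of ?d] S_def
      by (simp add: power2_eq_square)
  qed
  also have "\<dots> \<le> (S / T\<^sup>2)\<^sup>2 + T / ?q\<^sup>2 * S"
  proof -
    have "real (card (edges \<inter> H \<times> H)) \<le> real (card (H \<times> H))"
      using fH by (intro of_nat_mono card_mono) auto
    also have "\<dots> = (real (card H))\<^sup>2"
      by (simp add: card_cartesian_product power2_eq_square)
    also have "\<dots> \<le> (S / T\<^sup>2)\<^sup>2"
      using markov[OF T] by (intro power_mono) (auto simp: H_def)
    finally show ?thesis by simp
  qed
  finally have "(\<Sum>(u, w)\<in>edges. min 1 (?d u * ?d w / ?q\<^sup>2)) / (c * ?q) \<le> ((S / T\<^sup>2)\<^sup>2 + T / ?q\<^sup>2 * S) / (c * ?q)"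
    using c q0 by (intro divide_right_mono) auto
  also have "\<dots> = S\<^sup>2 / (T ^ 4 * c * ?q) + T * S / (c * ?q ^ 3)"
    by (simp add: add_divide_distrib power_divide power2_eq_square power3_eq_cube power4_eq_xxxx mult_ac)
  finally show ?thesis
    using prob_exactly_2_ge[OF c q ed deg] 1 by linarith
qed

end

section \<open>Executions that never terminate\<close>

context rctid_graph
begin

lemma candidates_pmf_cases:
  assumes \<kappa>: "\<kappa> \<in> set_pmf (candidates_pmf V E \<Psi> \<sigma>)" and u: "\<kappa> u = Some c"
  shows "u \<in> V \<and> \<sigma> u = None \<and> c \<in> palette V E \<Psi> \<sigma> u"
proof -
  let ?U = "{u \<in> V. \<sigma> u = None}"
  have fin: "finite ?U" using finite_V by simp
  have S: "set_pmf (candidates_pmf V E \<Psi> \<sigma>) = PiE_dflt ?U None (set_pmf \<circ> candidate_pmf V E \<Psi> \<sigma>)"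
    unfolding candidates_pmf_def by (rule set_Pi_pmf[OF fin])
  have U: "u \<in> ?U" using \<kappa> u unfolding S PiE_dflt_def by force
  then have "Some c \<in> set_pmf (candidate_pmf V E \<Psi> \<sigma> u)"
    using \<kappa> u unfolding S PiE_dflt_def by force
  then have "c \<in> palette V E \<Psi> \<sigma> u"
    using finite_colours by (auto simp: candidate_pmf_def palette_def split: if_splits)
  then show ?thesis using U by simp
qed

text \<open>Describes a round by its two states alone. The last conjunct replaces candidates by
  outcomes: a neighbour that ends up with \<open>c\<close> in this round must have proposed
  it.\<close>

lemma rctid_round_cases:
  assumes \<sigma>': "\<sigma>' \<in> set_pmf (rctid_round V E \<Psi> ident \<sigma>)" and u: "\<sigma>' u = Some c"
  shows "\<sigma> u = Some c \<or> u \<in> V \<and> \<sigma> u = None \<and> c \<in> palette V E \<Psi> \<sigma> u \<and>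
    (\<forall>w\<in>V. E u w \<longrightarrow> \<sigma> w = None \<longrightarrow> ident w < ident u \<longrightarrow> \<sigma>' w \<noteq> Some c)"
proof -
  obtain \<kappa> where \<kappa>: "\<kappa> \<in> set_pmf (candidates_pmf V E \<Psi> \<sigma>)" and \<sigma>'_def: "\<sigma>' = adopt V E ident \<sigma> \<kappa>"
    using \<sigma>' by (auto simp: rctid_round_def)
  show ?thesis
  proof (cases "\<sigma> u = None")
    case True
    then have a: "\<kappa> u = Some c" "\<forall>w\<in>V. E u w \<longrightarrow> ident w < ident u \<longrightarrow> \<kappa> w \<noteq> Some c"
      using u by (auto simp: \<sigma>'_def adopt_def split: if_splits)
    have "\<sigma>' w = None \<or> \<sigma>' w = \<kappa> w" if "\<sigma> w = None" for w
      using that by (simp add: \<sigma>'_def adopt_def)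
    then have "\<sigma>' w \<noteq> Some c" if "w \<in> V" "E u w" "\<sigma> w = None" "ident w < ident u" for w
      using a(2) that by (metis option.distinct(1))
    then show ?thesis
      using candidates_pmf_cases[OF \<kappa> a(1)] by blast
  next
    case False
    then show ?thesis using u by (auto simp: \<sigma>'_def adopt_def)
  qed
qed

lemma rctid_round_mono:
  assumes "\<sigma>' \<in> set_pmf (rctid_round V E \<Psi> ident \<sigma>)" and "\<sigma> u = Some c"
  shows "\<sigma>' u = Some c"
  using assms by (auto simp: rctid_round_def adopt_def)

definition proper :: "('v, 'c) colouring \<Rightarrow> bool" where
  "proper \<sigma> \<longleftrightarrow> (\<forall>u\<in>V. \<forall>c. \<sigma> u = Some c \<longrightarrow> c \<in> \<Psi> \<and> (\<forall>w\<in>V. E u w \<longrightarrow> \<sigma> w \<noteq> Some c))"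

lemma proper_colour: "proper \<sigma> \<Longrightarrow> u \<in> V \<Longrightarrow> \<sigma> u = Some c \<Longrightarrow> c \<in> \<Psi>"
  unfolding proper_def by blast

lemma proper_adjacent:
  "proper \<sigma> \<Longrightarrow> u \<in> V \<Longrightarrow> w \<in> V \<Longrightarrow> E u w \<Longrightarrow> \<sigma> u = Some c \<Longrightarrow> \<sigma> w \<noteq> Some c"
  unfolding proper_def by blast

text \<open>A clash with an earlier colour is excluded by the palette, a clash within the round by
  the IDs: being distinct, they make one of the two ends yield.\<close>

lemma rctid_round_proper:
  assumes \<sigma>': "\<sigma>' \<in> set_pmf (rctid_round V E \<Psi> ident \<sigma>)" and pr: "proper \<sigma>"
  shows "proper \<sigma>'"
  unfolding proper_def
proof (intro ballI allI impI conjI)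
  fix u c assume u: "u \<in> V" "\<sigma>' u = Some c"
  note cu = rctid_round_cases[OF \<sigma>' u(2)]
  then consider "\<sigma> u = Some c" | "c \<in> palette V E \<Psi> \<sigma> u" by blast
  then show "c \<in> \<Psi>"
  proof cases
    case 1 then show ?thesis using proper_colour[OF pr u(1)] by simp
  next
    case 2 then show ?thesis by (simp add: palette_def)
  qed
  fix w assume w: "w \<in> V" "E u w"
  show "\<sigma>' w \<noteq> Some c"
  proof
    assume w': "\<sigma>' w = Some c"
    note cw = rctid_round_cases[OF \<sigma>' w']
    have "ident u \<noteq> ident w"
      using inj_ident u w E_irrefl by (auto dest: inj_onD)
    show False
    proof (cases "\<sigma> u = None")
      case True
      then have u0: "c \<in> palette V E \<Psi> \<sigma> u"
          "\<And>w. w \<in> V \<Longrightarrow> E u w \<Longrightarrow> \<sigma> w = None \<Longrightarrow> ident w < ident u \<Longrightarrow> \<sigma>' w \<noteq> Some c"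
        using cu by auto
      then have "\<sigma> w \<noteq> Some c" using w by (auto simp: palette_def)
      then have w0: "\<sigma> w = None"
          "\<And>x. x \<in> V \<Longrightarrow> E w x \<Longrightarrow> \<sigma> x = None \<Longrightarrow> ident x < ident w \<Longrightarrow> \<sigma>' x \<noteq> Some c"
        using cw by auto
      show False
        using u0(2)[OF w w0(1)] w0(2)[OF u(1) E_sym[OF w(2)] True] u(2) w' \<open>ident u \<noteq> ident w\<close> by linarith
    next
      case False
      then have u0: "\<sigma> u = Some c" using cu by auto
      then have "\<sigma> w \<noteq> Some c" using proper_adjacent[OF pr u(1) w] by simp
      then have "c \<in> palette V E \<Psi> \<sigma> w" using cw by auto
      then show False using u0 u(1) E_sym[OF w(2)] by (auto simp: palette_def)
    qed
  qed
qed

lemma never_terminates_sets: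
  "{\<tau>. never_terminates V \<tau>} \<in> sets (rctid V E \<Psi> ident)"
proof -
  have "{\<tau>. never_terminates V \<tau>} = (\<Union>v\<in>V. \<Inter>t. {\<tau>. \<tau> t v = None})"
    by (auto simp: never_terminates_def)
  also have "\<dots> \<in> sets (rctid V E \<Psi> ident)"
    using finite_V by (intro sets.finite_UN sets.countable_INT' sets_rctid_component) auto
  finally show ?thesis .
qed

text \<open>Colours are never withdrawn, so palettes only shrink, and a vertex that is uncoloured
  with an empty palette remains so. One bad state after the first round decides the whole
  trajectory.\<close>

lemma rctid_prob_never_ge:
  "measure_pmf.prob (rctid_state V E \<Psi> ident (Suc 0)) {\<sigma>. \<exists>v\<in>V. \<sigma> v = None \<and> palette V E \<Psi> \<sigma> v = {}}
     \<le> rctid_prob V E \<Psi> ident (never_terminates V)"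
proof -
  let ?M = "rctid V E \<Psi> ident"
  let ?stuck = "\<lambda>\<sigma> v. \<sigma> v = None \<and> palette V E \<Psi> \<sigma> v = {}"
  interpret M: prob_space ?M by (rule prob_space_rctid)
  have "measure ?M {\<tau>. \<exists>v\<in>V. ?stuck (\<tau> (Suc 0)) v} \<le> measure ?M {\<tau>. never_terminates V \<tau>}"
  proof (rule M.finite_measure_mono_AE)
    show "AE \<tau> in ?M. \<tau> \<in> {\<tau>. \<exists>v\<in>V. ?stuck (\<tau> (Suc 0)) v} \<longrightarrow> \<tau> \<in> {\<tau>. never_terminates V \<tau>}"
      using AE_rctid_step[of V E \<Psi> ident] AE_rctid_start[of V E \<Psi> ident]
    proof eventually_elim
      fix \<tau> assume step: "\<forall>t. \<tau> (Suc t) \<in> set_pmf (rctid_round V E \<Psi> ident (\<tau> t))" and start: "\<tau> 0 = Map.empty"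
      have "never_terminates V \<tau>" if v: "v \<in> V" "?stuck (\<tau> (Suc 0)) v" for v
      proof -
        have "?stuck (\<tau> (Suc t)) v" for t
        proof (induction t)
          case 0 show ?case using v by simp
        next
          case (Suc t)
          have "palette V E \<Psi> (\<tau> (Suc (Suc t))) v \<subseteq> palette V E \<Psi> (\<tau> (Suc t)) v"
          proof
            fix c assume c: "c \<in> palette V E \<Psi> (\<tau> (Suc (Suc t))) v"
            have "\<tau> (Suc t) w \<noteq> Some c" if "w \<in> V" "E v w" for w
              using c that rctid_round_mono[OF step[rule_format, of "Suc t"], of w c]
              by (auto simp: palette_def)
            then show "c \<in> palette V E \<Psi> (\<tau> (Suc t)) v"
              using c by (auto simp: palette_def)
          qed
          moreover have "\<tau> (Suc (Suc t)) v = None"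
          proof (rule ccontr)
            assume "\<tau> (Suc (Suc t)) v \<noteq> None"
            then obtain c where "\<tau> (Suc (Suc t)) v = Some c" by auto
            from rctid_round_cases[OF step[rule_format] this]
            have "\<tau> (Suc t) v = Some c \<or> c \<in> palette V E \<Psi> (\<tau> (Suc t)) v" by blast
            then show False using Suc.IH by simp
          qed
          ultimately show ?case using Suc.IH by auto
        qed
        then have "\<tau> t v = None" for t
          using start by (cases t) auto
        then show ?thesis using v by (auto simp: never_terminates_def)
      qed
      then show "\<tau> \<in> {\<tau>. \<exists>v\<in>V. ?stuck (\<tau> (Suc 0)) v} \<longrightarrow> \<tau> \<in> {\<tau>. never_terminates V \<tau>}"
        by auto
    qed
  qed (rule never_terminates_sets)
  then show ?thesis
    using measure_rctid_state[of V E \<Psi> ident "\<lambda>\<sigma>. \<exists>v\<in>V. ?stuck \<sigma> v" "Suc 0"]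
    by (simp add: rctid_prob_def del: rctid_state.simps)
qed

text \<open>Along almost every trajectory all colourings are proper. If each member of the clique
  were coloured at some time, then at the latest of these times all would carry distinct colours,
  more than there are.\<close>

lemma rctid_prob_never_clique:
  assumes H: "H \<subseteq> V" "card \<Psi> < card H" and clique: "\<And>u w. u \<in> H \<Longrightarrow> w \<in> H \<Longrightarrow> u \<noteq> w \<Longrightarrow> E u w"
  shows "rctid_prob V E \<Psi> ident (never_terminates V) = 1"
proof -
  let ?M = "rctid V E \<Psi> ident"
  interpret M: prob_space ?M by (rule prob_space_rctid)
  have fH: "finite H" using H finite_V by (auto intro: finite_subset)
  have "AE \<tau> in ?M. \<tau> \<in> {\<tau>. never_terminates V \<tau>}"
    using AE_rctid_step[of V E \<Psi> ident] AE_rctid_start[of V E \<Psi> ident]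
  proof eventually_elim
    fix \<tau> assume step: "\<forall>t. \<tau> (Suc t) \<in> set_pmf (rctid_round V E \<Psi> ident (\<tau> t))" and start: "\<tau> 0 = Map.empty"
    have pr: "proper (\<tau> t)" for t
    proof (induction t)
      case 0 show ?case by (simp add: start proper_def)
    next
      case (Suc t) then show ?case by (rule rctid_round_proper[OF step[rule_format]])
    qed
    show "\<tau> \<in> {\<tau>. never_terminates V \<tau>}"
    proof (rule ccontr)
      assume "\<tau> \<notin> {\<tau>. never_terminates V \<tau>}"
      then have "\<forall>v\<in>H. \<exists>t. \<tau> t v \<noteq> None" using H by (auto simp: never_terminates_def)
      then obtain T where T: "\<And>v. v \<in> H \<Longrightarrow> \<tau> (T v) v \<noteq> None" by metis
      define N where "N = Max (T ` H)"
      have mono1: "\<tau> (Suc t) v \<noteq> None" if "\<tau> t v \<noteq> None" for t v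
        using rctid_round_mono[OF step[rule_format, of t], of v] that by auto
      have mono: "\<tau> t v \<noteq> None" if "\<tau> s v \<noteq> None" "s \<le> t" for s t v
        using that(2,1) by (induction rule: dec_induct) (simp_all add: mono1)
      have some: "\<tau> N v \<noteq> None" if "v \<in> H" for v
        using T[OF that] that fH mono[of "T v" v N] by (auto simp: N_def)
      have "inj_on (the \<circ> \<tau> N) H"
      proof (rule inj_onI, rule ccontr)
        fix u w assume uw: "u \<in> H" "w \<in> H" "(the \<circ> \<tau> N) u = (the \<circ> \<tau> N) w" "u \<noteq> w"
        obtain c where "\<tau> N u = Some c" "\<tau> N w = Some c"
          using some[OF uw(1)] some[OF uw(2)] uw(3) by auto
        then show False
          using proper_adjacent[OF pr[of N] _ _ clique[OF uw(1,2,4)]] uw H by blast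
      qed
      moreover have "(the \<circ> \<tau> N) ` H \<subseteq> \<Psi>"
        using some proper_colour[OF pr[of N]] H by fastforce
      ultimately have "card H \<le> card \<Psi>"
        using card_inj_on_le finite_colours by blast
      then show False using H by simp
    qed
  qed
  then have "measure ?M {\<tau>. never_terminates V \<tau>} = 1"
    by (subst M.prob_eq_1[OF never_terminates_sets]) auto
  then show ?thesis by (simp add: rctid_prob_def)
qed

end

lemma exp_le_1_2x: "0 \<le> x \<Longrightarrow> x \<le> 1 \<Longrightarrow> exp x \<le> 1 + 2 * (x::real)"
proof -
  assume x: "0 \<le> x" "x \<le> 1"
  have "exp x \<le> 1 + x + x\<^sup>2"
    using exp_bound[OF x] .
  also have "x\<^sup>2 \<le> x" using x by (simp add: power2_eq_square mult_left_le)
  finally show ?thesis by simp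
qed

section \<open>Colours adopted in the neighbourhood of a hub\<close>

context rctid_graph
begin

text \<open>The Chernoff method with exponential parameter \<open>1 / b\<close>.\<close>

lemma prob_colour_weight_le:
  assumes c: "c \<in> \<Psi>" and X: "X \<subseteq> V" and b: "0 < b"
    and f: "\<And>x. x \<in> X \<Longrightarrow> 0 \<le> f x \<and> f x \<le> b"
  shows "measure_pmf.prob first_candidates {\<kappa>. t \<le> (\<Sum>x\<in>{x \<in> X. \<kappa> x = Some c}. f x)}
     \<le> exp (2 * (\<Sum>x\<in>X. f x) / (b * real (card \<Psi>)) - t / b)"
proof -
  let ?q = "real (card \<Psi>)" and ?p = "map_pmf Some (pmf_of_set \<Psi>)"
  define g where "g x y = (if x \<in> X \<and> y = Some c then exp (f x / b) else 1)" for x y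
  have ne: "\<Psi> \<noteq> {}" and q: "0 < ?q" using c finite_colours by (auto simp: card_gt_0_iff)
  have fX: "finite X" using X finite_V by (rule finite_subset)
  have int: "integrable (measure_pmf ?p) h" for h :: "'c option \<Rightarrow> real"
    by (rule integrable_measure_pmf_finite) (use ne finite_colours in simp)
  have one: "measure_pmf.expectation ?p (g x) = (if x \<in> X then 1 + (exp (f x / b) - 1) / ?q else 1)" for x
  proof (cases "x \<in> X")
    case True
    have "measure_pmf.expectation ?p (g x) = (\<Sum>y\<in>\<Psi>. g x (Some y)) / ?q"
      using ne finite_colours by (simp add: integral_pmf_of_set)
    also have "(\<Sum>y\<in>\<Psi>. g x (Some y)) = g x (Some c) + (\<Sum>y\<in>\<Psi> - {c}. g x (Some y))"
      using c finite_colours by (simp add: sum.remove)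
    also have "(\<Sum>y\<in>\<Psi> - {c}. g x (Some y)) = (\<Sum>y\<in>\<Psi> - {c}. 1)"
      by (intro sum.cong) (auto simp: g_def)
    also have "\<dots> = ?q - 1"
      using c finite_colours q by (simp add: card_Diff_singleton of_nat_diff)
    finally show ?thesis using True q by (simp add: g_def field_simps)
  qed (simp add: g_def)
  let ?S = "{\<kappa>. t \<le> (\<Sum>x\<in>{x \<in> X. \<kappa> x = Some c}. f x)}"
  have G: "(\<Prod>x\<in>V. g x (\<kappa> x)) = exp ((\<Sum>x\<in>{x \<in> X. \<kappa> x = Some c}. f x) / b)" for \<kappa>
  proof -
    have "(\<Prod>x\<in>V. g x (\<kappa> x)) = (\<Prod>x\<in>{x \<in> X. \<kappa> x = Some c}. exp (f x / b))"
      using X finite_V by (intro prod.mono_neutral_cong_right) (auto simp: g_def)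
    also have "\<dots> = exp (\<Sum>x\<in>{x \<in> X. \<kappa> x = Some c}. f x / b)"
      using fX by (simp add: exp_sum)
    finally show ?thesis by (simp add: sum_divide_distrib)
  qed
  have "exp (t / b) * measure_pmf.prob first_candidates ?S =
      measure_pmf.expectation first_candidates (\<lambda>\<kappa>. exp (t / b) * indicator ?S \<kappa>)"
    by simp
  also have "\<dots> \<le> measure_pmf.expectation first_candidates (\<lambda>\<kappa>. \<Prod>x\<in>V. g x (\<kappa> x))"
  proof (rule integral_mono)
    show "integrable (measure_pmf first_candidates) (\<lambda>\<kappa>. \<Prod>x\<in>V. g x (\<kappa> x))"
      unfolding first_candidates_def by (intro integrable_prod_Pi_pmf finite_V int)
    show "exp (t / b) * indicator ?S \<kappa> \<le> (\<Prod>x\<in>V. g x (\<kappa> x))" for \<kappa>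
      unfolding G using b by (auto simp: indicator_def divide_right_mono)
  qed (intro integrable_mult_right integrable_real_indicator; simp add: measure_pmf.emeasure_eq_measure)
  also have "\<dots> = (\<Prod>x\<in>V. measure_pmf.expectation ?p (g x))"
    unfolding first_candidates_def
    by (rule expectation_prod_Pi_pmf[OF finite_V int]) (auto simp: g_def)
  also have "\<dots> = (\<Prod>x\<in>X. 1 + (exp (f x / b) - 1) / ?q)"
    unfolding one using X finite_V by (intro prod.mono_neutral_cong_right) auto
  also have "\<dots> \<le> (\<Prod>x\<in>X. exp (2 * (f x / b) / ?q))"
  proof (intro prod_mono conjI)
    fix x assume x: "x \<in> X"
    \<comment> \<open>The parameter \<open>1 / b\<close> keeps \<open>f x / b\<close> in the unit
      interval, where \<open>exp y \<le> 1 + 2 * y\<close>; this is the source of the factor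
      2.\<close>
    have "(exp (f x / b) - 1) / ?q \<le> (2 * (f x / b)) / ?q"
      using exp_le_1_2x[of "f x / b"] f[OF x] b q by (intro divide_right_mono) auto
    also have "1 + (2 * (f x / b)) / ?q \<le> exp (2 * (f x / b) / ?q)"
      by (rule exp_ge_add_one_self)
    finally show "1 + (exp (f x / b) - 1) / ?q \<le> exp (2 * (f x / b) / ?q)" by simp
    show "0 \<le> 1 + (exp (f x / b) - 1) / ?q"
      using f[OF x] b q by (intro add_nonneg_nonneg divide_nonneg_nonneg) auto
  qed
  also have "\<dots> = exp (2 * (\<Sum>x\<in>X. f x) / (b * ?q))"
    using fX by (simp add: exp_sum[symmetric] sum_distrib_left sum_divide_distrib)
  finally show ?thesis
    by (simp add: exp_diff pos_le_divide_eq mult.commute)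
qed

text \<open>Colour \<open>c\<close> is adopted within \<open>U\<close> unless more than half of \<open>U\<close> is blocked by neighbours outside \<open>U\<close>
  choosing \<open>c\<close> (set \<open>B \<kappa>\<close>), or nobody in the rest of \<open>U\<close> chooses \<open>c\<close>; the latter is independent of \<open>B \<kappa>\<close>.\<close>

lemma prob_colour_not_adopted_le:
  assumes c: "c \<in> \<Psi>" and v: "v \<in> V" and U: "U \<subseteq> V"
    and id: "\<And>w. w \<in> U \<Longrightarrow> ident w < ident v"
    and ind: "\<And>w w'. w \<in> U \<Longrightarrow> w' \<in> U \<Longrightarrow> \<not> E w w'"
    and b: "0 < b" "\<And>x. x \<in> V \<Longrightarrow> x \<noteq> v \<Longrightarrow> real (card {w \<in> U. E x w}) \<le> b"
    and D: "\<And>w. w \<in> U \<Longrightarrow> real (vertex_degree V E w) \<le> D" and q: "8 * D \<le> real (card \<Psi>)"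
  shows "measure_pmf.prob first_candidates
      {\<kappa>. \<forall>w\<in>U. \<kappa> w = Some c \<longrightarrow> (\<exists>x\<in>V. E w x \<and> ident x < ident w \<and> \<kappa> x = Some c)}
    \<le> exp (- real (card U) / (4 * b)) + exp (- real (card U) / (2 * real (card \<Psi>)))"
proof -
  let ?q = "real (card \<Psi>)" and ?K = first_candidates and ?p = "map_pmf Some (pmf_of_set \<Psi>)"
  \<comment> \<open>The only possible blockers of members of \<open>U\<close>: by independence none
    is in \<open>U\<close>, and \<open>v\<close> has a larger ID than all of them. The bound
    \<open>b\<close> is available just for vertices other than \<open>v\<close>.\<close>
  define X where "X = V - U - {v}"
  define B where "B \<kappa> = {w \<in> U. \<exists>x\<in>X. E w x \<and> \<kappa> x = Some c}" for \<kappa> :: "'v \<Rightarrow> 'c option"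
  define f where "f x = real (card {w \<in> U. E x w})" for x
  have ne: "\<Psi> \<noteq> {}" and q0: "0 < ?q" using c finite_colours by (auto simp: card_gt_0_iff)
  have fU: "finite U" using U finite_V by (rule finite_subset)
  have fX: "finite X" using finite_V by (simp add: X_def)
  have fB: "finite (B \<kappa>)" for \<kappa> using fU by (simp add: B_def)
  have BU: "B \<kappa> \<subseteq> U" for \<kappa> by (auto simp: B_def)
  let ?large = "{\<kappa>. real (card U) / 2 \<le> (\<Sum>x\<in>{x \<in> X. \<kappa> x = Some c}. f x)}"
  let ?miss = "{\<kappa>. real (card (B \<kappa>)) \<le> real (card U) / 2 \<and> (\<forall>w\<in>U - B \<kappa>. \<kappa> w \<noteq> Some c)}"
  have card_B: "real (card (B \<kappa>)) \<le> (\<Sum>x\<in>{x \<in> X. \<kappa> x = Some c}. f x)" for \<kappa>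
  proof -
    have "B \<kappa> \<subseteq> (\<Union>x\<in>{x \<in> X. \<kappa> x = Some c}. {w \<in> U. E x w})"
      unfolding B_def using E_sym by blast
    then have "card (B \<kappa>) \<le> card (\<Union>x\<in>{x \<in> X. \<kappa> x = Some c}. {w \<in> U. E x w})"
      using fX fU by (intro card_mono) auto
    also have "\<dots> \<le> (\<Sum>x\<in>{x \<in> X. \<kappa> x = Some c}. card {w \<in> U. E x w})"
      using fX by (intro card_UN_le) auto
    finally have "real (card (B \<kappa>)) \<le> real (\<Sum>x\<in>{x \<in> X. \<kappa> x = Some c}. card {w \<in> U. E x w})"
      by (rule of_nat_mono)
    then show ?thesis by (simp add: f_def)
  qed
  \<comment> \<open>Edges between \<open>X\<close> and \<open>U\<close> are counted from both sides,
    so that small degrees inside \<open>U\<close> bound the total blocking weight.\<close>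
  have sum_f: "(\<Sum>x\<in>X. f x) \<le> real (card U) * D"
  proof -
    have "(\<Sum>x\<in>X. f x) = (\<Sum>x\<in>X. \<Sum>w\<in>U. of_bool (E x w))"
      unfolding f_def using fU by (simp add: of_bool_def sum.If_cases Int_def)
    also have "\<dots> = (\<Sum>w\<in>U. \<Sum>x\<in>X. of_bool (E x w))"
      by (rule sum.swap)
    also have "\<dots> = (\<Sum>w\<in>U. real (card {x \<in> X. E x w}))"
      using fX by (simp add: of_bool_def sum.If_cases Int_def)
    also have "\<dots> \<le> (\<Sum>w\<in>U. real (vertex_degree V E w))"
      unfolding vertex_degree_def using finite_V E_sym
      by (intro sum_mono of_nat_mono card_mono) (auto simp: X_def)
    also have "\<dots> \<le> real (card U) * D"
      using D by (intro sum_bounded_above)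
    finally show ?thesis .
  qed
  have large: "measure_pmf.prob ?K ?large \<le> exp (- real (card U) / (4 * b))"
  proof -
    have "measure_pmf.prob ?K ?large \<le> exp (2 * (\<Sum>x\<in>X. f x) / (b * ?q) - (real (card U) / 2) / b)"
      by (rule prob_colour_weight_le[OF c _ b(1)]) (use b(2) in \<open>auto simp: X_def f_def\<close>)
    also have "2 * (\<Sum>x\<in>X. f x) / (b * ?q) - (real (card U) / 2) / b \<le> - real (card U) / (4 * b)"
    proof -
      have "2 * (\<Sum>x\<in>X. f x) / (b * ?q) \<le> 2 * (real (card U) * (?q / 8)) / (b * ?q)"
      proof (intro divide_right_mono mult_left_mono)
        show "(\<Sum>x\<in>X. f x) \<le> real (card U) * (?q / 8)"
          by (rule order_trans[OF sum_f mult_left_mono]) (use q in auto)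
      qed (use b q0 in auto)
      also have "\<dots> = real (card U) / (4 * b)"
        using b q0 by simp
      finally have "2 * (\<Sum>x\<in>X. f x) / (b * ?q) \<le> real (card U) / (4 * b)" .
      moreover have "real (card U) / 2 / b = real (card U) / (4 * b) + real (card U) / (4 * b)"
        using b by (simp add: field_simps)
      ultimately show ?thesis by (simp add: minus_divide_left[symmetric])
    qed
    finally show ?thesis by simp
  qed
  have miss: "measure_pmf.prob ?K ?miss \<le> exp (- real (card U) / (2 * ?q))"
  proof -
    \<comment> \<open>\<open>B \<kappa>\<close> depends on the candidates in \<open>X\<close> only,
      so the candidates in \<open>U\<close> may be redrawn with \<open>B \<kappa>\<close> held
      fixed.\<close>
    have "?K = bind_pmf ?K (\<lambda>f. map_pmf (\<lambda>h x. if x \<in> U then h x else f x) (Pi_pmf U None (\<lambda>_. ?p)))"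
      unfolding first_candidates_def by (rule Pi_pmf_resample[OF finite_V U])
    then have "measure_pmf.prob ?K ?miss = measure_pmf.prob
        (bind_pmf ?K (\<lambda>f. map_pmf (\<lambda>h x. if x \<in> U then h x else f x) (Pi_pmf U None (\<lambda>_. ?p)))) ?miss"
      by simp
    also have "\<dots> \<le> measure_pmf.expectation ?K (\<lambda>_. exp (- real (card U) / (2 * ?q)))"
    proof (rule measure_bind_pmf_le)
      fix \<kappa> :: "'v \<Rightarrow> 'c option"
      have B: "B (\<lambda>x. if x \<in> U then h x else \<kappa> x) = B \<kappa>" for h
        by (auto simp: B_def X_def)
      show "measure_pmf.prob (map_pmf (\<lambda>h x. if x \<in> U then h x else \<kappa> x) (Pi_pmf U None (\<lambda>_. ?p))) ?miss
        \<le> exp (- real (card U) / (2 * ?q))"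
      proof (cases "real (card (B \<kappa>)) \<le> real (card U) / 2")
        case True
        have "measure_pmf.prob (map_pmf (\<lambda>h x. if x \<in> U then h x else \<kappa> x) (Pi_pmf U None (\<lambda>_. ?p))) ?miss =
          measure_pmf.prob (Pi_pmf U None (\<lambda>_. ?p)) {h. \<forall>w\<in>U - B \<kappa>. h w \<noteq> Some c}"
          using True by (simp add: vimage_def B)
        also have "{h. \<forall>w\<in>U - B \<kappa>. h w \<noteq> Some c} = Pi U (\<lambda>w. if w \<in> B \<kappa> then UNIV else - {Some c})"
          by (force simp: Pi_iff)
        also have "measure_pmf.prob (Pi_pmf U None (\<lambda>_. ?p)) \<dots> =
            (\<Prod>w\<in>U. measure_pmf.prob ?p (if w \<in> B \<kappa> then UNIV else - {Some c}))"
          by (rule measure_Pi_pmf_Pi[OF fU])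
        also have "\<dots> = (\<Prod>w\<in>U - B \<kappa>. measure_pmf.prob ?p (- {Some c}))"
          using fU by (intro prod.mono_neutral_cong_right) auto
        also have "measure_pmf.prob ?p (- {Some c}) = 1 - 1 / ?q"
          using c ne finite_colours measure_pmf.prob_compl[of "{Some c}" ?p]
          by (simp add: measure_pmf_single pmf_map_inj' Compl_eq_Diff_UNIV)
        also have "(\<Prod>w\<in>U - B \<kappa>. 1 - 1 / ?q) \<le> exp (- 1 / ?q) ^ card (U - B \<kappa>)"
          using exp_ge_add_one_self[of "- 1 / ?q"] q0 by (simp, intro power_mono) (auto simp: field_simps)
        also have "\<dots> = exp (- (real (card (U - B \<kappa>)) / ?q))"
          by (simp add: exp_of_nat_mult[symmetric])
        also have "\<dots> \<le> exp (- real (card U) / (2 * ?q))"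
        proof -
          have "real (card (U - B \<kappa>)) = real (card U) - real (card (B \<kappa>))"
            using fB BU fU by (simp add: card_Diff_subset of_nat_diff card_mono)
          then have "real (card U) / 2 / ?q \<le> real (card (U - B \<kappa>)) / ?q"
            using True by (intro divide_right_mono) auto
          then show ?thesis by simp
        qed
        finally show ?thesis .
      next
        case False
        then have "measure_pmf.prob (map_pmf (\<lambda>h x. if x \<in> U then h x else \<kappa> x) (Pi_pmf U None (\<lambda>_. ?p))) ?miss = 0"
          by (simp add: vimage_def B)
        then show ?thesis by simp
      qed
    qed simp
    finally show ?thesis by simp
  qed
  have "measure_pmf.prob ?K {\<kappa>. \<forall>w\<in>U. \<kappa> w = Some c \<longrightarrow> (\<exists>x\<in>V. E w x \<and> ident x < ident w \<and> \<kappa> x = Some c)}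
     \<le> measure_pmf.prob ?K (?large \<union> ?miss)"
  proof (intro measure_pmf.finite_measure_mono subsetI)
    fix \<kappa> :: "'v \<Rightarrow> 'c option" assume "\<kappa> \<in> {\<kappa>. \<forall>w\<in>U. \<kappa> w = Some c \<longrightarrow> (\<exists>x\<in>V. E w x \<and> ident x < ident w \<and> \<kappa> x = Some c)}"
    then have *: "\<exists>x\<in>V. E w x \<and> ident x < ident w \<and> \<kappa> x = Some c" if "w \<in> U" "\<kappa> w = Some c" for w
      using that by blast
    have "w \<in> B \<kappa>" if w: "w \<in> U" "\<kappa> w = Some c" for w
    proof -
      obtain x where x: "x \<in> V" "E w x" "ident x < ident w" "\<kappa> x = Some c" using *[OF w] by blast
      moreover have "x \<notin> U" using ind[OF w(1)] x by blast
      moreover have "x \<noteq> v" using id[OF w(1)] x by auto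
      ultimately show ?thesis using w by (auto simp: B_def X_def)
    qed
    then show "\<kappa> \<in> ?large \<union> ?miss" using card_B[of \<kappa>] by force
  qed simp
  also have "\<dots> \<le> measure_pmf.prob ?K ?large + measure_pmf.prob ?K ?miss"
    by (rule measure_Un_le) auto
  finally show ?thesis using large miss by linarith
qed

lemma rctid_prob_never_hub:
  assumes ne: "\<Psi> \<noteq> {}" and v: "v \<in> V" and U: "U \<subseteq> V" "\<And>w. w \<in> U \<Longrightarrow> E v w"
    and id: "\<And>w. w \<in> U \<Longrightarrow> ident w < ident v"
    and ind: "\<And>w w'. w \<in> U \<Longrightarrow> w' \<in> U \<Longrightarrow> \<not> E w w'"
    and b: "0 < b" "\<And>x. x \<in> V \<Longrightarrow> x \<noteq> v \<Longrightarrow> real (card {w \<in> U. E x w}) \<le> b"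
    and D: "\<And>w. w \<in> U \<Longrightarrow> real (vertex_degree V E w) \<le> D" and q: "8 * D \<le> real (card \<Psi>)"
  shows "1 - real (card \<Psi>) * (exp (- real (card U) / (4 * b)) + exp (- real (card U) / (2 * real (card \<Psi>))))
     \<le> rctid_prob V E \<Psi> ident (never_terminates V)"
proof -
  let ?K = first_candidates
  let ?e = "exp (- real (card U) / (4 * b)) + exp (- real (card U) / (2 * real (card \<Psi>)))"
  let ?bad = "\<lambda>c. {\<kappa>. \<forall>w\<in>U. \<kappa> w = Some c \<longrightarrow> (\<exists>x\<in>V. E w x \<and> ident x < ident w \<and> \<kappa> x = Some c)}"
  let ?stuck = "{\<sigma>. \<exists>v\<in>V. \<sigma> v = None \<and> palette V E \<Psi> \<sigma> v = {}}"
  let ?stuck1 = "{\<kappa>. adopt V E ident Map.empty \<kappa> \<in> ?stuck}"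
  have "measure_pmf.prob ?K (UNIV - ?stuck1) \<le> measure_pmf.prob ?K (\<Union>c\<in>\<Psi>. ?bad c)"
  proof (rule measure_pmf.finite_measure_mono_AE)
    show "AE \<kappa> in measure_pmf ?K. \<kappa> \<in> UNIV - ?stuck1 \<longrightarrow> \<kappa> \<in> (\<Union>c\<in>\<Psi>. ?bad c)"
    proof (rule AE_pmfI, rule impI, rule ccontr)
      fix \<kappa> assume \<kappa>: "\<kappa> \<in> set_pmf ?K" "\<kappa> \<in> UNIV - ?stuck1" and "\<kappa> \<notin> (\<Union>c\<in>\<Psi>. ?bad c)"
      then have *: "\<exists>w\<in>U. \<kappa> w = Some c \<and> (\<forall>x\<in>V. E w x \<longrightarrow> ident x < ident w \<longrightarrow> \<kappa> x \<noteq> Some c)" if "c \<in> \<Psi>" for c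
        using that by blast
      obtain c where c: "c \<in> \<Psi>" "\<kappa> v = Some c"
        using first_candidates_Some[OF ne \<kappa>(1) v] .
      \<comment> \<open>The colour that \<open>v\<close> proposes is itself proposed in
        \<open>U\<close>, by a neighbour of smaller ID, so \<open>v\<close> is blocked as
        well.\<close>
      obtain w where w: "w \<in> U" "\<kappa> w = Some c" using *[OF c(1)] by blast
      then have "adopt V E ident Map.empty \<kappa> v = None"
        using U id c by (auto simp: adopt_def)
      moreover have "palette V E \<Psi> (adopt V E ident Map.empty \<kappa>) v = {}"
      proof -
        have "\<exists>w\<in>V. E v w \<and> adopt V E ident Map.empty \<kappa> w = Some c" if "c \<in> \<Psi>" for c
        proof -
          obtain w where w: "w \<in> U" "\<kappa> w = Some c" "\<forall>x\<in>V. E w x \<longrightarrow> ident x < ident w \<longrightarrow> \<kappa> x \<noteq> Some c"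
            using *[OF \<open>c \<in> \<Psi>\<close>] by blast
          then have "adopt V E ident Map.empty \<kappa> w = Some c" by (auto simp: adopt_def)
          then show ?thesis using w U by blast
        qed
        then show ?thesis by (auto simp: palette_def)
      qed
      ultimately show False using \<kappa>(2) v by auto
    qed
  qed simp
  also have "\<dots> \<le> (\<Sum>c\<in>\<Psi>. measure_pmf.prob ?K (?bad c))"
    using finite_colours by (intro measure_pmf.finite_measure_subadditive_finite) auto
  also have "\<dots> \<le> (\<Sum>c\<in>\<Psi>. ?e)"
    by (intro sum_mono prob_colour_not_adopted_le[where v = v and D = D] v U id ind b D q)
  finally have "1 - real (card \<Psi>) * ?e \<le> measure_pmf.prob ?K ?stuck1"
    using measure_pmf.prob_compl[of ?stuck1 ?K] by simp
  also have "\<dots> = measure_pmf.prob (rctid_state V E \<Psi> ident (Suc 0)) ?stuck"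
    using ne by (simp add: rctid_state_1 vimage_def del: rctid_state.simps)
  also have "\<dots> \<le> rctid_prob V E \<Psi> ident (never_terminates V)"
    by (rule rctid_prob_never_ge)
  finally show ?thesis .
qed

end

section \<open>Random identifiers\<close>

definition id_bijections :: "'v set \<Rightarrow> ('v \<Rightarrow> nat) set" where
  "id_bijections V = {ident. ident \<in> extensional V \<and> bij_betw ident V {..<card V}}"

lemma finite_id_bijections: "finite V \<Longrightarrow> finite (id_bijections V)"
  by (rule finite_subset[of _ "PiE V (\<lambda>_. {..<card V})"])
     (auto simp: id_bijections_def PiE_iff extensional_def bij_betw_def intro!: finite_PiE)

lemma id_bijections_nonempty:
  assumes "finite V" shows "id_bijections V \<noteq> {}"
proof -
  obtain h where h: "bij_betw h V {..<card V}"
    using ex_bij_betw_finite_nat[OF assms] by (auto simp: atLeast0LessThan)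
  then have "bij_betw (restrict h V) V {..<card V}"
    by (subst bij_betw_cong[of V "restrict h V" h]) auto
  then show ?thesis by (auto simp: id_bijections_def)
qed

lemma id_bijections_transpose:
  assumes "x \<in> V" "y \<in> V" "ident \<in> id_bijections V"
  shows "ident \<circ> Transposition.transpose x y \<in> id_bijections V"
proof -
  have t: "bij_betw (Transposition.transpose x y) V V"
    using assms by (intro bij_betwI[of _ _ _ "Transposition.transpose x y"]) (auto simp: Transposition.transpose_def)
  have "(ident \<circ> Transposition.transpose x y) \<in> extensional V"
    using assms by (auto simp: id_bijections_def extensional_def Transposition.transpose_def)
  then show ?thesis
    using assms bij_betw_trans[OF t] by (auto simp: id_bijections_def)
qed

definition low_id :: "('v \<Rightarrow> nat) \<Rightarrow> 'v \<Rightarrow> 'v set \<Rightarrow> bool" where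
  "low_id ident v W \<longleftrightarrow> 2 * card {w \<in> W. ident w < ident v} < card W"

text \<open>After the swap \<open>v\<close> carries the ID of \<open>w\<close>, so its rank in the
  group \<open>insert v W\<close> becomes the original rank of \<open>w\<close>.\<close>

lemma low_id_transpose:
  assumes v: "v \<notin> W" and w: "w \<in> insert v W"
  shows "low_id (ident \<circ> Transposition.transpose v w) v W \<longleftrightarrow> 2 * card {z \<in> insert v W. ident z < ident w} < card W"
proof -
  have "bij_betw (Transposition.transpose v w) {z \<in> W. (ident \<circ> Transposition.transpose v w) z < ident w} {z \<in> insert v W. ident z < ident w}"
    by (rule bij_betwI[of _ _ _ "Transposition.transpose v w"]) (use v w in \<open>auto simp: Transposition.transpose_def split: if_splits\<close>)
  then show ?thesis
    by (simp add: low_id_def bij_betw_same_card)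
qed

text \<open>Ranks inside \<open>G\<close> are distinct, and \<open>(m + 1) div 2\<close> numbers
  \<open>k\<close> satisfy \<open>2 * k < m\<close>. When the group consists of a hub and
  \<open>m\<close> further vertices, this is at most half of the group, with no loss from
  rounding.\<close>

lemma card_low_rank:
  fixes ident :: "'v \<Rightarrow> nat"
  assumes fin: "finite G" and inj: "inj_on ident G"
  shows "card {w \<in> G. 2 * card {z \<in> G. ident z < ident w} < m} \<le> (m + 1) div 2"
proof -
  let ?rank = "\<lambda>w. card {z \<in> G. ident z < ident w}"
  have less: "?rank u < ?rank w" if "u \<in> G" "ident u < ident w" for u w
    using that fin by (intro psubset_card_mono) auto
  have "inj_on ?rank G"
  proof (rule inj_onI, rule ccontr)
    fix u w assume "u \<in> G" "w \<in> G" "?rank u = ?rank w" "u \<noteq> w"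
    then have "ident u \<noteq> ident w" using inj by (auto dest: inj_onD)
    then show False
      using less[of u w] less[of w u] \<open>u \<in> G\<close> \<open>w \<in> G\<close> \<open>?rank u = ?rank w\<close> by linarith
  qed
  then have "card {w \<in> G. 2 * ?rank w < m} \<le> card {k. 2 * k < m}"
    by (intro card_inj_on_le[of ?rank]) (auto intro: inj_on_subset finite_subset[of _ "{..m}"])
  also have "{k. 2 * k < m} = {..<(m + 1) div 2}" by auto
  finally show ?thesis by simp
qed

text \<open>Swapping the ID of \<open>v\<close> with that of a uniformly random member of its group leaves the other groups
  untouched and makes \<open>v\<close> rank low with probability at most 1/2.\<close>

lemma card_all_low_id:
  assumes V: "finite V" and H: "finite H"
    and W: "\<And>v. v \<in> H \<Longrightarrow> insert v (W v) \<subseteq> V" "\<And>v. v \<in> H \<Longrightarrow> v \<notin> W v"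
    and disj: "\<And>v v'. v \<in> H \<Longrightarrow> v' \<in> H \<Longrightarrow> v \<noteq> v' \<Longrightarrow> insert v (W v) \<inter> insert v' (W v') = {}"
  shows "2 ^ card H * card {ident \<in> id_bijections V. \<forall>v\<in>H. low_id ident v (W v)} \<le> card (id_bijections V)"
  using H W disj
proof (induction H rule: finite_induct)
  case (insert v H)
  define R where "R = {ident \<in> id_bijections V. \<forall>v\<in>H. low_id ident v (W v)}"
  define G where "G = insert v (W v)"
  have fR: "finite R" unfolding R_def using finite_id_bijections[OF V] by simp
  have fW: "finite (W v)" and GV: "G \<subseteq> V" and vW: "v \<notin> W v" and fG: "finite G"
    using insert.prems(1,2)[of v] V by (auto simp: G_def intro: finite_subset)
  have IH: "2 ^ card H * card R \<le> card (id_bijections V)"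
    unfolding R_def using insert.prems by (intro insert.IH) auto
  have inv: "ident \<circ> Transposition.transpose v w \<in> R" if w: "w \<in> G" and ident: "ident \<in> R" for w ident
  proof -
    have "low_id (ident \<circ> Transposition.transpose v w) v' (W v')" if v': "v' \<in> H" for v'
    proof -
      have "z \<noteq> v \<and> z \<noteq> w" if "z \<in> insert v' (W v')" for z
        using insert.prems(3)[of v v'] insert.hyps v' that w by (auto simp: G_def)
      then have "(ident \<circ> Transposition.transpose v w) z = ident z" if "z \<in> insert v' (W v')" for z
        using that by (simp add: Transposition.transpose_def)
      then have "{z \<in> W v'. (ident \<circ> Transposition.transpose v w) z < (ident \<circ> Transposition.transpose v w) v'} = {z \<in> W v'. ident z < ident v'}"
        by auto
      then show ?thesis
        using ident v' by (simp only: low_id_def) (simp add: R_def low_id_def)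
    qed
    then show ?thesis
      using ident id_bijections_transpose[of v V w ident] GV w by (auto simp: R_def G_def)
  qed
  have same: "card {ident \<in> R. low_id (ident \<circ> Transposition.transpose v w) v (W v)} = card {ident \<in> R. low_id ident v (W v)}"
    if w: "w \<in> G" for w
  proof -
    have "bij_betw (\<lambda>ident. ident \<circ> Transposition.transpose v w) {ident \<in> R. low_id (ident \<circ> Transposition.transpose v w) v (W v)}
        {ident \<in> R. low_id ident v (W v)}"
      by (rule bij_betwI[of _ _ _ "\<lambda>ident. ident \<circ> Transposition.transpose v w"])
         (use inv[OF w] in \<open>auto simp: comp_assoc\<close>)
    then show ?thesis by (rule bij_betw_same_card)
  qed
  \<comment> \<open>Pairs of a swap partner and an ID assignment are counted in two ways: per
    partner, where swapping permutes \<open>R\<close>, and per assignment, where at most half of the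
    partners give \<open>v\<close> a low rank.\<close>
  have "card G * (2 * card {ident \<in> R. low_id ident v (W v)}) =
      2 * (\<Sum>w\<in>G. card {ident \<in> R. low_id (ident \<circ> Transposition.transpose v w) v (W v)})"
    using same by simp
  also have "(\<Sum>w\<in>G. card {ident \<in> R. low_id (ident \<circ> Transposition.transpose v w) v (W v)}) =
      (\<Sum>ident\<in>R. card {w \<in> G. low_id (ident \<circ> Transposition.transpose v w) v (W v)})"
  proof -
    have "(\<Sum>w\<in>G. card {ident \<in> R. low_id (ident \<circ> Transposition.transpose v w) v (W v)}) =
       (\<Sum>w\<in>G. \<Sum>ident\<in>R. of_bool (low_id (ident \<circ> Transposition.transpose v w) v (W v)))"
      using fR by (simp add: of_bool_def sum.If_cases Int_def)
    also have "\<dots> = (\<Sum>ident\<in>R. \<Sum>w\<in>G. of_bool (low_id (ident \<circ> Transposition.transpose v w) v (W v)))"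
      by (rule sum.swap)
    finally show ?thesis using fG by (simp add: of_bool_def sum.If_cases Int_def)
  qed
  also have "2 * \<dots> = (\<Sum>ident\<in>R. 2 * card {w \<in> G. low_id (ident \<circ> Transposition.transpose v w) v (W v)})"
    by (simp add: sum_distrib_left)
  also have "\<dots> \<le> (\<Sum>ident\<in>R. card G)"
  proof (rule sum_mono)
    fix ident assume "ident \<in> R"
    then have "inj_on ident G"
      using GV by (auto simp: R_def id_bijections_def bij_betw_def intro: inj_on_subset)
    have "{w \<in> G. low_id (ident \<circ> Transposition.transpose v w) v (W v)} =
        {w \<in> G. 2 * card {z \<in> G. ident z < ident w} < card (W v)}"
      using low_id_transpose[OF vW, of _ ident] by (auto simp: G_def)
    then have "card {w \<in> G. low_id (ident \<circ> Transposition.transpose v w) v (W v)} \<le> (card (W v) + 1) div 2"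
      using card_low_rank[OF fG \<open>inj_on ident G\<close>] by simp
    then show "2 * card {w \<in> G. low_id (ident \<circ> Transposition.transpose v w) v (W v)} \<le> card G"
      using fW vW by (simp add: G_def)
  qed
  finally have "card G * (2 * card {ident \<in> R. low_id ident v (W v)}) \<le> card G * card R"
    by (simp add: mult.commute)
  then have "2 * card {ident \<in> R. low_id ident v (W v)} \<le> card R"
    using fG by (simp add: G_def card_gt_0_iff)
  then have "2 ^ card H * (2 * card {ident \<in> R. low_id ident v (W v)}) \<le> card (id_bijections V)"
    using IH by (meson le_trans mult_le_mono2)
  moreover have "{ident \<in> id_bijections V. \<forall>v\<in>insert v H. low_id ident v (W v)} = {ident \<in> R. low_id ident v (W v)}"
    by (auto simp: R_def)
  ultimately show ?case
    using insert.hyps by (simp only: card_insert_disjoint power_Suc) (simp add: mult.assoc mult.left_commute)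
qed simp

text \<open>Either the hubs outnumber the colours and the clique decides, or
  \<open>card H \<le> card \<Psi>\<close>, and then \<open>HD\<close> supplies the bound
  \<open>8 * D \<le> card \<Psi>\<close> that the blocking estimate asks for. A hub above half of
  its leaves in ID has \<open>s / 2\<close> useful neighbours, which doubles both denominators of
  \<open>rctid_prob_never_hub\<close>.\<close>

theorem rctid_random_never_ge:
  fixes V :: "'v set" and E :: "'v \<Rightarrow> 'v \<Rightarrow> bool" and \<Psi> :: "'c set" and W :: "'v \<Rightarrow> 'v set"
  assumes V: "finite V" and E_sym: "\<And>u w. E u w \<Longrightarrow> E w u" and E_irrefl: "\<And>u. \<not> E u u"
    and \<Psi>: "finite \<Psi>" and H: "H \<subseteq> V" "H \<noteq> {}"
    and clique: "\<And>u w. u \<in> H \<Longrightarrow> w \<in> H \<Longrightarrow> u \<noteq> w \<Longrightarrow> E u w"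
    and W: "\<And>v. v \<in> H \<Longrightarrow> W v \<subseteq> V" "\<And>v w. v \<in> H \<Longrightarrow> w \<in> W v \<Longrightarrow> E v w"
    and ind: "\<And>v w w'. v \<in> H \<Longrightarrow> w \<in> W v \<Longrightarrow> w' \<in> W v \<Longrightarrow> \<not> E w w'"
    and disj: "\<And>v v'. v \<in> H \<Longrightarrow> v' \<in> H \<Longrightarrow> v \<noteq> v' \<Longrightarrow> insert v (W v) \<inter> insert v' (W v') = {}"
    and s: "\<And>v. v \<in> H \<Longrightarrow> s \<le> real (card (W v))"
    and b: "0 < b" "\<And>v x. v \<in> H \<Longrightarrow> x \<in> V \<Longrightarrow> x \<noteq> v \<Longrightarrow> real (card {w \<in> W v. E x w}) \<le> b"
    and D: "\<And>v w. v \<in> H \<Longrightarrow> w \<in> W v \<Longrightarrow> real (vertex_degree V E w) \<le> D"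
    and HD: "8 * D \<le> real (card H)"
  shows "1 - 1 / 2 ^ card H - real (card \<Psi>) * (exp (- s / (8 * b)) + exp (- s / (4 * real (card \<Psi>))))
     \<le> rctid_random_prob V E \<Psi> (never_terminates V)"
proof -
  let ?p = "random_ids V" and ?q = "real (card \<Psi>)" and ?P = "\<lambda>ident. rctid_prob V E \<Psi> ident (never_terminates V)"
  define err where "err = ?q * (exp (- s / (8 * b)) + exp (- s / (4 * ?q)))"
  define B where "B = {ident. \<forall>v\<in>H. low_id ident v (W v)}"
  have p: "?p = pmf_of_set (id_bijections V)"
    by (simp add: random_ids_def id_bijections_def)
  note ids = finite_id_bijections[OF V] id_bijections_nonempty[OF V]
  have set_p: "set_pmf ?p = id_bijections V"
    using ids by (simp add: p)
  have err0: "0 \<le> err" by (simp add: err_def)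
  have vW: "v \<notin> W v" if "v \<in> H" for v
    using W(2)[OF that, of v] E_irrefl by blast
  have fH: "finite H" using H(1) V by (rule finite_subset)
  have prob_B: "measure_pmf.prob ?p B \<le> 1 / 2 ^ card H"
  proof -
    have "2 ^ card H * card {ident \<in> id_bijections V. \<forall>v\<in>H. low_id ident v (W v)} \<le> card (id_bijections V)"
      by (rule card_all_low_id[OF V fH]) (use H W disj vW in blast)+
    then have "2 ^ card H * real (card (id_bijections V \<inter> B)) \<le> real (card (id_bijections V))"
      unfolding B_def Int_def mem_Collect_eq by (metis (no_types, lifting) of_nat_le_iff of_nat_mult of_nat_numeral of_nat_power)
    moreover have "0 < card (id_bijections V)" using ids by (simp add: card_gt_0_iff)
    ultimately show ?thesis
      using ids by (simp add: p measure_pmf_of_set field_simps)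
  qed
  have ge: "1 - err - indicator B ident \<le> ?P ident" if ident: "ident \<in> set_pmf ?p" for ident
  proof -
    interpret rctid_graph V E \<Psi> ident
      using ident V E_sym E_irrefl \<Psi> by unfold_locales (auto simp: set_p id_bijections_def bij_betw_def)
    show ?thesis
    proof (cases "card \<Psi> < card H")
      case True
      then show ?thesis
        using rctid_prob_never_clique[OF H(1) True clique] err0 by (simp add: indicator_def)
    next
      case False
      show ?thesis
      proof (cases "ident \<in> B")
        case True
        then show ?thesis using err0 by (simp add: rctid_prob_def order_trans[OF _ measure_nonneg])
      next
        case nB: False
        then obtain v where v: "v \<in> H" "card (W v) \<le> 2 * card {w \<in> W v. ident w < ident v}"
          by (auto simp: B_def low_id_def not_less)
        define U where "U = {w \<in> W v. ident w < ident v}"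
        have sU: "s / 2 \<le> real (card U)"
          using v s[OF v(1)] by (simp add: U_def)
        have fW: "finite (W v)" using W(1)[OF v(1)] V by (rule finite_subset)
        have \<Psi>0: "\<Psi> \<noteq> {}" using False H fH by (auto simp: card_eq_0_iff)
        have bU: "real (card {w \<in> U. E x w}) \<le> b" if "x \<in> V" "x \<noteq> v" for x
        proof -
          have "card {w \<in> U. E x w} \<le> card {w \<in> W v. E x w}"
            using fW by (intro card_mono) (auto simp: U_def)
          then show ?thesis using b(2)[OF v(1) that] by linarith
        qed
        have "1 - ?q * (exp (- real (card U) / (4 * b)) + exp (- real (card U) / (2 * ?q))) \<le> ?P ident"
          by (rule rctid_prob_never_hub[where v = v and D = D, OF \<Psi>0])
             (use v H W[OF v(1)] ind[OF v(1)] b(1) bU D[OF v(1)] False HD in \<open>auto simp: U_def\<close>)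
        moreover have "?q * (exp (- real (card U) / (4 * b)) + exp (- real (card U) / (2 * ?q))) \<le> err"
        proof -
          have "s / 2 / (4 * b) \<le> real (card U) / (4 * b)"
            using sU b(1) by (intro divide_right_mono) auto
          moreover have "s / 2 / (2 * ?q) \<le> real (card U) / (2 * ?q)"
            using sU by (intro divide_right_mono) auto
          ultimately show ?thesis
            unfolding err_def by (intro mult_left_mono add_mono) simp_all
        qed
        ultimately show ?thesis using nB by simp
      qed
    qed
  qed
  have fin: "finite (set_pmf ?p)" using set_p ids by simp
  have "1 - err - measure_pmf.prob ?p B = measure_pmf.expectation ?p (\<lambda>ident. 1 - err - indicator B ident)"
    by (subst Bochner_Integration.integral_diff) (auto intro!: integrable_measure_pmf_finite fin)
  also have "\<dots> \<le> measure_pmf.expectation ?p ?P"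
    by (intro integral_mono_AE integrable_measure_pmf_finite fin AE_pmfI ge)
  finally show ?thesis
    using prob_B by (simp add: rctid_random_prob_def err_def)
qed

section \<open>Poisson point processes\<close>

context
  fixes M :: "'w measure" and V :: "'w \<Rightarrow> 'p set" and \<mu> :: "'p measure" and A :: "'p set" and l :: real
  assumes ppp: "poisson_point_process M V \<mu>" and A: "A \<in> sets \<mu>" and l: "measure \<mu> A = l"
begin

interpretation prob_space M
  using ppp by (simp add: poisson_point_process_def)

lemma ppp_count_measurable:
  "{\<omega> \<in> space M. Q (card (V \<omega> \<inter> A))} \<in> sets M"
proof -
  have "(\<lambda>\<omega>. card (V \<omega> \<inter> A)) \<in> measurable M (count_space UNIV)"
    using ppp A by (simp add: poisson_point_process_def)
  from measurable_sets[OF this, of "Collect Q"] show ?thesis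
    by (simp add: vimage_def Int_def conj_commute)
qed

lemma ppp_count_eq:
  "measure M {\<omega> \<in> space M. card (V \<omega> \<inter> A) = k} = l ^ k / fact k * exp (- l)"
  using ppp A l by (auto simp: poisson_point_process_def)

lemma ppp_intensity_nonneg: "0 \<le> l"
  using l by auto

lemma ppp_count_sums:
  "(\<lambda>k. if Q k then l ^ k / fact k * exp (- l) else 0) sums measure M {\<omega> \<in> space M. Q (card (V \<omega> \<inter> A))}"
proof -
  define F where "F k = {\<omega> \<in> space M. card (V \<omega> \<inter> A) = k \<and> Q k}" for k
  have F: "F k \<in> sets M" for k
    unfolding F_def using ppp_count_measurable[of "\<lambda>j. j = k \<and> Q k"] by simp
  have "(\<lambda>k. measure M (F k)) sums measure M (\<Union>k. F k)"
    by (rule finite_measure_UNION) (use F in \<open>auto simp: disjoint_family_on_def F_def\<close>)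
  moreover have "measure M (F k) = (if Q k then l ^ k / fact k * exp (- l) else 0)" for k
    using ppp_count_eq[of k] by (auto simp: F_def)
  moreover have "(\<Union>k. F k) = {\<omega> \<in> space M. Q (card (V \<omega> \<inter> A))}"
    by (auto simp: F_def)
  ultimately show ?thesis by simp
qed

text \<open>The Chernoff method; \<open>exp (t * l - l)\<close> is the probability generating function at \<open>t\<close>.\<close>

lemma ppp_chernoff:
  assumes t: "0 \<le> t" and c: "0 \<le> c" and Q: "\<And>k. Q k \<Longrightarrow> 1 \<le> c * t ^ k"
  shows "measure M {\<omega> \<in> space M. Q (card (V \<omega> \<inter> A))} \<le> c * exp (t * l - l)"
proof (rule sums_le[OF _ ppp_count_sums])
  have "(\<lambda>k. (t * l) ^ k /\<^sub>R fact k) sums exp (t * l)"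
    by (rule exp_converges)
  from sums_mult[OF this, of "c * exp (- l)"]
  show "(\<lambda>k. c * t ^ k * (l ^ k / fact k * exp (- l))) sums (c * exp (t * l - l))"
    by (simp add: exp_diff exp_minus field_simps power_mult_distrib)
  show "(if Q k then l ^ k / fact k * exp (- l) else 0) \<le> c * t ^ k * (l ^ k / fact k * exp (- l))" for k
  proof -
    have nn: "0 \<le> l ^ k / fact k * exp (- l)" using ppp_intensity_nonneg by simp
    show ?thesis
    proof (cases "Q k")
      case True
      then show ?thesis using mult_right_mono[OF Q nn, of k] by simp
    next
      case False
      moreover have "0 \<le> (c * t ^ k) * (l ^ k / fact k * exp (- l))"
        by (rule mult_nonneg_nonneg[OF _ nn]) (use t c in simp)
      ultimately show ?thesis by simp
    qed
  qed
qed

text \<open>The Chernoff bound with \<open>t = exp 1\<close>, using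
  \<open>exp 1 - 1 \<le> 2\<close>. As \<open>a\<close> may exceed the intensity, regions of tiny
  measure are covered as well, at the threshold that a union bound dictates.\<close>

lemma ppp_upper_tail:
  assumes "l \<le> a"
  shows "measure M {\<omega> \<in> space M. \<not> real (card (V \<omega> \<inter> A)) < 8 * a} \<le> exp (- 6 * a)"
proof -
  have "measure M {\<omega> \<in> space M. \<not> real (card (V \<omega> \<inter> A)) < 8 * a} \<le> exp (- 8 * a) * exp (exp 1 * l - l)"
  proof (rule ppp_chernoff)
    fix k assume "\<not> real k < 8 * a"
    then show "1 \<le> exp (- 8 * a) * exp 1 ^ k"
      by (simp add: exp_of_nat_mult[symmetric] mult_exp_exp)
  qed auto
  also have "exp 1 * l - l \<le> 3 * l - l"
    using exp_le ppp_intensity_nonneg by (intro diff_right_mono mult_right_mono)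
  then have "exp (- 8 * a) * exp (exp 1 * l - l) \<le> exp (- 8 * a) * exp (2 * a)"
    using assms by simp
  also have "\<dots> = exp (- 6 * a)" by (simp add: mult_exp_exp)
  finally show ?thesis .
qed

text \<open>The Chernoff bound with \<open>t = 1 / 2\<close>; by \<open>ln 2 \<le> 3 / 4\<close> the
  exponent is at most \<open>3 / 8 * a - a / 2 = - a / 8\<close>.\<close>

lemma ppp_lower_tail:
  assumes a: "a \<le> l"
  shows "measure M {\<omega> \<in> space M. \<not> a / 2 \<le> real (card (V \<omega> \<inter> A))} \<le> exp (- a / 8)"
proof -
  have ln2: "ln (2 :: real) \<le> 3 / 4"
  proof -
    have "(2 :: real) \<le> 1 + 3 / 4 + (3 / 4)\<^sup>2 / 2" by (simp add: power2_eq_square)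
    also have "\<dots> \<le> exp (3 / 4)" by (rule exp_lower_Taylor_quadratic) simp
    finally have "ln 2 \<le> ln (exp (3 / 4 :: real))"
      by (subst ln_le_cancel_iff) auto
    then show ?thesis by simp
  qed
  have half: "(1 / 2 :: real) = exp (- ln 2)" by (simp add: exp_minus)
  have "measure M {\<omega> \<in> space M. \<not> a / 2 \<le> real (card (V \<omega> \<inter> A))} \<le> exp (ln 2 * (a / 2)) * exp (1 / 2 * l - l)"
  proof (rule ppp_chernoff)
    fix k assume "\<not> a / 2 \<le> real k"
    then have "ln 2 * real k \<le> ln 2 * (a / 2)" by (intro mult_left_mono) auto
    then show "1 \<le> exp (ln 2 * (a / 2)) * (1 / 2) ^ k"
      unfolding half by (simp add: exp_of_nat_mult[symmetric] mult_exp_exp mult.commute)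
  qed auto
  also have "\<dots> = exp (ln 2 * (a / 2) - l / 2)" by (simp add: mult_exp_exp)
  also have "ln 2 * (a / 2) - l / 2 \<le> - a / 8 \<or> a < 0"
  proof (cases "a < 0")
    case False
    then have "ln 2 * (a / 2) \<le> 3 / 4 * (a / 2)" using ln2 by (intro mult_right_mono) auto
    then show ?thesis using a by (intro disjI1) linarith
  qed simp
  then have "exp (ln 2 * (a / 2) - l / 2) \<le> exp (- a / 8)"
  proof
    assume "a < 0"
    then have "ln 2 * (a / 2) \<le> 0" by (simp add: mult_nonneg_nonpos)
    then have "ln 2 * (a / 2) - l / 2 \<le> - a / 8" using ppp_intensity_nonneg \<open>a < 0\<close> by linarith
    then show ?thesis by simp
  qed simp
  finally show ?thesis .
qed

lemma ppp_count_zero: "measure M {\<omega> \<in> space M. \<not> 0 < card (V \<omega> \<inter> A)} = exp (- l)"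
  using ppp_count_eq[of 0] by simp

lemma ppp_count_pos: "measure M {\<omega> \<in> space M. \<not> card (V \<omega> \<inter> A) = 0} \<le> l"
proof -
  have "measure M {\<omega> \<in> space M. \<not> card (V \<omega> \<inter> A) = 0} =
      1 - measure M {\<omega> \<in> space M. card (V \<omega> \<inter> A) = 0}"
    by (rule prob_neg) (rule ppp_count_measurable)
  then show ?thesis
    using ppp_count_eq[of 0] exp_ge_add_one_self[of "- l"] by simp
qed

text \<open>The quadratic order is the point: summed over about \<open>1 / x\<close> cells of
  intensity of order \<open>x\<close>, the bound still vanishes with \<open>x\<close>.\<close>

lemma ppp_count_ge_2: "measure M {\<omega> \<in> space M. \<not> card (V \<omega> \<inter> A) \<le> 1} \<le> l\<^sup>2"
proof -
  have "measure M {\<omega> \<in> space M. \<not> card (V \<omega> \<inter> A) \<le> 1} =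
      1 - measure M {\<omega> \<in> space M. card (V \<omega> \<inter> A) \<le> 1}"
    by (rule prob_neg) (rule ppp_count_measurable)
  also have "{\<omega> \<in> space M. card (V \<omega> \<inter> A) \<le> 1} =
      {\<omega> \<in> space M. card (V \<omega> \<inter> A) = 0} \<union> {\<omega> \<in> space M. card (V \<omega> \<inter> A) = 1}"
    by auto
  also have "measure M \<dots> = exp (- l) + l * exp (- l)"
    by (subst finite_measure_Union) (auto intro: ppp_count_measurable simp: ppp_count_eq)
  also have "1 - \<dots> = 1 - exp (- l) * (1 + l)" by (simp add: algebra_simps)
  also have "\<dots> \<le> 1 - (1 - l) * (1 + l)"
    using exp_ge_add_one_self[of "- l"] ppp_intensity_nonneg
    by (intro diff_left_mono mult_right_mono) auto
  finally show ?thesis by (simp add: power2_eq_square algebra_simps)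
qed

end

section \<open>Events that hold asymptotically almost surely\<close>

lemma aas_mono:
  assumes P: "aas M P" and Q: "\<forall>\<^sub>F n in sequentially. \<forall>\<omega>\<in>space (M n). P n \<omega> \<longrightarrow> Q n \<omega>"
  shows "aas M Q"
proof -
  obtain X where X: "\<And>n. X n \<in> sets (M n)" "\<And>n \<omega>. \<omega> \<in> X n \<Longrightarrow> P n \<omega>"
    "(\<lambda>n. measure (M n) (X n)) \<longlonglongrightarrow> 1"
    using P unfolding aas_def by blast
  \<comment> \<open>\<open>aas\<close> asks for \<open>Q\<close> on the witness event for every
    \<open>n\<close>; the finitely many exceptional \<open>n\<close> get the empty event.\<close>
  define Y where "Y n = (if \<forall>\<omega>\<in>space (M n). P n \<omega> \<longrightarrow> Q n \<omega> then X n else {})" for n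
  have "\<forall>\<^sub>F n in sequentially. measure (M n) (X n) = measure (M n) (Y n)"
    using Q by eventually_elim (simp add: Y_def)
  then have "(\<lambda>n. measure (M n) (Y n)) \<longlonglongrightarrow> 1"
    by (rule Lim_transform_eventually[OF X(3)])
  moreover have "Q n \<omega>" if "\<omega> \<in> Y n" for n \<omega>
    using that X(2)[of \<omega> n] sets.sets_into_space[OF X(1)[of n]] by (auto simp: Y_def split: if_splits)
  moreover have "Y n \<in> sets (M n)" for n
    using X(1) by (simp add: Y_def)
  ultimately show ?thesis
    unfolding aas_def by blast
qed

lemma aas_conj:
  assumes M: "\<And>n. prob_space (M n)" and P: "aas M P" and Q: "aas M Q"
  shows "aas M (\<lambda>n \<omega>. P n \<omega> \<and> Q n \<omega>)"
proof -
  obtain X where X: "\<And>n. X n \<in> sets (M n)" "\<And>n \<omega>. \<omega> \<in> X n \<Longrightarrow> P n \<omega>"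
    "(\<lambda>n. measure (M n) (X n)) \<longlonglongrightarrow> 1"
    using P unfolding aas_def by blast
  obtain Y where Y: "\<And>n. Y n \<in> sets (M n)" "\<And>n \<omega>. \<omega> \<in> Y n \<Longrightarrow> Q n \<omega>"
    "(\<lambda>n. measure (M n) (Y n)) \<longlonglongrightarrow> 1"
    using Q unfolding aas_def by blast
  have lower: "measure (M n) (X n) + measure (M n) (Y n) - 1 \<le> measure (M n) (X n \<inter> Y n)" for n
  proof -
    interpret prob_space "M n" by (rule M)
    have "measure (M n) (X n) \<le> measure (M n) ((X n \<inter> Y n) \<union> (space (M n) - Y n))"
      using X(1) Y(1) sets.sets_into_space[OF X(1)[of n]] by (intro finite_measure_mono) auto
    also have "\<dots> \<le> measure (M n) (X n \<inter> Y n) + measure (M n) (space (M n) - Y n)"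
      using X(1) Y(1) by (intro measure_Un_le) auto
    finally show ?thesis using prob_compl[OF Y(1)[of n]] by linarith
  qed
  have upper: "measure (M n) (X n \<inter> Y n) \<le> 1" for n
    using prob_space.prob_le_1[OF M] .
  have "(\<lambda>n. measure (M n) (X n \<inter> Y n)) \<longlonglongrightarrow> 1"
  proof (rule tendsto_sandwich[OF _ _ _ tendsto_const])
    show "(\<lambda>n. measure (M n) (X n) + measure (M n) (Y n) - 1) \<longlonglongrightarrow> 1"
      using tendsto_diff[OF tendsto_add[OF X(3) Y(3)] tendsto_const[of 1]] by simp
  qed (use lower upper in auto)
  then show ?thesis
    unfolding aas_def using X(1,2) Y(1,2)
    by (intro exI[of _ "\<lambda>n. X n \<inter> Y n"] conjI allI ballI sets.Int) blast+
qed

text \<open>A union bound over a growing family of regions fixed in advance. The conditions see the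
  point set through counts only, which makes the witness event measurable.\<close>

lemma aas_counts:
  fixes A :: "nat \<Rightarrow> 'i \<Rightarrow> 'p set" and p :: "nat \<Rightarrow> real"
  assumes ppp: "\<And>n. poisson_point_process (M n) (V n) (\<mu> n)"
    and ev: "\<forall>\<^sub>F n in sequentially. finite (J n) \<and> (\<forall>j\<in>J n. A n j \<in> sets (\<mu> n) \<and>
        measure (M n) {\<omega> \<in> space (M n). \<not> Q n j (card (V n \<omega> \<inter> A n j))} \<le> p n)"
    and p: "(\<lambda>n. real (card (J n)) * p n) \<longlonglongrightarrow> 0"
  shows "aas M (\<lambda>n \<omega>. \<forall>j\<in>J n. Q n j (card (V n \<omega> \<inter> A n j)))"
proof -
  define ok where "ok n \<longleftrightarrow> finite (J n) \<and> (\<forall>j\<in>J n. A n j \<in> sets (\<mu> n) \<and>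
        measure (M n) {\<omega> \<in> space (M n). \<not> Q n j (card (V n \<omega> \<inter> A n j))} \<le> p n)" for n
  define F where "F n j = {\<omega> \<in> space (M n). \<not> Q n j (card (V n \<omega> \<inter> A n j))}" for n j
  define X where "X n = (if ok n then space (M n) - (\<Union>j\<in>J n. F n j) else {})" for n
  have prob: "prob_space (M n)" for n
    using ppp[of n] by (simp add: poisson_point_process_def)
  have F: "F n j \<in> sets (M n)" if "ok n" "j \<in> J n" for n j
    unfolding F_def using that by (intro ppp_count_measurable[OF ppp]) (auto simp: ok_def)
  have X: "X n \<in> sets (M n)" for n
    unfolding X_def using F[of n] by (auto simp: ok_def)
  have lower: "1 - real (card (J n)) * p n \<le> measure (M n) (X n)" if "ok n" for n
  proof -
    interpret prob_space "M n" by (rule prob)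
    have fin: "finite (J n)" using that by (simp add: ok_def)
    have "measure (M n) (\<Union>j\<in>J n. F n j) \<le> (\<Sum>j\<in>J n. measure (M n) (F n j))"
      using F[OF that] fin by (intro finite_measure_subadditive_finite) auto
    also have "\<dots> \<le> real (card (J n)) * p n"
      using that by (intro sum_bounded_above) (auto simp: ok_def F_def)
    finally show ?thesis
      using that F[OF that] fin prob_compl[of "\<Union>j\<in>J n. F n j"] by (simp add: X_def sets.finite_UN)
  qed
  have "(\<lambda>n. measure (M n) (X n)) \<longlonglongrightarrow> 1"
  proof (rule tendsto_sandwich[OF _ _ _ tendsto_const])
    show "(\<lambda>n. 1 - real (card (J n)) * p n) \<longlonglongrightarrow> 1"
      using tendsto_diff[OF tendsto_const p, of 1] by simp
    show "\<forall>\<^sub>F n in sequentially. 1 - real (card (J n)) * p n \<le> measure (M n) (X n)"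
      using ev by eventually_elim (rule lower, simp add: ok_def)
    show "\<forall>\<^sub>F n in sequentially. measure (M n) (X n) \<le> 1"
      using prob_space.prob_le_1[OF prob] by simp
  qed
  moreover have "Q n j (card (V n \<omega> \<inter> A n j))" if "\<omega> \<in> X n" "j \<in> J n" for n \<omega> j
    using that by (auto simp: X_def F_def split: if_splits)
  ultimately show ?thesis
    unfolding aas_def using X by blast
qed

section \<open>The intensity measure\<close>

lemma space_hrg_intensity: "space (hrg_intensity \<alpha> C n) = disk (hrg_radius C n)"
  by (simp add: hrg_intensity_def space_restrict_space)

lemma disk_borel: "disk R \<in> sets borel"
  unfolding disk_def by (simp add: borel_Times)

lemma sets_hrg_intensity:
  assumes "A \<in> sets borel" "A \<subseteq> disk (hrg_radius C n)"
  shows "A \<in> sets (hrg_intensity \<alpha> C n)"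
  using assms by (auto simp: hrg_intensity_def sets_restrict_space_iff disk_borel)

text \<open>The intensity is a product of a radial and an angular part, and
  \<open>cosh (\<alpha> * r) / (2 * pi * (cosh (\<alpha> * R) - 1))\<close> is a primitive of the
  radial density.\<close>

lemma measure_hrg_rectangle:
  fixes \<alpha> C :: real and n :: nat
  defines "R \<equiv> hrg_radius C n"
  assumes \<alpha>: "0 < \<alpha>" and R: "0 < R" and ab: "0 \<le> a" "a \<le> b" "b \<le> R"
    and B: "B \<in> sets borel" "B \<subseteq> {0..<2 * pi}"
  shows "measure (hrg_intensity \<alpha> C n) ({a..b} \<times> B) =
    real n * ((cosh (\<alpha> * b) - cosh (\<alpha> * a)) / (cosh (\<alpha> * R) - 1)) * (measure lborel B / (2 * pi))"
proof -
  let ?g = "\<lambda>r. real n * radial_density \<alpha> R r"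
  let ?F = "\<lambda>r. real n * (cosh (\<alpha> * r) / (2 * pi * (cosh (\<alpha> * R) - 1)))"
  have pos: "0 < cosh (\<alpha> * R) - 1"
    using cosh_real_strict_mono[of 0 "\<alpha> * R"] \<alpha> R by simp
  have g0: "0 \<le> ?g r" if "0 \<le> r" for r
    using that \<alpha> pos by (simp add: radial_density_def)
  have g_meas [measurable]: "?g \<in> borel_measurable borel"
    unfolding radial_density_def by (intro borel_measurable_continuous_onI continuous_intros) (use pos in auto)
  have sub: "{a..b} \<times> B \<subseteq> disk R" and set: "{a..b} \<times> B \<in> sets borel"
    using ab B by (auto simp: disk_def intro!: borel_Times)
  have B_fin: "emeasure lborel B = ennreal (measure lborel B)"
  proof (rule emeasure_eq_ennreal_measure)
    have "emeasure lborel B \<le> emeasure lborel {0..2 * pi}"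
      using B(2) by (intro emeasure_mono) auto
    also have "\<dots> < \<infinity>" by simp
    finally show "emeasure lborel B \<noteq> top" by auto
  qed
  have "emeasure (hrg_intensity \<alpha> C n) ({a..b} \<times> B) =
    (\<integral>\<^sup>+x. ennreal (?g (fst x)) * indicator ({a..b} \<times> B) x \<partial>restrict_space lborel (disk R))"
    unfolding hrg_intensity_def R_def[symmetric]
  proof (rule emeasure_density)
    show "(\<lambda>x. ennreal (?g (fst x))) \<in> borel_measurable (restrict_space lborel (disk R))"
      unfolding radial_density_def
      by (intro measurable_restrict_space1 measurable_compose[OF _ measurable_ennreal])
         (simp, intro borel_measurable_continuous_onI continuous_intros, use pos in auto)
    show "{a..b} \<times> B \<in> sets (restrict_space lborel (disk R))"
      using sub set disk_borel by (auto simp: sets_restrict_space_iff)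
  qed
  also have "\<dots> = (\<integral>\<^sup>+x. ennreal (?g (fst x)) * indicator ({a..b} \<times> B) x \<partial>lborel)"
    using disk_borel by (subst nn_integral_restrict_space)
      (simp_all add: mult.assoc indicator_inter_arith[symmetric] Int_absorb2[OF sub])
  also have "\<dots> = (\<integral>\<^sup>+x. (ennreal (?g (fst x)) * indicator {a..b} (fst x)) * indicator B (snd x) \<partial>(lborel \<Otimes>\<^sub>M lborel))"
    unfolding lborel_prod by (intro nn_integral_cong) (auto simp: indicator_def)
  also have "\<dots> = (\<integral>\<^sup>+r. \<integral>\<^sup>+\<phi>. (ennreal (?g r) * indicator {a..b} r) * indicator B \<phi> \<partial>lborel \<partial>lborel)"
    using B(1) by (subst lborel.nn_integral_fst[symmetric]) simp_all
  also have "\<dots> = (\<integral>\<^sup>+r. (ennreal (?g r) * indicator {a..b} r) * emeasure lborel B \<partial>lborel)"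
    using B(1) by (simp add: nn_integral_cmult)
  also have "\<dots> = (\<integral>\<^sup>+r. ennreal (?g r) * indicator {a..b} r \<partial>lborel) * emeasure lborel B"
    by (rule nn_integral_multc) measurable
  also have "(\<integral>\<^sup>+r. ennreal (?g r) * indicator {a..b} r \<partial>lborel) = ennreal (?F b - ?F a)"
  proof (rule nn_integral_FTC_Icc[where F = ?F])
    fix x assume x: "x \<in> {a..b}"
    define K where "K = real n / (2 * pi * (cosh (\<alpha> * R) - 1))"
    have "((\<lambda>r. cosh (\<alpha> * r) * K) has_real_derivative sinh (\<alpha> * x) * \<alpha> * K) (at x)"
      by (auto intro!: derivative_eq_intros)
    moreover have "(\<lambda>r. cosh (\<alpha> * r) * K) = ?F" "sinh (\<alpha> * x) * \<alpha> * K = ?g x"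
      by (simp_all add: K_def radial_density_def fun_eq_iff)
    ultimately show "(?F has_real_derivative ?g x) (at x)" by simp
  qed (use ab g0 in auto)
  also have "ennreal (?F b - ?F a) * emeasure lborel B = ennreal ((?F b - ?F a) * measure lborel B)"
    unfolding B_fin by (simp add: ennreal_mult'')
  finally have em: "emeasure (hrg_intensity \<alpha> C n) ({a..b} \<times> B) = ennreal ((?F b - ?F a) * measure lborel B)" .
  have "cosh (\<alpha> * a) \<le> cosh (\<alpha> * b)"
    using ab \<alpha> by (subst cosh_real_nonneg_le_iff) auto
  then have "?F a \<le> ?F b"
    using pos by (intro mult_left_mono divide_right_mono) auto
  then have "0 \<le> (?F b - ?F a) * measure lborel B" by simp
  with em have "measure (hrg_intensity \<alpha> C n) ({a..b} \<times> B) = (?F b - ?F a) * measure lborel B"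
    by (simp add: measure_def)
  then show ?thesis by (simp add: diff_divide_distrib algebra_simps)
qed

lemma cosh_minus_1_le: "0 \<le> y \<Longrightarrow> cosh y - 1 \<le> exp y / (2 :: real)"
proof -
  assume "0 \<le> y"
  then have "exp (- y) \<le> 1" by simp
  moreover have "cosh y = exp y / 2 + exp (- y) / 2" by (simp add: cosh_field_def add_divide_distrib)
  ultimately show ?thesis by (simp del: exp_le_one_iff)
qed

lemma exp_ge_13: "4 \<le> y \<Longrightarrow> 13 \<le> exp (y :: real)"
proof -
  assume y: "4 \<le> y"
  have "(13 :: real) = 1 + 4 + 4\<^sup>2 / 2" by simp
  also have "\<dots> \<le> exp 4" by (rule exp_lower_Taylor_quadratic) simp
  also have "\<dots> \<le> exp y" using y by simp
  finally show ?thesis .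
qed

lemma cosh_minus_1_ge: "4 \<le> y \<Longrightarrow> exp y / 4 \<le> cosh y - (1 :: real)"
proof -
  assume "4 \<le> y"
  then have "13 \<le> exp y" by (rule exp_ge_13)
  moreover have "exp y / 2 \<le> cosh y" by (simp add: cosh_field_def)
  ultimately show ?thesis by linarith
qed

lemma measure_hrg_ball_le:
  fixes \<alpha> C :: real and n :: nat
  defines "R \<equiv> hrg_radius C n"
  assumes \<alpha>: "0 < \<alpha>" and R: "4 \<le> \<alpha> * R" and \<rho>: "0 \<le> \<rho>" "\<rho> \<le> R"
    and B: "B \<in> sets borel" "B \<subseteq> {0..<2 * pi}"
  shows "measure (hrg_intensity \<alpha> C n) ({0..\<rho>} \<times> B) \<le> real n * exp (- \<alpha> * (R - \<rho>)) * measure lborel B"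
proof -
  have "0 < \<alpha> * R" using R by linarith
  then have R0: "0 < R" using \<alpha> by (simp add: zero_less_mult_iff)
  have "(cosh (\<alpha> * \<rho>) - 1) / (cosh (\<alpha> * R) - 1) \<le> (exp (\<alpha> * \<rho>) / 2) / (exp (\<alpha> * R) / 4)"
    using cosh_minus_1_le[of "\<alpha> * \<rho>"] cosh_minus_1_ge[OF R] \<alpha> \<rho>
    by (intro frac_le) (auto simp: cosh_real_ge_1)
  also have "\<dots> = 2 * exp (- \<alpha> * (R - \<rho>))"
    by (simp add: exp_diff exp_minus field_simps)
  finally have "real n * ((cosh (\<alpha> * \<rho>) - 1) / (cosh (\<alpha> * R) - 1)) * (measure lborel B / (2 * pi))
      \<le> real n * (2 * exp (- \<alpha> * (R - \<rho>))) * (measure lborel B / (2 * pi))"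
    by (intro mult_right_mono mult_left_mono) auto
  also have "\<dots> = real n * exp (- \<alpha> * (R - \<rho>)) * (measure lborel B / pi)" by simp
  also have "\<dots> \<le> real n * exp (- \<alpha> * (R - \<rho>)) * measure lborel B"
    using pi_ge_two mult_right_mono[of 1 pi "measure lborel B"]
    by (intro mult_left_mono) (auto simp: field_simps)
  finally show ?thesis
    using measure_hrg_rectangle[of \<alpha> C n 0 \<rho> B] \<alpha> R0 \<rho> B by (simp add: R_def)
qed

lemma measure_hrg_ball_ge:
  fixes \<alpha> C :: real and n :: nat
  defines "R \<equiv> hrg_radius C n"
  assumes \<alpha>: "0 < \<alpha>" and \<rho>: "4 \<le> \<alpha> * \<rho>" "\<rho> \<le> R"
  shows "real n * exp (- \<alpha> * (R - \<rho>)) / 2 \<le> measure (hrg_intensity \<alpha> C n) ({0..\<rho>} \<times> {0..<2 * pi})"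
proof -
  have "0 < \<alpha> * \<rho>" using \<rho>(1) by linarith
  then have \<rho>0: "0 < \<rho>" using \<alpha> by (simp add: zero_less_mult_iff)
  have "\<alpha> * \<rho> \<le> \<alpha> * R" using \<rho>(2) \<alpha> by simp
  then have \<alpha>R: "4 \<le> \<alpha> * R" using \<rho>(1) by linarith
  note pos = cosh_minus_1_ge[OF \<alpha>R]
  have "exp (- \<alpha> * (R - \<rho>)) / 2 = (exp (\<alpha> * \<rho>) / 4) / (exp (\<alpha> * R) / 2)"
    by (simp add: exp_diff exp_minus field_simps)
  also have "\<dots> \<le> (cosh (\<alpha> * \<rho>) - 1) / (cosh (\<alpha> * R) - 1)"
  proof (rule frac_le)
    show "0 \<le> cosh (\<alpha> * \<rho>) - 1" by (simp add: cosh_real_ge_1)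
    show "exp (\<alpha> * \<rho>) / 4 \<le> cosh (\<alpha> * \<rho>) - 1" by (rule cosh_minus_1_ge[OF \<rho>(1)])
    show "0 < cosh (\<alpha> * R) - 1" using pos exp_ge_13[OF \<alpha>R] by linarith
    show "cosh (\<alpha> * R) - 1 \<le> exp (\<alpha> * R) / 2" using \<alpha>R by (intro cosh_minus_1_le) simp
  qed
  finally have "real n * (exp (- \<alpha> * (R - \<rho>)) / 2) \<le> real n * ((cosh (\<alpha> * \<rho>) - 1) / (cosh (\<alpha> * R) - 1))"
    by (intro mult_left_mono) auto
  then show ?thesis
    using measure_hrg_rectangle[of \<alpha> C n 0 \<rho> "{0..<2 * pi}"] \<alpha> \<rho> \<rho>0 by (simp add: R_def)
qed

text \<open>One unit inwards, \<open>exp (\<alpha> * r)\<close> shrinks at least by the factor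
  \<open>2 / 3\<close>, so the outermost annulus holds a constant share, here a quarter, of every
  sector; \<open>2 * pi \<le> 8\<close> turns it into \<open>1 / 32\<close>.\<close>

lemma measure_hrg_boundary_ge:
  fixes \<alpha> C :: real and n :: nat
  defines "R \<equiv> hrg_radius C n"
  assumes \<alpha>: "1 / 2 \<le> \<alpha>" and R: "4 \<le> \<alpha> * R" "1 \<le> R"
    and B: "B \<in> sets borel" "B \<subseteq> {0..<2 * pi}"
  shows "real n * measure lborel B / 32 \<le> measure (hrg_intensity \<alpha> C n) ({R - 1..R} \<times> B)"
proof -
  let ?y = "\<alpha> * R"
  have "exp (- \<alpha>) \<le> exp (- (1 / 2))" using \<alpha> by simp
  also have "\<dots> \<le> 2 / 3"
    using exp_ge_add_one_self[of "1 / 2 :: real"] by (simp add: exp_minus field_simps)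
  finally have e: "exp (- \<alpha>) \<le> 2 / 3" .
  have "\<alpha> * (R - 1) \<ge> 0" using \<alpha> R by simp
  then have e1: "exp (- (\<alpha> * (R - 1))) \<le> 1" by simp
  have "exp (\<alpha> * (R - 1)) = exp ?y * exp (- \<alpha>)" by (simp add: mult_exp_exp algebra_simps)
  also have "\<dots> \<le> exp ?y * (2 / 3)" using e by (intro mult_left_mono) auto
  finally have e2: "exp (\<alpha> * (R - 1)) \<le> exp ?y * (2 / 3)" .
  have "cosh (\<alpha> * (R - 1)) = exp (\<alpha> * (R - 1)) / 2 + exp (- (\<alpha> * (R - 1))) / 2"
    by (simp add: cosh_field_def add_divide_distrib)
  also have "\<dots> \<le> exp ?y * (2 / 3) / 2 + 1 / 2"
    using e1 e2 by (intro add_mono divide_right_mono) auto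
  finally have c1: "cosh (\<alpha> * (R - 1)) \<le> exp ?y / 3 + 1 / 2" by simp
  have c2: "exp ?y / 2 \<le> cosh ?y" by (simp add: cosh_field_def)
  have pos: "0 < cosh ?y - 1" using cosh_minus_1_ge[OF R(1)] exp_ge_13[OF R(1)] by linarith
  have "1 / 4 * (cosh ?y - 1) \<le> cosh ?y - cosh (\<alpha> * (R - 1))"
  proof -
    have "1 / 4 * (c - 1) \<le> c - c'" if "c' \<le> e / 3 + 1 / 2" "e / 2 \<le> c" "13 \<le> e" for c c' e :: real
      using that by (simp add: field_simps)
    then show ?thesis using c1 c2 exp_ge_13[OF R(1)] by blast
  qed
  then have ratio: "1 / 4 \<le> (cosh ?y - cosh (\<alpha> * (R - 1))) / (cosh ?y - 1)"
    using pos by (simp add: pos_le_divide_eq)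
  have angle: "measure lborel B / 8 \<le> measure lborel B / (2 * pi)"
    using pi_less_4 by (intro divide_left_mono) auto
  have "real n * (1 / 4) * x \<le> real n * r * y" if "1 / 4 \<le> r" "x \<le> y" "0 \<le> x" for r x y :: real
    using that by (intro mult_mono mult_left_mono) auto
  from this[OF ratio angle]
  have "real n * (1 / 4) * (measure lborel B / 8)
      \<le> real n * ((cosh ?y - cosh (\<alpha> * (R - 1))) / (cosh ?y - 1)) * (measure lborel B / (2 * pi))"
    by simp
  then show ?thesis
    using measure_hrg_rectangle[of \<alpha> C n "R - 1" R B] \<alpha> R B by (simp add: R_def)
qed

section \<open>Adjacency in polar coordinates\<close>

text \<open>Distance on the circle between representatives in \<open>[0, 2 * pi)\<close>; the second
  alternative is closeness across the cut at angle zero.\<close>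

definition near_angle :: "real \<Rightarrow> real \<Rightarrow> real \<Rightarrow> bool" where
  "near_angle \<eta> a b \<longleftrightarrow> \<bar>a - b\<bar> \<le> \<eta> \<or> 2 * pi - \<eta> \<le> \<bar>a - b\<bar>"

lemma near_angle_sym: "near_angle \<eta> a b \<longleftrightarrow> near_angle \<eta> b a"
  by (simp add: near_angle_def abs_minus_commute)

lemma near_angle_mono: "near_angle \<eta> a b \<Longrightarrow> \<eta> \<le> \<eta>' \<Longrightarrow> near_angle \<eta>' a b"
  by (auto simp: near_angle_def)

lemma near_angle_trans_abs: "near_angle \<eta> a b \<Longrightarrow> \<bar>c - a\<bar> \<le> \<delta> \<Longrightarrow> near_angle (\<eta> + \<delta>) c b"
  by (auto simp: near_angle_def)

text \<open>Jordan's inequality: the concave sine lies above its chord.\<close>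

lemma sin_ge_linear:
  assumes "0 \<le> x" "x \<le> pi / 2"
  shows "2 / pi * x \<le> sin x"
proof -
  have conc: "concave_on {0..pi} sin"
    unfolding concave_on_def
    by (rule convex_on_realI[where f'="\<lambda>x. - cos x"])
       (auto intro!: derivative_eq_intros cos_monotone_0_pi_le)
  have "(1 - 2 / pi * x) * sin 0 + (2 / pi * x) * sin (pi / 2) \<le> sin ((1 - 2 / pi * x) *\<^sub>R 0 + (2 / pi * x) *\<^sub>R (pi / 2))"
    using assms by (intro concave_onD[OF conc]) (auto simp: field_simps)
  then show ?thesis by simp
qed

lemma exp_half_power2: "(exp (t / 2))\<^sup>2 = exp (t :: real)"
  by (simp add: power2_eq_square mult_exp_exp)

text \<open>With \<open>d\<close> half the angle difference the hypothesis says
  \<open>sin d \<le> y\<close>. Jordan's inequality is applied to \<open>d\<close> itself if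
  \<open>d \<le> pi / 2\<close>, and otherwise to \<open>pi - d\<close>, half the angle across the
  cut.\<close>

lemma near_angle_of_cos:
  assumes ab: "a \<in> {0..<2 * pi}" "b \<in> {0..<2 * pi}" and y: "1 - cos (a - b) \<le> 2 * y\<^sup>2" "0 \<le> y"
  shows "near_angle (pi * y) a b"
proof -
  define d where "d = \<bar>a - b\<bar> / 2"
  have d: "0 \<le> d" "d < pi" using ab by (auto simp: d_def)
  have "cos (a - b) = cos (2 * d)" by (simp add: d_def)
  then have "2 * (sin d)\<^sup>2 \<le> 2 * y\<^sup>2"
    using y(1) cos_double_sin[of d] by linarith
  then have s: "sin d \<le> y" using y(2) by (auto intro: power2_le_imp_le[of "sin d" y])
  show ?thesis
  proof (cases "d \<le> pi / 2")
    case True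
    then have "2 / pi * d \<le> y" using sin_ge_linear[OF d(1)] s by linarith
    then have "2 * d \<le> pi * y" by (simp add: pos_divide_le_eq mult.commute)
    then show ?thesis by (simp add: near_angle_def d_def)
  next
    case False
    then have "2 / pi * (pi - d) \<le> sin (pi - d)" using d by (intro sin_ge_linear) auto
    also have "\<dots> \<le> y" using s by simp
    finally have "2 * (pi - d) \<le> pi * y" by (simp add: pos_divide_le_eq mult.commute)
    then show ?thesis by (simp add: near_angle_def d_def)
  qed
qed

text \<open>The addition theorem splits the distance formula into its value for equal angles and a
  nonnegative angular excess.\<close>

lemma hyp_dist_le_iff:
  assumes "0 \<le> fst x" "0 \<le> fst y" "0 \<le> R"
  shows "hyp_dist x y \<le> R \<longleftrightarrow>
    cosh (fst x - fst y) + sinh (fst x) * sinh (fst y) * (1 - cos (snd x - snd y)) \<le> cosh R"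
proof -
  have "hyp_dist x y \<le> R \<longleftrightarrow> cosh (hyp_dist x y) \<le> cosh R"
    using hyp_dist_nonneg_cosh(1)[OF assms(1,2)] assms(3) by (simp add: cosh_real_nonneg_le_iff)
  then show ?thesis
    using hyp_dist_nonneg_cosh(2)[OF assms(1,2)] by (simp add: cosh_diff algebra_simps)
qed

text \<open>The angular excess is at most \<open>exp R\<close>, and
  \<open>exp r / 4 \<le> sinh r\<close> solves this for the angle. The two factors
  \<open>1 / 4\<close> give 16, twice the square of \<open>sqrt 8\<close>, and
  \<open>pi * sqrt 8 \<le> 9\<close>.\<close>

lemma hyp_adj_imp_near_angle:
  assumes x: "x \<in> disk R" "1 \<le> fst x" and y: "y \<in> disk R" "1 \<le> fst y" and adj: "hyp_adj R x y"
  shows "near_angle (9 * exp ((R - fst x - fst y) / 2)) (snd x) (snd y)"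
proof -
  have R: "1 \<le> R" using x by (auto simp: disk_def)
  have ge: "exp r / 4 \<le> sinh r" if "1 \<le> r" for r :: real
  proof -
    define e E where "e = exp (- r)" and "E = exp r"
    have "e \<le> 1" "1 + r \<le> E" using that exp_ge_add_one_self[of r] by (auto simp: e_def E_def)
    then have "E / 4 \<le> (E - e) / 2" using that by (simp add: field_simps)
    then show ?thesis by (simp add: sinh_field_def e_def E_def)
  qed
  have "sinh (fst x) * sinh (fst y) * (1 - cos (snd x - snd y)) \<le> cosh R - cosh (fst x - fst y)"
    using adj hyp_dist_le_iff[of x y R] x y R by (auto simp: hyp_adj_def)
  also have "\<dots> \<le> cosh R" by simp
  also have "\<dots> \<le> exp R" using R by (simp add: cosh_def)
  finally have 1: "sinh (fst x) * sinh (fst y) * (1 - cos (snd x - snd y)) \<le> exp R" .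
  have "(exp (fst x) / 4) * (exp (fst y) / 4) * (1 - cos (snd x - snd y)) \<le> sinh (fst x) * sinh (fst y) * (1 - cos (snd x - snd y))"
    using ge[OF x(2)] ge[OF y(2)] x y by (intro mult_right_mono mult_mono) auto
  with 1 have "exp (fst x) * exp (fst y) * (1 - cos (snd x - snd y)) \<le> 16 * exp R" by simp
  then have "1 - cos (snd x - snd y) \<le> 16 * exp R / (exp (fst x) * exp (fst y))"
    by (simp add: pos_le_divide_eq mult.commute)
  also have "\<dots> = 16 * exp (R - fst x - fst y)" by (simp add: exp_diff)
  also have "\<dots> = 2 * (sqrt 8 * exp ((R - fst x - fst y) / 2))\<^sup>2"
    by (simp add: power_mult_distrib exp_half_power2)
  finally have "near_angle (pi * (sqrt 8 * exp ((R - fst x - fst y) / 2))) (snd x) (snd y)"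
    using x y by (intro near_angle_of_cos) (auto simp: disk_def)
  moreover have "pi * sqrt 8 \<le> 9"
  proof -
    have "pi * sqrt 8 \<le> 3.15 * 2.85"
    proof (rule mult_mono)
      show "pi \<le> 3.15" using pi_approx by simp
      show "sqrt 8 \<le> 2.85" by (rule real_le_lsqrt) (auto simp: power2_eq_square)
    qed auto
    then show ?thesis by simp
  qed
  ultimately show ?thesis
    by (elim near_angle_mono) (simp add: mult.assoc[symmetric])
qed

text \<open>Radii in \<open>[1, R]\<close> differ by at most \<open>R - 1\<close>, which leaves
  \<open>cosh R - cosh (R - 1) \<ge> exp R / 8\<close> for the angular excess. This is what
  \<open>sinh r \<le> exp r / 2\<close> and the quadratic bound on the cosine cost.\<close>

lemma hyp_adj_of_angle:
  assumes x: "1 \<le> fst x" "fst x \<le> R" and y: "1 \<le> fst y" "fst y \<le> R" and R: "2 \<le> R" and ne: "x \<noteq> y"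
    and ang: "\<bar>snd x - snd y\<bar> \<le> exp ((R - fst x - fst y) / 2)"
  shows "hyp_adj R x y"
proof -
  have "\<bar>fst x - fst y\<bar> \<le> \<bar>R - 1\<bar>" using x y by auto
  then have 1: "cosh (fst x - fst y) \<le> cosh (R - 1)"
    using cosh_real_nonneg_le_iff[of "\<bar>fst x - fst y\<bar>" "\<bar>R - 1\<bar>"] by simp
  have sinh_le: "sinh r \<le> exp r / 2" for r :: real by (simp add: sinh_field_def)
  have "(snd x - snd y)\<^sup>2 \<le> (exp ((R - fst x - fst y) / 2))\<^sup>2"
    using ang by (simp add: abs_le_square_iff[symmetric])
  also have "\<dots> = exp R / (exp (fst x) * exp (fst y))" by (simp add: exp_half_power2 exp_diff)
  finally have 2: "(snd x - snd y)\<^sup>2 \<le> exp R / (exp (fst x) * exp (fst y))" .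
  have "1 - cos (snd x - snd y) \<le> (snd x - snd y)\<^sup>2 / 2"
  proof -
    define t where "t = (snd x - snd y) / 2"
    have "(sin t)\<^sup>2 \<le> t\<^sup>2"
      using abs_sin_x_le_abs_x[of t] by (simp add: abs_le_square_iff)
    moreover have "snd x - snd y = 2 * t" by (simp add: t_def)
    ultimately show ?thesis
      by (simp add: cos_double_sin power_mult_distrib)
  qed
  with 2 have "1 - cos (snd x - snd y) \<le> exp R / (exp (fst x) * exp (fst y)) / 2" by simp
  then have "sinh (fst x) * sinh (fst y) * (1 - cos (snd x - snd y)) \<le>
     (exp (fst x) / 2 * (exp (fst y) / 2)) * (exp R / (exp (fst x) * exp (fst y)) / 2)"
    using sinh_le x y by (intro mult_mono) auto
  also have "\<dots> = exp R / 8" by (simp add: field_simps)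
  also have "\<dots> \<le> cosh R - cosh (R - 1)"
  proof -
    have e: "exp (- 1) \<le> (1 / 2 :: real)" using exp_ge_add_one_self[of "1 :: real"] by (simp add: exp_minus field_simps)
    have "exp (R - 1) = exp R * exp (- 1)" by (simp add: exp_diff exp_minus field_simps)
    also have "\<dots> \<le> exp R * (1 / 2)" using e by (intro mult_left_mono) auto
    finally have a: "exp (R - 1) \<le> exp R / 2" by simp
    have "(2 :: real)\<^sup>2 \<le> (exp 1)\<^sup>2"
      using exp_ge_add_one_self[of "1 :: real"] by (intro power_mono) auto
    also have "\<dots> = exp 2" by (simp add: power2_eq_square mult_exp_exp)
    also have "\<dots> \<le> exp R" using R by simp
    finally have b: "4 \<le> exp R" by simp
    have "cosh (R - 1) = exp (R - 1) / 2 + exp (1 - R) / 2" by (simp add: cosh_field_def add_divide_distrib)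
    also have "\<dots> \<le> exp R / 2 / 2 + 1 / 2" using a R by (intro add_mono divide_right_mono) auto
    finally have "cosh (R - 1) \<le> exp R / 4 + 1 / 2" by simp
    moreover have "exp R / 2 \<le> cosh R" by (simp add: cosh_field_def)
    ultimately show ?thesis using b by linarith
  qed
  finally have "cosh (fst x - fst y) + sinh (fst x) * sinh (fst y) * (1 - cos (snd x - snd y)) \<le> cosh R"
    using 1 by linarith
  then show ?thesis using ne hyp_dist_le_iff[of x y R] x y R by (simp add: hyp_adj_def)
qed

text \<open>The worst case is a pair of opposite angles, where the distance is the sum of the
  radii.\<close>

lemma hyp_adj_of_radii:
  assumes x: "0 \<le> fst x" and y: "0 \<le> fst y" and R: "fst x + fst y \<le> R" and ne: "x \<noteq> y"
  shows "hyp_adj R x y"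
proof -
  have "sinh (fst x) * sinh (fst y) * (1 - cos (snd x - snd y)) \<le> sinh (fst x) * sinh (fst y) * 2"
    using x y cos_ge_minus_one[of "snd x - snd y"] by (intro mult_left_mono) auto
  then have "cosh (fst x - fst y) + sinh (fst x) * sinh (fst y) * (1 - cos (snd x - snd y)) \<le> cosh (fst x + fst y)"
    by (simp add: cosh_diff cosh_add)
  also have "\<dots> \<le> cosh R" using x y R by (simp add: cosh_real_nonneg_le_iff)
  finally show ?thesis using ne hyp_dist_le_iff[of x y R] x y R by (simp add: hyp_adj_def)
qed

lemma hyp_adj_sym: "hyp_adj R x y \<Longrightarrow> hyp_adj R y x"
proof -
  have "cos (snd y - snd x) = cos (snd x - snd y)"
    by (metis cos_minus minus_diff_eq)
  then show "hyp_adj R x y \<Longrightarrow> hyp_adj R y x"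
    by (auto simp: hyp_adj_def hyp_dist_def mult.commute)
qed

lemma hyp_adj_irrefl: "\<not> hyp_adj R x x"
  by (simp add: hyp_adj_def)

section \<open>Regions of the disk\<close>

lemma fmeasurable_lborel_interval: "{a..b} \<in> fmeasurable lborel" "{a..<b} \<in> fmeasurable lborel" for a b :: real
proof -
  have "emeasure lborel {a..b} < \<infinity>" by (simp add: emeasure_lborel_Icc_eq)
  then show Icc: "{a..b} \<in> fmeasurable lborel" by (simp add: fmeasurable_def)
  show "{a..<b} \<in> fmeasurable lborel"
    by (rule fmeasurableI2[OF Icc]) auto
qed

locale hrg_parameters =
  fixes \<alpha> C :: real
  assumes \<alpha>_gt: "1 / 2 < \<alpha>" and \<alpha>_lt: "\<alpha> < 1"
begin

text \<open>The room between \<alpha> and \<open>1 / 2\<close>, spent as an exponent of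
  \<open>ln n\<close>. The normalisation \<open>1 + 4 * \<tau> = 2 * \<alpha>\<close> is what
  \<open>exponent_gap\<close> consumes.\<close>

definition \<tau> :: real where "\<tau> = (2 * \<alpha> - 1) / 4"
definition R :: "nat \<Rightarrow> real" where "R n = hrg_radius C n"
definition L :: "nat \<Rightarrow> real" where "L n = ln (real n)"

text \<open>The depth of a point is its distance from the boundary of the disk.  A.a.s. no vertex is
  deeper than \<open>max_depth\<close>, polylogarithmically many are deeper than \<open>hub_depth\<close> and
  \<open>sep_depth\<close>, and those of the latter depth have pairwise well separated angles.\<close>

definition max_depth :: "nat \<Rightarrow> real" where "max_depth n = (L n + \<tau> * ln (L n)) / \<alpha>"
definition hub_depth :: "nat \<Rightarrow> real" where "hub_depth n = (L n - (1 + \<tau>) * ln (L n)) / \<alpha>"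
definition sep_depth :: "nat \<Rightarrow> real" where "sep_depth n = hub_depth n - 4 * ln (L n)"
text \<open>A cell of this width meets the outermost annulus in intensity at least
  \<open>2 * L n\<close>, so it is empty with probability at most \<open>exp (- 2 * L n)\<close>,
  enough for a union bound over \<open>n\<close> cells.\<close>

definition cell_width :: "nat \<Rightarrow> real" where "cell_width n = 64 * L n / real n"
text \<open>The exponential bounds the arc of every vertex. The factor 20 covers two such arcs as
  well as one arc plus the reach with constant 16 in \<open>near_leaves\<close>.\<close>

definition sep_angle :: "nat \<Rightarrow> real" where "sep_angle n = 20 * exp ((max_depth n - R n) / 2)"
text \<open>The constant of \<open>measure_region_le\<close>: a geometric series in
  \<open>exp (1 / 2 - \<alpha>)\<close>, convergent because \<open>\<alpha> > 1 / 2\<close>.\<close>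

definition deg_const :: real where "deg_const = 60 * exp 1 * exp (- C / 2) / (1 - exp (1 / 2 - \<alpha>))"

lemma \<tau>_pos: "0 < \<tau>" and \<tau>_less: "\<tau> < 1 / 4" and \<tau>_\<alpha>: "1 + 4 * \<tau> = 2 * \<alpha>"
  using \<alpha>_gt \<alpha>_lt by (auto simp: \<tau>_def field_simps)

lemmas asymp_defs = R_def hrg_radius_def L_def max_depth_def hub_depth_def sep_depth_def
  cell_width_def sep_angle_def

lemma deg_const_pos: "0 < deg_const"
  using \<alpha>_gt by (simp add: deg_const_def)

lemma ev_L: "\<forall>\<^sub>F n in sequentially. 1 \<le> L n"
  unfolding L_def by real_asymp

lemma ev_R: "\<forall>\<^sub>F n in sequentially. 4 \<le> \<alpha> * R n \<and> 16 \<le> R n"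
proof (rule eventually_conj)
  show "\<forall>\<^sub>F n in sequentially. 4 \<le> \<alpha> * R n"
    using \<alpha>_gt unfolding asymp_defs by real_asymp
  show "\<forall>\<^sub>F n in sequentially. 16 \<le> R n"
    unfolding asymp_defs by real_asymp
qed

lemma exp_L: "1 \<le> L n \<Longrightarrow> exp (L n) = real n"
  by (cases "n = 0") (auto simp: L_def)

lemma n_pos: "1 \<le> L n \<Longrightarrow> 0 < n"
  by (cases "n = 0") (auto simp: L_def)

lemma exp_half_R: "1 \<le> L n \<Longrightarrow> exp (- R n / 2) = exp (- C / 2) / real n"
proof -
  assume L: "1 \<le> L n"
  have "- R n / 2 = - C / 2 - L n"
    by (simp add: R_def hrg_radius_def L_def field_simps)
  then show ?thesis using exp_L[OF L] by (simp add: exp_diff)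
qed

text \<open>\<open>real n * exp (- \<alpha> * x)\<close> is, up to constants, the expected number of
  vertices of depth at least \<open>x\<close>. The three depth scales make it vanish, exceed
  \<open>ln n\<close> by a power of \<open>ln n\<close>, and stay polylogarithmic.\<close>

lemma exp_max_depth: "1 \<le> L n \<Longrightarrow> real n * exp (- \<alpha> * max_depth n) = L n powr - \<tau>"
proof -
  assume L: "1 \<le> L n"
  have "- \<alpha> * max_depth n = - L n - \<tau> * ln (L n)"
    using \<alpha>_gt by (simp add: max_depth_def)
  then show ?thesis
    using L exp_L[OF L] n_pos[OF L] by (simp add: powr_def exp_diff exp_minus inverse_eq_divide)
qed

lemma exp_hub_depth: "1 \<le> L n \<Longrightarrow> real n * exp (- \<alpha> * hub_depth n) = L n powr (1 + \<tau>)"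
proof -
  assume L: "1 \<le> L n"
  have "- \<alpha> * hub_depth n = (1 + \<tau>) * ln (L n) - L n"
    using \<alpha>_gt by (simp add: hub_depth_def)
  then show ?thesis
    using L exp_L[OF L] n_pos[OF L] by (simp add: powr_def exp_diff)
qed

lemma exp_sep_depth: "1 \<le> L n \<Longrightarrow> real n * exp (- \<alpha> * sep_depth n) = L n powr (1 + \<tau> + 4 * \<alpha>)"
proof -
  assume L: "1 \<le> L n"
  have "- \<alpha> * sep_depth n = (1 + \<tau> + 4 * \<alpha>) * ln (L n) - L n"
    using \<alpha>_gt by (simp add: sep_depth_def hub_depth_def field_simps)
  then show ?thesis
    using L exp_L[OF L] n_pos[OF L] by (simp add: powr_def exp_diff)
qed

definition ball :: "nat \<Rightarrow> real \<Rightarrow> real set \<Rightarrow> point set" where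
  "ball n x B = {0..R n - x} \<times> B"

definition angles :: "real \<Rightarrow> real \<Rightarrow> real set" where
  "angles \<eta> c = {\<phi> \<in> {0..<2 * pi}. near_angle \<eta> \<phi> c}"

lemma angles_borel: "angles \<eta> c \<in> sets borel"
proof -
  have "angles \<eta> c = {0..<2 * pi} \<inter> ({\<phi>. \<bar>\<phi> - c\<bar> \<le> \<eta>} \<union> {\<phi>. 2 * pi - \<eta> \<le> \<bar>\<phi> - c\<bar>})"
    by (auto simp: angles_def near_angle_def)
  also have "\<dots> \<in> sets borel"
    by (intro sets.Int sets.Un borel_closed[OF closed_Collect_le] continuous_intros) auto
  finally show ?thesis .
qed

lemma measure_angles_le:
  assumes c: "0 \<le> c" "c \<le> 2 * pi" and \<eta>: "0 \<le> \<eta>"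
  shows "measure lborel (angles \<eta> c) \<le> 6 * \<eta>"
proof -
  let ?I = "{c - \<eta>..c + \<eta>}" and ?J = "{c + 2 * pi - \<eta>..c + 2 * pi + \<eta>}" and ?K = "{c - 2 * pi - \<eta>..c - 2 * pi + \<eta>}"
  have "measure lborel (angles \<eta> c) \<le> measure lborel (?I \<union> ?J \<union> ?K)"
  proof (rule measure_mono_fmeasurable)
    show "angles \<eta> c \<subseteq> ?I \<union> ?J \<union> ?K"
      using c \<eta> by (auto simp: angles_def near_angle_def abs_if split: if_splits)
    show "angles \<eta> c \<in> sets lborel" using angles_borel by simp
    show "?I \<union> ?J \<union> ?K \<in> fmeasurable lborel" by (intro fmeasurable.Un fmeasurable_lborel_interval)
  qed
  also have "\<dots> \<le> measure lborel ?I + measure lborel ?J + measure lborel ?K"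
    by (intro order_trans[OF measure_Un_le] add_mono) auto
  finally show ?thesis using \<eta> by simp
qed

lemma sets_ball:
  assumes "0 \<le> x" "B \<in> sets borel" "B \<subseteq> {0..<2 * pi}"
  shows "ball n x B \<in> sets (hrg_intensity \<alpha> C n)"
  using assms by (intro sets_hrg_intensity) (auto simp: ball_def disk_def R_def intro!: borel_Times)

lemma measure_ball_le:
  assumes R: "4 \<le> \<alpha> * R n" and "0 \<le> x" "B \<in> sets borel" "B \<subseteq> {0..<2 * pi}"
  shows "measure (hrg_intensity \<alpha> C n) (ball n x B) \<le> real n * exp (- \<alpha> * x) * measure lborel B"
proof (cases "x \<le> R n")
  case True
  then show ?thesis
    using measure_hrg_ball_le[of \<alpha> C n "R n - x" B] assms \<alpha>_gt by (simp add: ball_def R_def)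
qed (simp add: ball_def)

lemma measure_ball_ge:
  assumes "4 \<le> \<alpha> * (R n - x)" "0 \<le> x"
  shows "real n * exp (- \<alpha> * x) / 2 \<le> measure (hrg_intensity \<alpha> C n) (ball n x {0..<2 * pi})"
  using measure_hrg_ball_ge[of \<alpha> "R n - x" C n] assms \<alpha>_gt by (simp add: ball_def R_def)

definition layers :: "nat \<Rightarrow> nat set" where "layers n = {..nat \<lfloor>R n\<rfloor>}"

text \<open>Up to constants the angle within which a point of depth \<open>k\<close> reaches the
  boundary circle. Cells of this width enlarge neighbourhoods by a constant factor only, and a layer
  has \<open>O(exp (R n / 2))\<close> of them.\<close>

definition layer_cell :: "nat \<Rightarrow> nat \<Rightarrow> real" where "layer_cell n k = exp ((real k - R n) / 2)"

text \<open>\<open>region n k i\<close> contains all possible neighbours of all points whose depth is in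
  \<open>[k, k + 1)\<close> and whose angle is in the \<open>i\<close>-th cell of width \<open>layer_cell n k\<close>.\<close>

definition region :: "nat \<Rightarrow> nat \<Rightarrow> nat \<Rightarrow> point set" where
  "region n k i = (\<Union>j\<in>layers n. ball n (real j)
     (angles (9 * exp ((real k + real j + 2 - R n) / 2) + layer_cell n k) (real i * layer_cell n k)))"

lemma sets_region: "region n k i \<in> sets (hrg_intensity \<alpha> C n)"
  unfolding region_def layers_def
  by (intro sets.finite_UN sets_ball angles_borel) (auto simp: angles_def)

text \<open>The intensity of depth at least \<open>j\<close> is of order
  \<open>n * exp (- \<alpha> * j)\<close>, and such points are near depth \<open>k\<close> within an
  angle of order \<open>exp ((k + j - R n) / 2)\<close>. As \<open>exp (- R n / 2)\<close> is of
  order \<open>1 / n\<close>, the sum over \<open>j\<close> is geometric.\<close>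

lemma measure_region_le:
  assumes R: "4 \<le> \<alpha> * R n" and L: "1 \<le> L n" and i: "real i * layer_cell n k \<le> 2 * pi"
  shows "measure (hrg_intensity \<alpha> C n) (region n k i) \<le> deg_const * exp (real k / 2)"
proof -
  let ?\<mu> = "hrg_intensity \<alpha> C n"
  let ?\<eta> = "\<lambda>j. 9 * exp ((real k + real j + 2 - R n) / 2) + layer_cell n k"
  let ?B = "\<lambda>j. ball n (real j) (angles (?\<eta> j) (real i * layer_cell n k))"
  let ?x = "exp (1 / 2 - \<alpha>)"
  have x: "0 < ?x" "?x < 1" using \<alpha>_gt by auto
  have c0: "0 \<le> real i * layer_cell n k" by (simp add: layer_cell_def)
  have n0: "0 < real n" using L by (cases "n = 0") (auto simp: L_def)
  have B: "measure ?\<mu> (?B j) \<le> 60 * exp 1 * exp (- C / 2) * exp (real k / 2) * ?x ^ j" for j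
  proof -
    have "layer_cell n k \<le> exp 1 * exp ((real k + real j - R n) / 2)"
      unfolding layer_cell_def mult_exp_exp exp_le_cancel_iff by (simp add: field_simps)
    moreover have "exp ((real k + real j + 2 - R n) / 2) = exp 1 * exp ((real k + real j - R n) / 2)"
      by (simp add: mult_exp_exp field_simps)
    ultimately have \<eta>: "?\<eta> j \<le> 10 * exp 1 * exp ((real k + real j - R n) / 2)" by simp
    have \<eta>0: "0 \<le> ?\<eta> j" by (simp add: layer_cell_def)
    have "measure ?\<mu> (?B j) \<le> real n * exp (- \<alpha> * real j) * measure lborel (angles (?\<eta> j) (real i * layer_cell n k))"
      using R by (intro measure_ball_le angles_borel) (auto simp: angles_def)
    also have "\<dots> \<le> real n * exp (- \<alpha> * real j) * (6 * ?\<eta> j)"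
      using measure_angles_le[OF c0 i \<eta>0] by (intro mult_left_mono) auto
    also have "\<dots> \<le> real n * exp (- \<alpha> * real j) * (6 * (10 * exp 1 * exp ((real k + real j - R n) / 2)))"
      using \<eta> by (intro mult_left_mono) auto
    also have "exp ((real k + real j - R n) / 2) = exp (real k / 2) * exp (real j / 2) * exp (- R n / 2)"
      by (simp add: mult_exp_exp field_simps)
    also have "real n * exp (- \<alpha> * real j) * (6 * (10 * exp 1 * (exp (real k / 2) * exp (real j / 2) * exp (- R n / 2))))
        = 60 * exp 1 * exp (- C / 2) * exp (real k / 2) * (exp (real j / 2) * exp (- \<alpha> * real j))"
      using n0 unfolding exp_half_R[OF L] by simp
    also have "exp (real j / 2) * exp (- \<alpha> * real j) = ?x ^ j"
      by (simp add: mult_exp_exp exp_of_nat_mult[symmetric] algebra_simps)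
    finally show ?thesis .
  qed
  have "measure ?\<mu> (region n k i) \<le> (\<Sum>j\<in>layers n. measure ?\<mu> (?B j))"
    unfolding region_def
  proof (rule measure_UNION_le)
    show "finite (layers n)" by (simp add: layers_def)
    show "?B j \<in> sets ?\<mu>" for j
      by (intro sets_ball angles_borel) (auto simp: angles_def)
  qed
  also have "\<dots> \<le> (\<Sum>j\<in>layers n. 60 * exp 1 * exp (- C / 2) * exp (real k / 2) * ?x ^ j)"
    by (intro sum_mono B)
  also have "\<dots> = 60 * exp 1 * exp (- C / 2) * exp (real k / 2) * (\<Sum>j\<in>layers n. ?x ^ j)"
    by (simp add: sum_distrib_left)
  also have "(\<Sum>j\<in>layers n. ?x ^ j) \<le> 1 / (1 - ?x)"
  proof -
    have "(\<Sum>j\<in>layers n. ?x ^ j) \<le> (\<Sum>j. ?x ^ j)"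
      using x by (intro sum_le_suminf summable_geometric) (auto simp: layers_def)
    also have "\<dots> = 1 / (1 - ?x)" using x by (intro suminf_geometric) simp
    finally show ?thesis .
  qed
  then have "60 * exp 1 * exp (- C / 2) * exp (real k / 2) * (\<Sum>j\<in>layers n. ?x ^ j)
      \<le> 60 * exp 1 * exp (- C / 2) * exp (real k / 2) * (1 / (1 - ?x))"
    by (intro mult_left_mono) auto
  also have "\<dots> = deg_const * exp (real k / 2)"
    by (simp add: deg_const_def)
  finally show ?thesis .
qed

definition cell :: "nat \<Rightarrow> nat \<Rightarrow> point set" where
  "cell n i = {R n - 1..R n} \<times> {real i * cell_width n..<(real i + 1) * cell_width n}"

text \<open>Consecutive cells overlap by half, so two angles at distance at most
  \<open>sep_angle n\<close> share a cell; \<open>sep_wrap\<close> takes the place of a cell across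
  the cut.\<close>

definition sep_cell :: "nat \<Rightarrow> nat \<Rightarrow> real set" where
  "sep_cell n i = {0..<2 * pi} \<inter> {real i * sep_angle n..<(real i + 2) * sep_angle n}"

definition sep_wrap :: "nat \<Rightarrow> real set" where
  "sep_wrap n = {0..<2 * pi} \<inter> ({0..sep_angle n} \<union> {2 * pi - sep_angle n..2 * pi})"

definition \<Delta>_low :: "nat \<Rightarrow> real" where "\<Delta>_low n = exp ((hub_depth n - R n) / 2) / (4 * cell_width n)"
definition \<Delta>_up :: "nat \<Rightarrow> real" where "\<Delta>_up n = 8 * max (deg_const * exp (max_depth n / 2)) (L n)"
definition sq_up :: "nat \<Rightarrow> real" where
  "sq_up n = 64 * (deg_const + L n)\<^sup>2 * ((R n + 1) * (8 * exp 1 * (7 + L n) * exp (max_depth n)))"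
definition sum_low :: "nat \<Rightarrow> real" where
  "sum_low n = real n * exp (- \<alpha> * (R n / 2)) / 4 * (exp (- R n / 4) / (4 * cell_width n))"
text \<open>Bounds the number of leaves of a hub that another vertex can see. The
  \<open>4 * ln (L n)\<close> between \<open>sep_depth\<close> and \<open>hub_depth\<close> makes it
  smaller than \<open>\<Delta>_low\<close> by two logarithms.\<close>

definition leaf_mult :: "nat \<Rightarrow> real" where
  "leaf_mult n = 48 * exp ((sep_depth n - R n) / 2) / cell_width n + 6"

end

section \<open>Typical vertex counts\<close>

locale hrg = hrg_parameters +
  fixes M :: "nat \<Rightarrow> 'w measure" and V :: "nat \<Rightarrow> 'w \<Rightarrow> point set"
  assumes hrg: "\<And>n. hyperbolic_random_graph \<alpha> C n (M n) (V n)"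
begin

lemma ppp: "poisson_point_process (M n) (V n) (hrg_intensity \<alpha> C n)"
  using hrg[of n] by (simp add: hyperbolic_random_graph_def)

text \<open>In units of \<open>ln n\<close> the three depths have leading term
  \<open>1 / \<alpha>\<close>, strictly between 1 and 2, while \<open>R n\<close> has 2; their
  mutual order is settled by the terms in \<open>ln (L n)\<close>.\<close>

lemma ev_depths: "\<forall>\<^sub>F n in sequentially. 0 \<le> sep_depth n \<and> sep_depth n \<le> hub_depth n \<and> R n / 2 \<le> hub_depth n
    \<and> hub_depth n \<le> max_depth n \<and> max_depth n + 16 \<le> R n"
proof -
  define b where "b = 1 / \<alpha>"
  have b: "b < 2" "1 < b" using \<alpha>_gt \<alpha>_lt by (auto simp: b_def field_simps)
  have eq: "max_depth n = (L n + \<tau> * ln (L n)) * b" "hub_depth n = (L n - (1 + \<tau>) * ln (L n)) * b" for n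
    by (simp_all add: max_depth_def hub_depth_def b_def)
  have "\<forall>\<^sub>F n in sequentially. 0 \<le> sep_depth n" "\<forall>\<^sub>F n in sequentially. sep_depth n \<le> hub_depth n"
    "\<forall>\<^sub>F n in sequentially. R n / 2 \<le> hub_depth n" "\<forall>\<^sub>F n in sequentially. max_depth n + 16 \<le> R n"
    "\<forall>\<^sub>F n in sequentially. hub_depth n \<le> max_depth n"
    unfolding sep_depth_def eq L_def R_def hrg_radius_def using b \<tau>_pos by real_asymp+
  then show ?thesis by (intro eventually_conj)
qed

lemma ev_hub: "\<forall>\<^sub>F n in sequentially. 4 \<le> \<alpha> * (R n - hub_depth n)"
proof -
  have "4 \<le> \<alpha> * (R n - hub_depth n)" if "hub_depth n \<le> max_depth n" "max_depth n + 16 \<le> R n" for n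
    using that mult_mono[of "1 / 2" \<alpha> 16 "R n - hub_depth n"] \<alpha>_gt by simp
  then show ?thesis using ev_depths by (auto elim: eventually_mono)
qed

lemma aas_single:
  assumes "\<forall>\<^sub>F n in sequentially. A n \<in> sets (hrg_intensity \<alpha> C n) \<and>
      measure (M n) {\<omega> \<in> space (M n). \<not> Q n (card (V n \<omega> \<inter> A n))} \<le> p n"
    and "p \<longlonglongrightarrow> 0"
  shows "aas M (\<lambda>n \<omega>. Q n (card (V n \<omega> \<inter> A n)))"
proof -
  have "aas M (\<lambda>n \<omega>. \<forall>j\<in>{()}. Q n (card (V n \<omega> \<inter> A n)))"
    by (rule aas_counts[OF ppp, where p = p]) (use assms in auto)
  then show ?thesis by simp
qed

lemma aas_max_depth: "aas M (\<lambda>n \<omega>. card (V n \<omega> \<inter> ball n (max_depth n) {0..<2 * pi}) = 0)"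
proof (rule aas_single)
  show "(\<lambda>n. L n powr - \<tau> * (2 * pi)) \<longlonglongrightarrow> 0"
    using \<tau>_pos unfolding L_def by real_asymp
  show "\<forall>\<^sub>F n in sequentially. ball n (max_depth n) {0..<2 * pi} \<in> sets (hrg_intensity \<alpha> C n) \<and>
      measure (M n) {\<omega> \<in> space (M n). \<not> card (V n \<omega> \<inter> ball n (max_depth n) {0..<2 * pi}) = 0}
        \<le> L n powr - \<tau> * (2 * pi)"
    using ev_depths ev_R ev_L
  proof eventually_elim
    case (elim n)
    have s: "ball n (max_depth n) {0..<2 * pi} \<in> sets (hrg_intensity \<alpha> C n)"
      using elim by (intro sets_ball) auto
    have "measure (hrg_intensity \<alpha> C n) (ball n (max_depth n) {0..<2 * pi}) \<le> L n powr - \<tau> * (2 * pi)"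
      using measure_ball_le[of n "max_depth n" "{0..<2 * pi}"] exp_max_depth[of n] elim by simp
    then show ?case using ppp_count_pos[OF ppp s refl] s by linarith
  qed
qed

text \<open>There are \<open>O(n * ln n)\<close> regions, because \<open>exp (R n / 2)\<close> is of
  order \<open>n\<close>. Raising small intensities to \<open>L n\<close> makes every tail at most
  \<open>exp (- 6 * L n)\<close>.\<close>

lemma aas_regions:
  "aas M (\<lambda>n \<omega>. \<forall>(k, i)\<in>{(k, i) \<in> layers n \<times> {..nat \<lceil>7 * exp (R n / 2)\<rceil>}. real i * layer_cell n k \<le> 2 * pi}.
     real (card (V n \<omega> \<inter> region n k i)) < 8 * max (deg_const * exp (real k / 2)) (L n))"
proof -
  let ?I = "\<lambda>n. layers n \<times> {..nat \<lceil>7 * exp (R n / 2)\<rceil>}"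
  let ?J = "\<lambda>n. {(k, i) \<in> ?I n. real i * layer_cell n k \<le> 2 * pi}"
  have "aas M (\<lambda>n \<omega>. \<forall>ki\<in>?J n. real (card (V n \<omega> \<inter> (case ki of (k, i) \<Rightarrow> region n k i)))
      < 8 * max (deg_const * exp (real (fst ki) / 2)) (L n))"
  proof (rule aas_counts[OF ppp, where p = "\<lambda>n. exp (- 6 * L n)"])
    show "\<forall>\<^sub>F n in sequentially. finite (?J n) \<and> (\<forall>ki\<in>?J n. (case ki of (k, i) \<Rightarrow> region n k i) \<in> sets (hrg_intensity \<alpha> C n) \<and>
      measure (M n) {\<omega> \<in> space (M n). \<not> real (card (V n \<omega> \<inter> (case ki of (k, i) \<Rightarrow> region n k i)))
      < 8 * max (deg_const * exp (real (fst ki) / 2)) (L n)} \<le> exp (- 6 * L n))"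
      using ev_R ev_L
    proof eventually_elim
      case (elim n)
      have "finite (?J n)"
        by (rule finite_subset[of _ "?I n"]) (auto simp: layers_def)
      moreover have "measure (M n) {\<omega> \<in> space (M n). \<not> real (card (V n \<omega> \<inter> region n k i))
          < 8 * max (deg_const * exp (real k / 2)) (L n)} \<le> exp (- 6 * L n)" if "(k, i) \<in> ?J n" for k i
      proof -
        let ?a = "max (deg_const * exp (real k / 2)) (L n)"
        have "measure (hrg_intensity \<alpha> C n) (region n k i) \<le> ?a"
          using measure_region_le[of n i k] elim that by (auto simp: le_max_iff_disj)
        from ppp_upper_tail[OF ppp sets_region refl this]
        have "measure (M n) {\<omega> \<in> space (M n). \<not> real (card (V n \<omega> \<inter> region n k i)) < 8 * ?a} \<le> exp (- 6 * ?a)" .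
        also have "\<dots> \<le> exp (- 6 * L n)" by simp
        finally show ?thesis .
      qed
      ultimately show ?case using sets_region by auto
    qed
    have lim: "(\<lambda>n. (R n + 1) * (7 * exp (R n / 2) + 2) * exp (- 6 * L n)) \<longlonglongrightarrow> 0"
      unfolding L_def R_def hrg_radius_def by real_asymp
    show "(\<lambda>n. real (card (?J n)) * exp (- 6 * L n)) \<longlonglongrightarrow> 0"
    proof (rule tendsto_sandwich[OF _ _ tendsto_const lim])
      show "\<forall>\<^sub>F n in sequentially. real (card (?J n)) * exp (- 6 * L n) \<le> (R n + 1) * (7 * exp (R n / 2) + 2) * exp (- 6 * L n)"
        using ev_R
      proof eventually_elim
        case (elim n)
        have "card (?J n) \<le> card (?I n)"
          by (rule card_mono) (auto simp: layers_def)
        also have "\<dots> = (nat \<lfloor>R n\<rfloor> + 1) * (nat \<lceil>7 * exp (R n / 2)\<rceil> + 1)"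
          by (simp add: card_cartesian_product layers_def)
        finally have "real (card (?J n)) \<le> real (nat \<lfloor>R n\<rfloor> + 1) * real (nat \<lceil>7 * exp (R n / 2)\<rceil> + 1)"
          by (simp only: of_nat_mult[symmetric] of_nat_le_iff)
        also have "\<dots> \<le> (R n + 1) * (7 * exp (R n / 2) + 2)"
        proof (rule mult_mono)
          show "real (nat \<lfloor>R n\<rfloor> + 1) \<le> R n + 1" using elim by simp
          have "0 < exp (R n / 2)" by simp
          then show "real (nat \<lceil>7 * exp (R n / 2)\<rceil> + 1) \<le> 7 * exp (R n / 2) + 2"
            by (simp add: of_nat_nat) linarith
          show "0 \<le> R n + 1" using elim by simp
        qed (rule of_nat_0_le_iff)
        finally show ?case by (intro mult_right_mono) auto
      qed
    qed simp
  qed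
  then show ?thesis by (simp add: case_prod_beta)
qed

lemma aas_layers:
  "aas M (\<lambda>n \<omega>. \<forall>k\<in>layers n. real (card (V n \<omega> \<inter> ball n (real k) {0..<2 * pi}))
      < 8 * max (real n * exp (- \<alpha> * real k) * (2 * pi)) (L n))"
proof (rule aas_counts[OF ppp, where p = "\<lambda>n. exp (- 6 * L n)"])
  show "\<forall>\<^sub>F n in sequentially. finite (layers n) \<and> (\<forall>k\<in>layers n. ball n (real k) {0..<2 * pi} \<in> sets (hrg_intensity \<alpha> C n) \<and>
      measure (M n) {\<omega> \<in> space (M n). \<not> real (card (V n \<omega> \<inter> ball n (real k) {0..<2 * pi}))
      < 8 * max (real n * exp (- \<alpha> * real k) * (2 * pi)) (L n)} \<le> exp (- 6 * L n))"
    using ev_R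
  proof eventually_elim
    case (elim n)
    have s: "ball n (real k) {0..<2 * pi} \<in> sets (hrg_intensity \<alpha> C n)" for k
      by (rule sets_ball) auto
    have "measure (M n) {\<omega> \<in> space (M n). \<not> real (card (V n \<omega> \<inter> ball n (real k) {0..<2 * pi}))
      < 8 * max (real n * exp (- \<alpha> * real k) * (2 * pi)) (L n)} \<le> exp (- 6 * L n)" for k
    proof -
      let ?a = "max (real n * exp (- \<alpha> * real k) * (2 * pi)) (L n)"
      have "measure (hrg_intensity \<alpha> C n) (ball n (real k) {0..<2 * pi}) \<le> ?a"
        using measure_ball_le[of n "real k" "{0..<2 * pi}"] elim by (simp add: le_max_iff_disj)
      from ppp_upper_tail[OF ppp s refl this]
      have "measure (M n) {\<omega> \<in> space (M n). \<not> real (card (V n \<omega> \<inter> ball n (real k) {0..<2 * pi})) < 8 * ?a} \<le> exp (- 6 * ?a)" .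
      also have "\<dots> \<le> exp (- 6 * L n)" by simp
      finally show ?thesis .
    qed
    with s show ?case by (simp add: layers_def)
  qed
  have lim: "(\<lambda>n. (R n + 1) * exp (- 6 * L n)) \<longlonglongrightarrow> 0"
    unfolding L_def R_def hrg_radius_def by real_asymp
  show "(\<lambda>n. real (card (layers n)) * exp (- 6 * L n)) \<longlonglongrightarrow> 0"
  proof (rule tendsto_sandwich[OF _ _ tendsto_const lim])
    show "\<forall>\<^sub>F n in sequentially. real (card (layers n)) * exp (- 6 * L n) \<le> (R n + 1) * exp (- 6 * L n)"
      using ev_R by eventually_elim (auto simp: layers_def intro!: mult_right_mono)
  qed simp
qed

lemma aas_cells:
  "aas M (\<lambda>n \<omega>. \<forall>i\<in>{i \<in> {..<n}. (real i + 1) * cell_width n \<le> 2 * pi}. 0 < card (V n \<omega> \<inter> cell n i))"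
proof (rule aas_counts[OF ppp, where p = "\<lambda>n. exp (- 2 * L n)"])
  let ?J = "\<lambda>n. {i \<in> {..<n}. (real i + 1) * cell_width n \<le> 2 * pi}"
  show "\<forall>\<^sub>F n in sequentially. finite (?J n) \<and> (\<forall>i\<in>?J n. cell n i \<in> sets (hrg_intensity \<alpha> C n) \<and>
      measure (M n) {\<omega> \<in> space (M n). \<not> 0 < card (V n \<omega> \<inter> cell n i)} \<le> exp (- 2 * L n))"
    using ev_R ev_L
  proof eventually_elim
    case (elim n)
    have n: "0 < n" using n_pos elim by blast
    have w: "0 < cell_width n" using elim n by (simp add: cell_width_def)
    have "cell n i \<in> sets (hrg_intensity \<alpha> C n) \<and>
      measure (M n) {\<omega> \<in> space (M n). \<not> 0 < card (V n \<omega> \<inter> cell n i)} \<le> exp (- 2 * L n)" if i: "i \<in> ?J n" for i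
    proof -
      let ?B = "{real i * cell_width n..<(real i + 1) * cell_width n}"
      have B: "?B \<subseteq> {0..<2 * pi}" using i w by auto
      have s: "cell n i \<in> sets (hrg_intensity \<alpha> C n)"
        unfolding cell_def using B elim
        by (intro sets_hrg_intensity) (auto simp: disk_def R_def intro!: borel_Times)
      have mB: "measure lborel ?B = cell_width n" using w by (simp add: algebra_simps)
      have "real n * measure lborel ?B / 32 \<le> measure (hrg_intensity \<alpha> C n) (cell n i)"
        using measure_hrg_boundary_ge[of \<alpha> C n ?B] B elim \<alpha>_gt by (simp add: cell_def R_def)
      then have "2 * L n \<le> measure (hrg_intensity \<alpha> C n) (cell n i)"
        using n unfolding mB by (simp add: cell_width_def)
      then show ?thesis
        using s ppp_count_zero[OF ppp s refl] by simp
    qed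
    then show ?case by simp
  qed
  have lim: "(\<lambda>n. real n * exp (- 2 * L n)) \<longlonglongrightarrow> 0"
    unfolding L_def by real_asymp
  show "(\<lambda>n. real (card (?J n)) * exp (- 2 * L n)) \<longlonglongrightarrow> 0"
  proof (rule tendsto_sandwich[OF _ _ tendsto_const lim])
    have "card (?J n) \<le> n" for n
      using card_mono[of "{..<n}" "?J n"] by auto
    then show "\<forall>\<^sub>F n in sequentially. real (card (?J n)) * exp (- 2 * L n) \<le> real n * exp (- 2 * L n)"
      by (intro always_eventually allI mult_right_mono) auto
  qed simp
qed

lemma aas_core: "aas M (\<lambda>n \<omega>. real n * exp (- \<alpha> * (R n / 2)) / 4 \<le> real (card (V n \<omega> \<inter> ball n (R n / 2) {0..<2 * pi})))"
proof -
  let ?a = "\<lambda>n. real n * exp (- \<alpha> * (R n / 2)) / 2"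
  have "aas M (\<lambda>n \<omega>. ?a n / 2 \<le> real (card (V n \<omega> \<inter> ball n (R n / 2) {0..<2 * pi})))"
  proof (rule aas_single)
    show "(\<lambda>n. exp (- ?a n / 8)) \<longlonglongrightarrow> 0"
      using \<alpha>_gt \<alpha>_lt unfolding R_def hrg_radius_def by real_asymp
    have ev: "\<forall>\<^sub>F n in sequentially. 4 \<le> \<alpha> * (R n - R n / 2)"
      using \<alpha>_gt unfolding R_def hrg_radius_def by real_asymp
    show "\<forall>\<^sub>F n in sequentially. ball n (R n / 2) {0..<2 * pi} \<in> sets (hrg_intensity \<alpha> C n) \<and>
        measure (M n) {\<omega> \<in> space (M n). \<not> ?a n / 2 \<le> real (card (V n \<omega> \<inter> ball n (R n / 2) {0..<2 * pi}))}
          \<le> exp (- ?a n / 8)"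
      using ev ev_R
    proof eventually_elim
      case (elim n)
      have s: "ball n (R n / 2) {0..<2 * pi} \<in> sets (hrg_intensity \<alpha> C n)"
        using elim by (intro sets_ball) auto
      have "?a n \<le> measure (hrg_intensity \<alpha> C n) (ball n (R n / 2) {0..<2 * pi})"
        using elim by (intro measure_ball_ge) auto
      from ppp_lower_tail[OF ppp s refl this] s show ?case by simp
    qed
  qed
  then show ?thesis by simp
qed

lemma aas_hubs: "aas M (\<lambda>n \<omega>. L n powr (1 + \<tau>) / 4 \<le> real (card (V n \<omega> \<inter> ball n (hub_depth n) {0..<2 * pi})))"
proof -
  let ?a = "\<lambda>n. L n powr (1 + \<tau>) / 2"
  have "aas M (\<lambda>n \<omega>. ?a n / 2 \<le> real (card (V n \<omega> \<inter> ball n (hub_depth n) {0..<2 * pi})))"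
  proof (rule aas_single)
    show "(\<lambda>n. exp (- ?a n / 8)) \<longlonglongrightarrow> 0"
      using \<tau>_pos unfolding L_def by real_asymp
    show "\<forall>\<^sub>F n in sequentially. ball n (hub_depth n) {0..<2 * pi} \<in> sets (hrg_intensity \<alpha> C n) \<and>
        measure (M n) {\<omega> \<in> space (M n). \<not> ?a n / 2 \<le> real (card (V n \<omega> \<inter> ball n (hub_depth n) {0..<2 * pi}))}
          \<le> exp (- ?a n / 8)"
      using ev_hub ev_depths ev_L
    proof eventually_elim
      case (elim n)
      have s: "ball n (hub_depth n) {0..<2 * pi} \<in> sets (hrg_intensity \<alpha> C n)"
        using elim by (intro sets_ball) auto
      have "real n * exp (- \<alpha> * hub_depth n) / 2 \<le> measure (hrg_intensity \<alpha> C n) (ball n (hub_depth n) {0..<2 * pi})"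
        using elim by (intro measure_ball_ge) auto
      then have "?a n \<le> measure (hrg_intensity \<alpha> C n) (ball n (hub_depth n) {0..<2 * pi})"
        using exp_hub_depth[of n] elim by simp
      from ppp_lower_tail[OF ppp s refl this] s show ?case by simp
    qed
  qed
  then show ?thesis by simp
qed

lemma prob_sep_le:
  assumes R: "4 \<le> \<alpha> * R n" and L: "1 \<le> L n" and x: "0 \<le> sep_depth n"
    and B: "B \<in> sets borel" "B \<subseteq> {0..<2 * pi}" "measure lborel B \<le> 2 * sep_angle n"
  shows "ball n (sep_depth n) B \<in> sets (hrg_intensity \<alpha> C n) \<and>
    measure (M n) {\<omega> \<in> space (M n). \<not> card (V n \<omega> \<inter> ball n (sep_depth n) B) \<le> 1}
      \<le> (L n powr (1 + \<tau> + 4 * \<alpha>) * (2 * sep_angle n))\<^sup>2"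
proof -
  have s: "ball n (sep_depth n) B \<in> sets (hrg_intensity \<alpha> C n)"
    using x B by (intro sets_ball)
  have "measure (hrg_intensity \<alpha> C n) (ball n (sep_depth n) B) \<le> L n powr (1 + \<tau> + 4 * \<alpha>) * measure lborel B"
    using measure_ball_le[OF R x B(1,2)] exp_sep_depth[OF L] by simp
  also have "\<dots> \<le> L n powr (1 + \<tau> + 4 * \<alpha>) * (2 * sep_angle n)"
    using B(3) by (intro mult_left_mono) auto
  finally have "(measure (hrg_intensity \<alpha> C n) (ball n (sep_depth n) B))\<^sup>2 \<le> (L n powr (1 + \<tau> + 4 * \<alpha>) * (2 * sep_angle n))\<^sup>2"
    by (intro power_mono) auto
  then show ?thesis
    using s ppp_count_ge_2[OF ppp s refl] by linarith
qed

text \<open>Up to constants the squared factor is the expected number of pairs of deep vertices and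
  \<open>sep_angle n\<close> the chance that a pair is close; \<open>1 / \<alpha> < 2\<close> makes
  the latter a negative power of \<open>n\<close> up to logarithms.\<close>

lemma lim_sep_angle: "(\<lambda>n. (L n powr (1 + \<tau> + 4 * \<alpha>))\<^sup>2 * sep_angle n) \<longlonglongrightarrow> 0"
proof -
  define b where "b = 1 / \<alpha>"
  have b: "b < 2" "0 < b" using \<alpha>_gt by (auto simp: field_simps b_def)
  have "(\<lambda>n. (L n powr (1 + \<tau> + 4 * \<alpha>))\<^sup>2 * (20 * exp (((L n + \<tau> * ln (L n)) * b - R n) / 2))) \<longlonglongrightarrow> 0"
    using b unfolding asymp_defs by real_asymp
  then show ?thesis by (simp add: sep_angle_def max_depth_def b_def)
qed

lemma ev_sep_angle: "\<forall>\<^sub>F n in sequentially. sep_angle n \<le> 1"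
proof -
  define b where "b = 1 / \<alpha>"
  have b: "b < 2" "0 < b" using \<alpha>_gt by (auto simp: field_simps b_def)
  have "\<forall>\<^sub>F n in sequentially. 20 * exp (((L n + \<tau> * ln (L n)) * b - R n) / 2) \<le> 1"
    using b unfolding asymp_defs by real_asymp
  then show ?thesis by (simp add: sep_angle_def max_depth_def b_def)
qed

lemma sep_angle_pos: "0 < sep_angle n" by (simp add: sep_angle_def)

lemma aas_sep_wrap: "aas M (\<lambda>n \<omega>. card (V n \<omega> \<inter> ball n (sep_depth n) (sep_wrap n)) \<le> 1)"
proof (rule aas_single)
  have lim: "(\<lambda>n. 4 * ((L n powr (1 + \<tau> + 4 * \<alpha>))\<^sup>2 * sep_angle n)) \<longlonglongrightarrow> 0"
    using tendsto_mult_left[OF lim_sep_angle, of 4] by simp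
  show "(\<lambda>n. (L n powr (1 + \<tau> + 4 * \<alpha>) * (2 * sep_angle n))\<^sup>2) \<longlonglongrightarrow> 0"
  proof (rule tendsto_sandwich[OF _ _ tendsto_const lim])
    show "\<forall>\<^sub>F n in sequentially. (L n powr (1 + \<tau> + 4 * \<alpha>) * (2 * sep_angle n))\<^sup>2
        \<le> 4 * ((L n powr (1 + \<tau> + 4 * \<alpha>))\<^sup>2 * sep_angle n)"
      using ev_sep_angle
    proof eventually_elim
      case (elim n)
      have "(sep_angle n)\<^sup>2 \<le> sep_angle n"
        using elim sep_angle_pos[of n] by (simp add: power2_eq_square mult_left_le)
      from mult_left_mono[OF this, of "4 * (L n powr (1 + \<tau> + 4 * \<alpha>))\<^sup>2"]
      show ?case by (simp add: power_mult_distrib mult_ac)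
    qed
  qed simp
  show "\<forall>\<^sub>F n in sequentially. ball n (sep_depth n) (sep_wrap n) \<in> sets (hrg_intensity \<alpha> C n) \<and>
      measure (M n) {\<omega> \<in> space (M n). \<not> card (V n \<omega> \<inter> ball n (sep_depth n) (sep_wrap n)) \<le> 1}
        \<le> (L n powr (1 + \<tau> + 4 * \<alpha>) * (2 * sep_angle n))\<^sup>2"
    using ev_R ev_L ev_depths
  proof eventually_elim
    case (elim n)
    have "measure lborel (sep_wrap n) \<le> measure lborel ({0..sep_angle n} \<union> {2 * pi - sep_angle n..2 * pi})"
      by (rule measure_mono_fmeasurable) (auto simp: sep_wrap_def intro!: fmeasurable.Un fmeasurable_lborel_interval)
    also have "\<dots> \<le> measure lborel {0..sep_angle n} + measure lborel {2 * pi - sep_angle n..2 * pi}"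
      by (rule measure_Un_le) auto
    also have "\<dots> = 2 * sep_angle n" using sep_angle_pos[of n] by simp
    finally have "measure lborel (sep_wrap n) \<le> 2 * sep_angle n" .
    then show ?case
      using elim by (intro prob_sep_le) (auto simp: sep_wrap_def)
  qed
qed

lemma aas_sep_cells:
  "aas M (\<lambda>n \<omega>. \<forall>i\<in>{..nat \<lceil>2 * pi / sep_angle n\<rceil>}. card (V n \<omega> \<inter> ball n (sep_depth n) (sep_cell n i)) \<le> 1)"
proof (rule aas_counts[OF ppp, where p = "\<lambda>n. (L n powr (1 + \<tau> + 4 * \<alpha>) * (2 * sep_angle n))\<^sup>2"])
  show "\<forall>\<^sub>F n in sequentially. finite {..nat \<lceil>2 * pi / sep_angle n\<rceil>} \<and> (\<forall>i\<in>{..nat \<lceil>2 * pi / sep_angle n\<rceil>}.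
      ball n (sep_depth n) (sep_cell n i) \<in> sets (hrg_intensity \<alpha> C n) \<and>
      measure (M n) {\<omega> \<in> space (M n). \<not> card (V n \<omega> \<inter> ball n (sep_depth n) (sep_cell n i)) \<le> 1}
        \<le> (L n powr (1 + \<tau> + 4 * \<alpha>) * (2 * sep_angle n))\<^sup>2)"
    using ev_R ev_L ev_depths
  proof eventually_elim
    case (elim n)
    have "measure lborel (sep_cell n i) \<le> 2 * sep_angle n" for i
    proof -
      have "measure lborel (sep_cell n i) \<le> measure lborel {real i * sep_angle n..<(real i + 2) * sep_angle n}"
        by (rule measure_mono_fmeasurable) (auto simp: sep_cell_def intro: fmeasurable_lborel_interval)
      also have "\<dots> = 2 * sep_angle n"
        using sep_angle_pos[of n] by (simp add: algebra_simps)
      finally show ?thesis .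
    qed
    then have "ball n (sep_depth n) (sep_cell n i) \<in> sets (hrg_intensity \<alpha> C n) \<and>
      measure (M n) {\<omega> \<in> space (M n). \<not> card (V n \<omega> \<inter> ball n (sep_depth n) (sep_cell n i)) \<le> 1}
        \<le> (L n powr (1 + \<tau> + 4 * \<alpha>) * (2 * sep_angle n))\<^sup>2" for i
      using elim by (intro prob_sep_le) (auto simp: sep_cell_def)
    then show ?case by blast
  qed
  have lim: "(\<lambda>n. 40 * ((L n powr (1 + \<tau> + 4 * \<alpha>))\<^sup>2 * sep_angle n)) \<longlonglongrightarrow> 0"
    using tendsto_mult_left[OF lim_sep_angle, of 40] by simp
  show "(\<lambda>n. real (card {..nat \<lceil>2 * pi / sep_angle n\<rceil>}) * (L n powr (1 + \<tau> + 4 * \<alpha>) * (2 * sep_angle n))\<^sup>2) \<longlonglongrightarrow> 0"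
  proof (rule tendsto_sandwich[OF _ _ tendsto_const lim])
    show "\<forall>\<^sub>F n in sequentially. real (card {..nat \<lceil>2 * pi / sep_angle n\<rceil>}) * (L n powr (1 + \<tau> + 4 * \<alpha>) * (2 * sep_angle n))\<^sup>2
        \<le> 40 * ((L n powr (1 + \<tau> + 4 * \<alpha>))\<^sup>2 * sep_angle n)"
      using ev_sep_angle
    proof eventually_elim
      case (elim n)
      let ?a = "sep_angle n"
      have a: "0 < ?a" by (rule sep_angle_pos)
      have p: "0 \<le> 2 * pi / ?a" using a by simp
      have "real (card {..nat \<lceil>2 * pi / ?a\<rceil>}) = real_of_int \<lceil>2 * pi / ?a\<rceil> + 1"
        using p by (simp add: of_nat_nat)
      also have "\<dots> \<le> 2 * pi / ?a + 2" by linarith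
      also have "\<dots> \<le> 10 / ?a"
      proof -
        have "2 * pi + 2 * ?a \<le> 10" using elim pi_less_4 by linarith
        then have "(2 * pi + 2 * ?a) / ?a \<le> 10 / ?a" using a by (intro divide_right_mono) auto
        then show ?thesis using a by (simp add: add_divide_distrib)
      qed
      finally have c: "real (card {..nat \<lceil>2 * pi / ?a\<rceil>}) \<le> 10 / ?a" .
      have "real (card {..nat \<lceil>2 * pi / ?a\<rceil>}) * (L n powr (1 + \<tau> + 4 * \<alpha>) * (2 * ?a))\<^sup>2
          \<le> 10 / ?a * (L n powr (1 + \<tau> + 4 * \<alpha>) * (2 * ?a))\<^sup>2"
        using c by (intro mult_right_mono) auto
      also have "\<dots> = 40 * ((L n powr (1 + \<tau> + 4 * \<alpha>))\<^sup>2 * ?a)"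
        using a by (simp add: power2_eq_square)
      finally show ?case .
    qed
  qed simp
qed

end

section \<open>Typical graphs\<close>

lemma card_nat_interval_le:
  assumes "\<And>k. k \<in> K \<Longrightarrow> A \<le> real k \<and> real k \<le> B" and "A \<le> B"
  shows "real (card K) \<le> B - A + 1"
proof (cases "K = {}")
  case False
  have fin: "finite K"
    by (rule finite_subset[of _ "{..nat \<lfloor>B\<rfloor>}"]) (use assms(1) in \<open>auto simp: le_nat_floor\<close>)
  have M: "real (Max K) \<le> B" and m: "A \<le> real (Min K)"
    using assms(1)[of "Max K"] assms(1)[of "Min K"] fin False by auto
  have "card K \<le> card {Min K..Max K}"
    using fin by (intro card_mono) auto
  moreover have "Min K \<le> Max K" using fin False by simp
  ultimately have "real (card K) \<le> real (Max K) - real (Min K) + 1" by simp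
  then show ?thesis using M m by linarith
qed (use assms in simp)

text \<open>The randomness of the points is frozen into counts for explicit regions; every graph
  property below follows deterministically. The bounds on \<open>cell_width\<close> say that a cell
  is narrow against the arcs of central vertices and wide against the angle at which boundary
  vertices are adjacent.\<close>

locale typical = hrg_parameters +
  fixes n :: nat and P :: "point set"
  assumes finite_P: "finite P" and P_disk: "P \<subseteq> disk (R n)"
    and L_ge: "1 \<le> L n" and R_ge: "16 \<le> R n"
    and depths: "0 \<le> sep_depth n" "sep_depth n \<le> hub_depth n" "R n / 2 \<le> hub_depth n"
      "hub_depth n \<le> max_depth n" "max_depth n + 16 \<le> R n"
    and width_less: "6 * cell_width n \<le> exp (- R n / 4)" and width_ge: "9 * exp ((2 - R n) / 2) < cell_width n"
    and no_deep: "card (P \<inter> ball n (max_depth n) {0..<2 * pi}) = 0"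
    and region_card: "\<And>k i. k \<in> layers n \<Longrightarrow> i \<le> nat \<lceil>7 * exp (R n / 2)\<rceil> \<Longrightarrow> real i * layer_cell n k \<le> 2 * pi \<Longrightarrow>
        real (card (P \<inter> region n k i)) < 8 * max (deg_const * exp (real k / 2)) (L n)"
    and layer_card: "\<And>k. k \<in> layers n \<Longrightarrow> real (card (P \<inter> ball n (real k) {0..<2 * pi}))
      < 8 * max (real n * exp (- \<alpha> * real k) * (2 * pi)) (L n)"
    and cell_card: "\<And>i. i < n \<Longrightarrow> (real i + 1) * cell_width n \<le> 2 * pi \<Longrightarrow> 0 < card (P \<inter> cell n i)"
    and core_card: "real n * exp (- \<alpha> * (R n / 2)) / 4 \<le> real (card (P \<inter> ball n (R n / 2) {0..<2 * pi}))"
    and hub_card: "L n powr (1 + \<tau>) / 4 \<le> real (card (P \<inter> ball n (hub_depth n) {0..<2 * pi}))"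
    and wrap_card: "card (P \<inter> ball n (sep_depth n) (sep_wrap n)) \<le> 1"
    and sep_card: "\<And>i. i \<le> nat \<lceil>2 * pi / sep_angle n\<rceil> \<Longrightarrow> card (P \<inter> ball n (sep_depth n) (sep_cell n i)) \<le> 1"
begin

abbreviation adj :: "point \<Rightarrow> point \<Rightarrow> bool" where "adj \<equiv> hyp_adj (R n)"
abbreviation deg :: "point \<Rightarrow> real" where "deg x \<equiv> real (vertex_degree P adj x)"

definition depth :: "point \<Rightarrow> real" where "depth x = R n - fst x"

lemma P_D: "x \<in> P \<Longrightarrow> 0 \<le> fst x" "x \<in> P \<Longrightarrow> fst x \<le> R n" "x \<in> P \<Longrightarrow> 0 \<le> snd x" "x \<in> P \<Longrightarrow> snd x < 2 * pi"
  "x \<in> P \<Longrightarrow> x \<in> disk (R n)"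
  using P_disk by (auto simp: disk_def)

lemma mem_ball: "x \<in> ball n d B \<longleftrightarrow> 0 \<le> fst x \<and> d \<le> depth x \<and> snd x \<in> B"
  by (cases x) (auto simp: ball_def depth_def)

lemma P_ball: "P \<inter> ball n d {0..<2 * pi} = {x \<in> P. d \<le> depth x}"
  by (auto simp only: mem_ball P_D Int_iff mem_Collect_eq atLeastLessThan_iff)

lemma depth_less: "x \<in> P \<Longrightarrow> depth x < max_depth n"
proof (rule ccontr)
  assume x: "x \<in> P" "\<not> depth x < max_depth n"
  have "{x \<in> P. max_depth n \<le> depth x} = {}"
    using no_deep[unfolded P_ball] finite_P by (subst (asm) card_0_eq) auto
  moreover have "x \<in> {x \<in> P. max_depth n \<le> depth x}" using x by simp
  ultimately show False by blast
qed

lemma fst_ge: "x \<in> P \<Longrightarrow> 16 < fst x"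
  using depth_less[of x] depths by (simp add: depth_def)

lemma depth_nonneg: "x \<in> P \<Longrightarrow> 0 \<le> depth x"
  using P_D(2) by (simp add: depth_def)

lemma width_pos: "0 < cell_width n"
  using width_ge by (rule less_trans[rotated]) simp

lemma layers_floor: "x \<in> P \<Longrightarrow> nat \<lfloor>depth x\<rfloor> \<in> layers n"
  using P_D(1)[of x] by (auto simp: layers_def depth_def intro!: nat_mono floor_mono)

text \<open>The neighbourhood of a random vertex is no region fixed in advance. Rounding depth and
  angle to a layer and a cell puts it inside one of finitely many such regions.\<close>

lemma deg_le:
  assumes x: "x \<in> P"
  shows "deg x \<le> 8 * max (deg_const * exp (depth x / 2)) (L n)"
proof -
  define k where "k = nat \<lfloor>depth x\<rfloor>"
  let ?w = "layer_cell n k"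
  define i where "i = nat \<lfloor>snd x / ?w\<rfloor>"
  have w: "0 < ?w" by (simp add: layer_cell_def)
  have k: "real k \<le> depth x" "depth x < real k + 1"
    using depth_nonneg[OF x] by (auto simp: k_def)
  have "0 \<le> snd x / ?w" using P_D[OF x] w by simp
  then have i: "real i \<le> snd x / ?w" "snd x / ?w < real i + 1" by (auto simp: i_def)
  then have i': "real i * ?w \<le> snd x" "snd x < (real i + 1) * ?w" using w by (auto simp: field_simps)
  have i_le: "i \<le> nat \<lceil>7 * exp (R n / 2)\<rceil>"
  proof -
    have "exp (- R n / 2) \<le> ?w" by (simp add: layer_cell_def)
    then have "snd x / ?w \<le> snd x / exp (- R n / 2)"
      using P_D[OF x] by (intro divide_left_mono) (auto simp: layer_cell_def)
    also have "\<dots> = snd x * exp (R n / 2)" by (simp add: exp_minus field_simps)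
    also have "\<dots> \<le> 7 * exp (R n / 2)"
      using P_D[OF x] pi_approx by (intro mult_right_mono) auto
    finally have "real i \<le> 7 * exp (R n / 2)" using i by linarith
    then show ?thesis by linarith
  qed
  have "{y \<in> P. adj x y} \<subseteq> P \<inter> region n k i"
  proof
    fix y assume "y \<in> {y \<in> P. adj x y}"
    then have y: "y \<in> P" "adj x y" by auto
    define j where "j = nat \<lfloor>depth y\<rfloor>"
    have j: "real j \<le> depth y" "depth y < real j + 1"
      using depth_nonneg[OF y(1)] by (auto simp: j_def)
    have "near_angle (9 * exp ((R n - fst x - fst y) / 2)) (snd x) (snd y)"
      using P_D(5)[OF x] P_D(5)[OF y(1)] fst_ge[OF x] fst_ge[OF y(1)] y(2) by (intro hyp_adj_imp_near_angle) auto
    \<comment> \<open>Rounding both depths down loses less than one unit each, hence the summand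
      2.\<close>
    then have "near_angle (9 * exp ((real k + real j + 2 - R n) / 2)) (snd x) (snd y)"
      by (rule near_angle_mono) (use k j in \<open>simp add: depth_def\<close>)
    then have "near_angle (9 * exp ((real k + real j + 2 - R n) / 2) + ?w) (real i * ?w) (snd y)"
      by (rule near_angle_trans_abs) (use i' in \<open>simp add: algebra_simps\<close>)
    then have "snd y \<in> angles (9 * exp ((real k + real j + 2 - R n) / 2) + ?w) (real i * ?w)"
      using P_D[OF y(1)] by (auto simp: angles_def near_angle_sym)
    then have "y \<in> ball n (real j) (angles (9 * exp ((real k + real j + 2 - R n) / 2) + ?w) (real i * ?w))"
      using P_D(1)[OF y(1)] j by (simp add: mem_ball)
    then show "y \<in> P \<inter> region n k i"
      using y layers_floor[OF y(1)] by (auto simp: region_def j_def)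
  qed
  then have "vertex_degree P adj x \<le> card (P \<inter> region n k i)"
    unfolding vertex_degree_def using finite_P by (intro card_mono) auto
  then have "deg x \<le> real (card (P \<inter> region n k i))" by simp
  also have "\<dots> \<le> 8 * max (deg_const * exp (real k / 2)) (L n)"
    using region_card[of k i] layers_floor[OF x] i_le i' P_D[OF x] by (auto simp: k_def)
  also have "\<dots> \<le> 8 * max (deg_const * exp (depth x / 2)) (L n)"
    using k deg_const_pos by (intro mult_left_mono max.mono mult_left_mono) auto
  finally show ?thesis .
qed

text \<open>Pigeonhole: close angles lie in a common \<open>sep_cell\<close> or, across the cut,
  both in \<open>sep_wrap\<close>, and none of these holds two deep vertices.\<close>

lemma separated:
  assumes x: "x \<in> P" "sep_depth n \<le> depth x" and y: "y \<in> P" "sep_depth n \<le> depth y" and ne: "x \<noteq> y"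
  shows "\<not> near_angle (sep_angle n) (snd x) (snd y)"
proof -
  let ?a = "sep_angle n"
  have a: "0 < ?a" by (simp add: sep_angle_def)
  have two: False if "card (P \<inter> ball n (sep_depth n) B) \<le> 1" "snd x \<in> B" "snd y \<in> B" "x \<in> P" "y \<in> P"
      "sep_depth n \<le> depth x" "sep_depth n \<le> depth y" "x \<noteq> y" for B x y
  proof -
    have "{x, y} \<subseteq> P \<inter> ball n (sep_depth n) B"
      using that by (simp add: mem_ball P_D)
    then have "card {x, y} \<le> card (P \<inter> ball n (sep_depth n) B)"
      using finite_P by (intro card_mono) auto
    then show False using that by simp
  qed
  have ord: False if near: "near_angle ?a (snd x) (snd y)" and le: "snd x \<le> snd y" and xy: "x \<in> P" "y \<in> P"
      "sep_depth n \<le> depth x" "sep_depth n \<le> depth y" "x \<noteq> y" for x y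
  proof (cases "snd y - snd x \<le> ?a")
    case True
    define i where "i = nat \<lfloor>snd x / ?a\<rfloor>"
    have "0 \<le> snd x / ?a" using P_D[OF xy(1)] a by simp
    then have i: "real i \<le> snd x / ?a" "snd x / ?a < real i + 1" by (auto simp: i_def)
    then have i': "real i * ?a \<le> snd x" "snd x < (real i + 1) * ?a" using a by (auto simp: field_simps)
    have "snd x / ?a \<le> 2 * pi / ?a" using P_D[OF xy(1)] a by (intro divide_right_mono) auto
    then have "i \<le> nat \<lceil>2 * pi / ?a\<rceil>" using i by linarith
    moreover have "snd x \<in> sep_cell n i" "snd y \<in> sep_cell n i"
      using i' True le a P_D[OF xy(1)] P_D[OF xy(2)] by (auto simp: sep_cell_def algebra_simps)
    ultimately show False using two[OF sep_card] xy by blast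
  next
    case False
    then have "2 * pi - ?a \<le> snd y - snd x" using near le by (auto simp: near_angle_def)
    then have "snd x \<in> sep_wrap n" "snd y \<in> sep_wrap n"
      using P_D[OF xy(1)] P_D[OF xy(2)] by (auto simp: sep_wrap_def)
    then show False using two[OF wrap_card] xy by blast
  qed
  show ?thesis
  proof
    assume near: "near_angle ?a (snd x) (snd y)"
    show False
    proof (cases "snd x \<le> snd y")
      case True
      then show False using ord[OF near] assms by blast
    next
      case False
      then show False using ord[of y x] near assms near_angle_sym by (metis linear)
    qed
  qed
qed

text \<open>The angular tolerance of \<open>hyp_adj_of_angle\<close> in its worst case, a second
  vertex on the boundary circle.\<close>

definition arc_len :: "point \<Rightarrow> real" where "arc_len v = exp (- fst v / 2)"

text \<open>The arc extends from \<open>v\<close> to the side that avoids the cut at angle zero, so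
  that plain differences of angles suffice for leaves.\<close>

definition arc_start :: "point \<Rightarrow> real" where
  "arc_start v = (if snd v \<le> pi then snd v else snd v - arc_len v)"

text \<open>Only every other cell is used, so that representatives of distinct cells are not adjacent.\<close>

definition arc_cells :: "point \<Rightarrow> nat set" where
  "arc_cells v = {k. arc_start v \<le> 2 * real k * cell_width n \<and> (2 * real k + 1) * cell_width n \<le> arc_start v + arc_len v}"

definition cell_rep :: "nat \<Rightarrow> point" where
  "cell_rep k = (SOME p. p \<in> P \<inter> cell n (2 * k))"

definition leaves :: "point \<Rightarrow> point set" where
  "leaves v = cell_rep ` arc_cells v"

context
  fixes v assumes v: "v \<in> P" and core: "fst v \<le> R n / 2"
begin

lemma arc_len_pos: "0 < arc_len v"
  by (simp add: arc_len_def)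

lemma arc_length: "arc_len v \<le> 1" "6 * cell_width n \<le> arc_len v" "cell_width n \<le> 1 / 6"
proof -
  show 1: "arc_len v \<le> 1" using P_D(1)[OF v] by (simp add: arc_len_def)
  have "exp (- R n / 4) \<le> arc_len v" using core by (simp add: arc_len_def)
  then show "6 * cell_width n \<le> arc_len v" using width_less by linarith
  with 1 show "cell_width n \<le> 1 / 6" by linarith
qed

lemma arc_bounds: "0 \<le> arc_start v" "arc_start v + arc_len v \<le> 2 * pi"
  "arc_start v \<le> t \<Longrightarrow> t \<le> arc_start v + arc_len v \<Longrightarrow> \<bar>t - snd v\<bar> \<le> arc_len v"
  using arc_length(1) arc_len_pos P_D[OF v] pi_gt3 by (auto simp: arc_start_def split: if_splits)

lemma arc_cells_rep:
  assumes k: "k \<in> arc_cells v"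
  shows "cell_rep k \<in> P" "R n - 1 \<le> fst (cell_rep k)" "2 * real k * cell_width n \<le> snd (cell_rep k)"
    "snd (cell_rep k) < (2 * real k + 1) * cell_width n" "\<bar>snd (cell_rep k) - snd v\<bar> \<le> arc_len v"
proof -
  have le: "(2 * real k + 1) * cell_width n \<le> 2 * pi" and ge: "arc_start v \<le> 2 * real k * cell_width n"
    and le': "(2 * real k + 1) * cell_width n \<le> arc_start v + arc_len v"
    using k arc_bounds(2) by (auto simp: arc_cells_def)
  have "2 * k < n"
  proof -
    have n: "0 < real n" using n_pos[OF L_ge] by simp
    have "(2 * real k + 1) * (64 * 1) \<le> (2 * real k + 1) * (64 * L n)"
      using L_ge by (intro mult_left_mono) auto
    also have "\<dots> \<le> 2 * pi * real n"
      using le n by (simp add: cell_width_def field_simps)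
    also have "\<dots> \<le> 64 * real n" using pi_less_4 by (intro mult_right_mono) auto
    finally have "2 * real k + 1 \<le> real n" by simp
    then show ?thesis by linarith
  qed
  then have "0 < card (P \<inter> cell n (2 * k))"
    using cell_card[of "2 * k"] le by simp
  then have "P \<inter> cell n (2 * k) \<noteq> {}" by auto
  then have "cell_rep k \<in> P \<inter> cell n (2 * k)"
    unfolding cell_rep_def by (metis some_in_eq)
  then show *: "cell_rep k \<in> P" "R n - 1 \<le> fst (cell_rep k)" "2 * real k * cell_width n \<le> snd (cell_rep k)"
    "snd (cell_rep k) < (2 * real k + 1) * cell_width n"
    by (auto simp: cell_def)
  show "\<bar>snd (cell_rep k) - snd v\<bar> \<le> arc_len v"
    using * ge le' by (intro arc_bounds(3)) auto
qed

lemma cell_rep_far: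
  assumes "k \<in> arc_cells v" "k' \<in> arc_cells v" "k < k'"
  shows "cell_width n < snd (cell_rep k') - snd (cell_rep k)"
proof -
  have "(2 * real k + 2) * cell_width n \<le> 2 * real k' * cell_width n"
    using assms width_pos by (intro mult_right_mono) auto
  then show ?thesis
    using arc_cells_rep(4)[OF assms(1)] arc_cells_rep(3)[OF assms(2)] by (simp add: algebra_simps)
qed

lemma inj_cell_rep: "inj_on cell_rep (arc_cells v)"
proof (rule inj_onI, rule ccontr)
  fix k k' assume k: "k \<in> arc_cells v" "k' \<in> arc_cells v" "cell_rep k = cell_rep k'" "k \<noteq> k'"
  then show False
    using cell_rep_far[of k k'] cell_rep_far[of k' k] width_pos by (cases "k < k'") auto
qed

lemma finite_arc_cells: "finite (arc_cells v)"
  by (rule inj_on_finite[OF inj_cell_rep _ finite_P]) (auto intro: arc_cells_rep)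

lemma leaves_subset: "leaves v \<subseteq> P"
  by (auto simp: leaves_def intro: arc_cells_rep)

lemma leaves_fst: "p \<in> leaves v \<Longrightarrow> R n - 1 \<le> fst p"
  by (auto simp: leaves_def intro: arc_cells_rep)

lemma leaves_snd: "p \<in> leaves v \<Longrightarrow> \<bar>snd p - snd v\<bar> \<le> arc_len v"
  by (auto simp: leaves_def intro: arc_cells_rep)

lemma leaves_adj: "p \<in> leaves v \<Longrightarrow> adj v p"
proof -
  assume p: "p \<in> leaves v"
  then have pP: "p \<in> P" using leaves_subset by auto
  have "arc_len v \<le> exp ((R n - fst v - fst p) / 2)"
    using P_D(2)[OF pP] by (simp add: arc_len_def)
  then have "\<bar>snd v - snd p\<bar> \<le> exp ((R n - fst v - fst p) / 2)"
    using leaves_snd[OF p] by (simp add: abs_minus_commute)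
  then show ?thesis
    using fst_ge[OF v] fst_ge[OF pP] P_D(2)[OF v] P_D(2)[OF pP] leaves_fst[OF p] core R_ge
    by (intro hyp_adj_of_angle) auto
qed

text \<open>Leaves have depth at most 1, so adjacency would force their angles within
  \<open>9 * exp ((2 - R n) / 2)\<close>, less than the cell skipped between them. Their plain
  difference is at most 2, which rules out closeness across the cut.\<close>

lemma leaves_independent:
  assumes "p \<in> leaves v" "p' \<in> leaves v"
  shows "\<not> adj p p'"
proof
  assume adj: "adj p p'"
  obtain k k' where k: "k \<in> arc_cells v" "p = cell_rep k" "k' \<in> arc_cells v" "p' = cell_rep k'"
    using assms by (auto simp: leaves_def)
  have "k \<noteq> k'" using adj k by (auto simp: hyp_adj_irrefl)
  then have far: "cell_width n < \<bar>snd p - snd p'\<bar>"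
    using cell_rep_far[OF k(1,3)] cell_rep_far[OF k(3,1)] k by (cases "k < k'") auto
  have close: "\<bar>snd p - snd p'\<bar> \<le> 2"
    using leaves_snd[OF assms(1)] leaves_snd[OF assms(2)] arc_length(1) by linarith
  have P: "p \<in> P" "p' \<in> P" using assms leaves_subset by auto
  have "near_angle (9 * exp ((R n - fst p - fst p') / 2)) (snd p) (snd p')"
    using adj P_D(5)[OF P(1)] P_D(5)[OF P(2)] fst_ge[OF P(1)] fst_ge[OF P(2)] by (intro hyp_adj_imp_near_angle) auto
  then have "near_angle (9 * exp ((2 - R n) / 2)) (snd p) (snd p')"
    by (rule near_angle_mono) (use leaves_fst[OF assms(1)] leaves_fst[OF assms(2)] in simp)
  then have "near_angle (cell_width n) (snd p) (snd p')"
    by (rule near_angle_mono) (use width_ge in simp)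
  then show False
    using far close arc_length(3) pi_gt3 by (auto simp: near_angle_def)
qed

text \<open>The admissible \<open>k\<close> are the integers in an interval of length
  \<open>x - 1 / 2\<close>, where \<open>x = arc_len v / (2 * cell_width n)\<close>, so there are at
  least \<open>x - 3 / 2\<close>. An arc spans six cell widths, hence \<open>x \<ge> 3\<close> and
  this is at least \<open>x / 2\<close>.\<close>

lemma card_leaves_ge: "arc_len v / (4 * cell_width n) \<le> real (card (leaves v))"
proof -
  let ?w = "cell_width n" and ?a = "arc_start v" and ?\<theta> = "arc_len v"
  define A where "A = ?a / (2 * ?w)"
  define B where "B = (?a + ?\<theta>) / (2 * ?w) - 1 / 2"
  note w = width_pos
  have A0: "0 \<le> A" using arc_bounds(1) w by (simp add: A_def)
  have \<theta>: "3 \<le> ?\<theta> / (2 * ?w)" using arc_length(2) w by (simp add: field_simps)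
  have BA: "B = A + ?\<theta> / (2 * ?w) - 1 / 2" by (simp add: A_def B_def add_divide_distrib)
  have sub: "{nat \<lceil>A\<rceil>..nat \<lfloor>B\<rfloor>} \<subseteq> arc_cells v"
  proof
    fix k assume k: "k \<in> {nat \<lceil>A\<rceil>..nat \<lfloor>B\<rfloor>}"
    have B0: "0 \<le> B" using A0 \<theta> BA by linarith
    have "A \<le> real k" using k by (auto simp: nat_ceiling_le_eq)
    moreover have "real k \<le> B" using k B0 by (auto simp: le_nat_floor nat_le_iff le_floor_iff le_nat_iff)
    ultimately show "k \<in> arc_cells v"
      using w by (simp add: arc_cells_def A_def B_def field_simps)
  qed
  have "card {nat \<lceil>A\<rceil>..nat \<lfloor>B\<rfloor>} \<le> card (arc_cells v)"
    by (rule card_mono[OF finite_arc_cells sub])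
  also have "\<dots> = card (leaves v)"
    by (simp add: leaves_def card_image[OF inj_cell_rep])
  finally have "real (card {nat \<lceil>A\<rceil>..nat \<lfloor>B\<rfloor>}) \<le> real (card (leaves v))" by simp
  moreover have "?\<theta> / (2 * ?w) - 3 / 2 \<le> real (card {nat \<lceil>A\<rceil>..nat \<lfloor>B\<rfloor>})"
    using A0 \<theta> BA by simp linarith
  moreover have "?\<theta> / (4 * ?w) = ?\<theta> / (2 * ?w) / 2" by simp
  ultimately show ?thesis using \<theta> by linarith
qed

lemma near_leaves:
  assumes x: "x \<in> P" and p: "p \<in> leaves v" and adj: "adj x p"
  shows "near_angle (16 * exp (- fst x / 2)) (snd p) (snd x)"
proof -
  have pP: "p \<in> P" using p leaves_subset by auto
  have "near_angle (9 * exp ((R n - fst x - fst p) / 2)) (snd x) (snd p)"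
    using adj P_D(5)[OF x] P_D(5)[OF pP] fst_ge[OF x] fst_ge[OF pP] by (intro hyp_adj_imp_near_angle) auto
  then have "near_angle (16 * exp (- fst x / 2)) (snd x) (snd p)"
  proof (rule near_angle_mono)
    \<comment> \<open>A leaf has depth at most 1, which costs the factor \<open>exp (1 / 2)\<close>;
      the constant 16 exceeds \<open>9 * 7 / 4\<close>.\<close>
    have half: "exp (1 / 2) \<le> (7 / 4 :: real)"
    proof (rule power2_le_imp_le)
      show "(exp (1 / 2))\<^sup>2 \<le> (7 / 4 :: real)\<^sup>2"
        using exp_le exp_half_power2[of 1] by (simp add: power2_eq_square)
    qed simp
    have "exp ((R n - fst x - fst p) / 2) \<le> exp (1 / 2 + - fst x / 2)"
      using leaves_fst[OF p] by simp
    also have "\<dots> = exp (1 / 2) * exp (- fst x / 2)" by (rule exp_add)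
    also have "\<dots> \<le> 7 / 4 * exp (- fst x / 2)" using half by (intro mult_right_mono) auto
    finally show "9 * exp ((R n - fst x - fst p) / 2) \<le> 16 * exp (- fst x / 2)"
      using exp_gt_zero[of "- fst x / 2"] by linarith
  qed
  then show ?thesis by (simp add: near_angle_sym)
qed

text \<open>The leaves seen by \<open>x\<close> lie in a window of length \<open>2 * \<eta>\<close>
  with \<open>\<eta> = 16 * exp (- fst x / 2)\<close>, or in one of its translates by a full turn.
  As leaves use every other cell, each window holds at most \<open>\<eta> / cell_width n + 2\<close>
  of them.\<close>

lemma card_adj_leaves_le:
  assumes x: "x \<in> P"
  shows "real (card {p \<in> leaves v. adj x p}) \<le> 48 * exp (- fst x / 2) / cell_width n + 6"
proof -
  let ?w = "cell_width n" and ?\<eta> = "16 * exp (- fst x / 2)"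
  note w = width_pos
  define S where "S lo = {k \<in> arc_cells v. lo \<le> snd (cell_rep k) \<and> snd (cell_rep k) \<le> lo + 2 * ?\<eta>}" for lo
  have fS: "finite (S lo)" for lo using finite_arc_cells by (simp add: S_def)
  have S: "real (card (S lo)) \<le> ?\<eta> / ?w + 2" for lo
  proof -
    have "real (card (S lo)) \<le> (lo + 2 * ?\<eta>) / (2 * ?w) - (lo / (2 * ?w) - 1 / 2) + 1"
    proof (rule card_nat_interval_le)
      fix k assume k: "k \<in> S lo"
      then have "2 * real k * ?w \<le> lo + 2 * ?\<eta>" "lo < (2 * real k + 1) * ?w"
        using arc_cells_rep[of k] by (auto simp: S_def)
      then show "lo / (2 * ?w) - 1 / 2 \<le> real k \<and> real k \<le> (lo + 2 * ?\<eta>) / (2 * ?w)"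
        using w by (simp add: field_simps)
    next
      have "lo / (2 * ?w) \<le> (lo + 2 * ?\<eta>) / (2 * ?w)"
        using w by (intro divide_right_mono) auto
      then show "lo / (2 * ?w) - 1 / 2 \<le> (lo + 2 * ?\<eta>) / (2 * ?w)" by linarith
    qed
    then show ?thesis by (simp add: add_divide_distrib)
  qed
  have "{p \<in> leaves v. adj x p} \<subseteq> cell_rep ` (S (snd x - ?\<eta>) \<union> S (snd x + 2 * pi - ?\<eta>) \<union> S (snd x - 2 * pi - ?\<eta>))"
  proof
    fix p assume p: "p \<in> {p \<in> leaves v. adj x p}"
    then obtain k where k: "k \<in> arc_cells v" "p = cell_rep k" by (auto simp: leaves_def)
    have near: "near_angle ?\<eta> (snd p) (snd x)" using near_leaves[OF x] p by auto
    have pP: "p \<in> P" using p leaves_subset by auto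
    have "k \<in> S (snd x - ?\<eta>) \<union> S (snd x + 2 * pi - ?\<eta>) \<union> S (snd x - 2 * pi - ?\<eta>)"
      using near k P_D[OF x] P_D[OF pP] exp_gt_zero[of "- fst x / 2"]
      unfolding near_angle_def S_def by (auto simp: abs_if split: if_splits)
    then show "p \<in> cell_rep ` (S (snd x - ?\<eta>) \<union> S (snd x + 2 * pi - ?\<eta>) \<union> S (snd x - 2 * pi - ?\<eta>))"
      using k by auto
  qed
  then have "card {p \<in> leaves v. adj x p} \<le> card (S (snd x - ?\<eta>) \<union> S (snd x + 2 * pi - ?\<eta>) \<union> S (snd x - 2 * pi - ?\<eta>))"
    using fS by (meson surj_card_le finite_UnI)
  also have "\<dots> \<le> card (S (snd x - ?\<eta>)) + card (S (snd x + 2 * pi - ?\<eta>)) + card (S (snd x - 2 * pi - ?\<eta>))"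
    by (intro order_trans[OF card_Un_le] add_mono card_Un_le order_refl)
  finally have "real (card {p \<in> leaves v. adj x p}) \<le> real (card (S (snd x - ?\<eta>))) + real (card (S (snd x + 2 * pi - ?\<eta>)))
      + real (card (S (snd x - 2 * pi - ?\<eta>)))"
    by linarith
  also have "\<dots> \<le> (?\<eta> / ?w + 2) + (?\<eta> / ?w + 2) + (?\<eta> / ?w + 2)"
    by (intro add_mono S)
  finally show ?thesis by simp
qed

lemma deg_core_ge: "arc_len v / (4 * cell_width n) \<le> deg v"
proof -
  have "card (leaves v) \<le> vertex_degree P adj v"
    unfolding vertex_degree_def using finite_P leaves_subset leaves_adj by (intro card_mono) auto
  then show ?thesis using card_leaves_ge by linarith
qed

end

end

section \<open>Degree moments and hubs of a typical graph\<close>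

context typical
begin


abbreviation max_deg :: real where "max_deg \<equiv> real (max_degree P adj)"

definition hubs :: "point set" where "hubs = {x \<in> P. hub_depth n \<le> depth x}"

lemma hubs_D: "v \<in> hubs \<Longrightarrow> v \<in> P" "v \<in> hubs \<Longrightarrow> fst v \<le> R n / 2"
  "v \<in> hubs \<Longrightarrow> exp ((hub_depth n - R n) / 2) \<le> arc_len v"
  using depths by (auto simp: hubs_def depth_def arc_len_def)

lemma card_hubs: "L n powr (1 + \<tau>) / 4 \<le> real (card hubs)"
  using hub_card unfolding P_ball hubs_def .

lemma hubs_nonempty: "hubs \<noteq> {}"
proof
  assume "hubs = {}"
  then have "L n powr (1 + \<tau>) / 4 \<le> 0" using card_hubs by simp
  then show False using L_ge by simp
qed

lemma deg_le_max: "x \<in> P \<Longrightarrow> deg x \<le> max_deg"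
  unfolding max_degree_def using finite_P by (intro of_nat_mono Max_ge) auto

lemma hub_low: "v \<in> hubs \<Longrightarrow> \<Delta>_low n \<le> arc_len v / (4 * cell_width n)"
  unfolding \<Delta>_low_def using hubs_D(3) width_pos by (intro divide_right_mono) auto

lemma max_deg_ge: "\<Delta>_low n \<le> max_deg"
proof -
  obtain v where v: "v \<in> hubs" using hubs_nonempty by auto
  show ?thesis
    using hub_low[OF v] deg_core_ge[OF hubs_D(1)[OF v] hubs_D(2)[OF v]] deg_le_max[OF hubs_D(1)[OF v]] by linarith
qed

lemma max_deg_le: "max_deg \<le> \<Delta>_up n"
proof -
  have "deg x \<le> \<Delta>_up n" if x: "x \<in> P" for x
  proof -
    have "deg x \<le> 8 * max (deg_const * exp (depth x / 2)) (L n)" by (rule deg_le[OF x])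
    also have "\<dots> \<le> \<Delta>_up n"
      unfolding \<Delta>_up_def using depth_less[OF x] deg_const_pos
      by (intro mult_left_mono max.mono) auto
    finally show ?thesis .
  qed
  moreover have "max_degree P adj \<in> insert 0 (vertex_degree P adj ` P)"
    unfolding max_degree_def by (rule Max_in) (use finite_P in auto)
  moreover have "0 \<le> \<Delta>_up n" using L_ge by (simp add: \<Delta>_up_def le_max_iff_disj)
  ultimately show ?thesis by auto
qed

text \<open>A squared degree is at most polylogarithmic times \<open>exp (depth x)\<close>. A layer
  \<open>k\<close> with about \<open>n * exp (- \<alpha> * k)\<close> vertices contributes about
  \<open>n * exp ((1 - \<alpha>) * k)\<close>; for \<open>\<alpha> < 1\<close> this grows with
  \<open>k\<close>, so every layer is bounded by the value at \<open>max_depth n\<close>.\<close>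

lemma sum_sq_le: "(\<Sum>x\<in>P. (deg x)\<^sup>2) \<le> sq_up n"
proof -
  define K where "K = {k \<in> layers n. real k \<le> max_depth n}"
  define B where "B = 8 * exp 1 * (7 + L n) * exp (max_depth n)"
  have B0: "0 \<le> B" using L_ge by (simp add: B_def)
  have fK: "finite K" by (simp add: K_def layers_def)
  have d: "(deg x)\<^sup>2 \<le> 64 * (deg_const + L n)\<^sup>2 * exp (depth x)" if x: "x \<in> P" for x
  proof -
    have e: "1 \<le> exp (depth x / 2)" using depth_nonneg[OF x] by simp
    have "deg x \<le> 8 * max (deg_const * exp (depth x / 2)) (L n)" by (rule deg_le[OF x])
    also have "max (deg_const * exp (depth x / 2)) (L n) \<le> (deg_const + L n) * exp (depth x / 2)"
    proof (rule max.boundedI)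
      have "0 \<le> deg_const * exp (depth x / 2)" "0 \<le> L n * exp (depth x / 2)" "L n * 1 \<le> L n * exp (depth x / 2)"
        using deg_const_pos L_ge e by (auto intro!: mult_left_mono simp del: one_le_exp_iff)
      then show "deg_const * exp (depth x / 2) \<le> (deg_const + L n) * exp (depth x / 2)"
        "L n \<le> (deg_const + L n) * exp (depth x / 2)"
        unfolding distrib_right by linarith+
    qed
    finally have "deg x \<le> 8 * ((deg_const + L n) * exp (depth x / 2))" by simp
    then have "(deg x)\<^sup>2 \<le> (8 * ((deg_const + L n) * exp (depth x / 2)))\<^sup>2"
      by (intro power_mono) auto
    also have "\<dots> = 64 * (deg_const + L n)\<^sup>2 * exp (depth x)"
      by (simp add: power_mult_distrib exp_half_power2)
    finally show ?thesis .
  qed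
  have layer: "(\<Sum>x\<in>{x \<in> P. nat \<lfloor>depth x\<rfloor> = k}. exp (depth x)) \<le> B" if k: "k \<in> K" for k
  proof -
    have kl: "k \<in> layers n" "real k \<le> max_depth n" using k by (auto simp: K_def)
    have floor: "real (nat \<lfloor>depth x\<rfloor>) \<le> depth x \<and> depth x \<le> real (nat \<lfloor>depth x\<rfloor>) + 1" if "x \<in> P" for x
      using depth_nonneg[OF that] by linarith
    have "(\<Sum>x\<in>{x \<in> P. nat \<lfloor>depth x\<rfloor> = k}. exp (depth x)) \<le> real (card {x \<in> P. nat \<lfloor>depth x\<rfloor> = k}) * exp (real k + 1)"
      using floor by (intro sum_bounded_above) auto
    also have "\<dots> \<le> real (card {x \<in> P. real k \<le> depth x}) * exp (real k + 1)"
      using floor finite_P by (intro mult_right_mono of_nat_mono card_mono) auto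
    also have "\<dots> \<le> 8 * max (real n * exp (- \<alpha> * real k) * (2 * pi)) (L n) * exp (real k + 1)"
      using layer_card[OF kl(1)] unfolding P_ball by (intro mult_right_mono) auto
    also have "\<dots> \<le> 8 * (real n * exp (- \<alpha> * real k) * 7 + L n) * exp (real k + 1)"
    proof -
      have "real n * exp (- \<alpha> * real k) * (2 * pi) \<le> real n * exp (- \<alpha> * real k) * 7"
        using pi_approx by (intro mult_left_mono) auto
      moreover have "0 \<le> real n * exp (- \<alpha> * real k) * 7" by simp
      ultimately have "max (real n * exp (- \<alpha> * real k) * (2 * pi)) (L n) \<le> real n * exp (- \<alpha> * real k) * 7 + L n"
        using L_ge by linarith
      then show ?thesis by (intro mult_right_mono mult_left_mono) auto
    qed
    also have "\<dots> = 8 * exp 1 * (7 * (real n * exp (- \<alpha> * real k + real k)) + L n * exp (real k))"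
      unfolding exp_add[of "- \<alpha> * real k" "real k"] exp_add[of "real k" 1] by (simp add: algebra_simps)
    also have "\<dots> \<le> 8 * exp 1 * (7 * exp (max_depth n) + L n * exp (max_depth n))"
    proof (intro mult_left_mono add_mono)
      have "- \<alpha> * real k + real k \<le> - \<alpha> * max_depth n + max_depth n"
        using mult_left_mono[OF kl(2), of "1 - \<alpha>"] \<alpha>_lt by (simp add: algebra_simps)
      then have "real n * exp (- \<alpha> * real k + real k) \<le> real n * exp (- \<alpha> * max_depth n + max_depth n)"
        by (intro mult_left_mono) auto
      also have "\<dots> = (real n * exp (- \<alpha> * max_depth n)) * exp (max_depth n)"
        by (simp only: exp_add mult.assoc)
      also have "\<dots> = L n powr - \<tau> * exp (max_depth n)"
        by (simp only: exp_max_depth[OF L_ge])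
      also have "\<dots> \<le> 1 * exp (max_depth n)"
      proof (rule mult_right_mono)
        have "L n powr - \<tau> \<le> L n powr 0" using L_ge \<tau>_pos by (intro powr_mono) auto
        then show "L n powr - \<tau> \<le> 1" using L_ge by simp
      qed simp
      finally show "real n * exp (- \<alpha> * real k + real k) \<le> exp (max_depth n)" by simp
    qed (use L_ge kl in auto)
    also have "\<dots> = B" by (simp add: B_def algebra_simps)
    finally show ?thesis .
  qed
  have "(\<Sum>x\<in>P. exp (depth x)) = (\<Sum>k\<in>K. \<Sum>x\<in>{x \<in> P. nat \<lfloor>depth x\<rfloor> = k}. exp (depth x))"
  proof (rule sum.group[symmetric, OF finite_P fK])
    show "(\<lambda>x. nat \<lfloor>depth x\<rfloor>) ` P \<subseteq> K"
    proof
      fix k assume "k \<in> (\<lambda>x. nat \<lfloor>depth x\<rfloor>) ` P"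
      then obtain x where x: "x \<in> P" "k = nat \<lfloor>depth x\<rfloor>" by auto
      then show "k \<in> K"
        using layers_floor[OF x(1)] depth_less[OF x(1)] depth_nonneg[OF x(1)] unfolding K_def by auto linarith
    qed
  qed
  also have "\<dots> \<le> (\<Sum>k\<in>K. B)" by (intro sum_mono layer)
  also have "\<dots> \<le> (R n + 1) * B"
  proof -
    have "card K \<le> card (layers n)" by (intro card_mono) (auto simp: K_def layers_def)
    then have "real (card K) \<le> R n + 1" using R_ge by (simp add: layers_def) linarith
    then show ?thesis using B0 by (simp add: mult_right_mono)
  qed
  finally have s: "(\<Sum>x\<in>P. exp (depth x)) \<le> (R n + 1) * B" .
  have "(\<Sum>x\<in>P. (deg x)\<^sup>2) \<le> (\<Sum>x\<in>P. 64 * (deg_const + L n)\<^sup>2 * exp (depth x))"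
    by (intro sum_mono d)
  also have "\<dots> = 64 * (deg_const + L n)\<^sup>2 * (\<Sum>x\<in>P. exp (depth x))"
    by (simp add: sum_distrib_left)
  also have "\<dots> \<le> 64 * (deg_const + L n)\<^sup>2 * ((R n + 1) * B)"
    using s by (intro mult_left_mono) auto
  finally show ?thesis by (simp add: sq_up_def B_def)
qed

text \<open>Vertices of depth at least \<open>R n / 2\<close> are enough: at least of order
  \<open>n powr (1 - \<alpha>)\<close> many, each of degree at least of order
  \<open>sqrt n / ln n\<close>.\<close>

lemma sum_deg_ge: "sum_low n \<le> (\<Sum>x\<in>P. deg x)"
proof -
  let ?core = "{x \<in> P. R n / 2 \<le> depth x}" and ?d = "exp (- R n / 4) / (4 * cell_width n)"
  have "sum_low n \<le> real (card ?core) * ?d"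
    unfolding sum_low_def using core_card width_pos unfolding P_ball
    by (intro mult_right_mono) auto
  also have "\<dots> \<le> (\<Sum>x\<in>?core. deg x)"
  proof (rule sum_bounded_below)
    fix x assume "x \<in> ?core"
    then have x: "x \<in> P" "fst x \<le> R n / 2" by (auto simp: depth_def)
    have "?d \<le> arc_len x / (4 * cell_width n)"
      using x width_pos by (intro divide_right_mono) (auto simp: arc_len_def)
    then show "?d \<le> deg x" using deg_core_ge[OF x] by linarith
  qed
  also have "\<dots> \<le> (\<Sum>x\<in>P. deg x)" using finite_P by (intro sum_mono2) auto
  finally show ?thesis .
qed

text \<open>From \<open>exp (- 2 * x) \<le> 1 - x\<close> for \<open>0 < x \<le> 1 / 2\<close>.
  Degrees are at most the maximum degree and thus at most \<open>2 * q / \<epsilon>\<close>, so a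
  neighbourhood avoids a given colour with probability bounded below in terms of \<epsilon>
  alone.\<close>

lemma one_minus_inverse_power_ge:
  assumes q: "2 \<le> q" and d: "real d \<le> 2 * q / \<epsilon>" and \<epsilon>: "0 < (\<epsilon> :: real)"
  shows "exp (- 4 / \<epsilon>) \<le> (1 - 1 / q) ^ d"
proof -
  let ?x = "1 / q"
  have x: "0 < ?x" "?x \<le> 1 / 2" using q by (auto simp: field_simps)
  have "1 \<le> (1 + 2 * x) * (1 - x)" if "0 < x" "x \<le> 1 / 2" for x :: real
    using that mult_nonneg_nonneg[of x "1 - 2 * x"] by (simp add: algebra_simps)
  from this[OF x] have "1 \<le> (1 + 2 * ?x) * (1 - ?x)" .
  also have "\<dots> \<le> exp (2 * ?x) * (1 - ?x)"
    using x exp_ge_add_one_self[of "2 * ?x"] by (intro mult_right_mono) auto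
  finally have e: "exp (- (2 * ?x)) \<le> 1 - ?x"
    by (simp add: exp_minus pos_divide_le_eq mult.commute inverse_eq_divide)
  have "2 * ?x * real d \<le> 2 * ?x * (2 * q / \<epsilon>)" using d x by (intro mult_left_mono) auto
  then have "- 4 / \<epsilon> \<le> real d * - (2 * ?x)" using q \<epsilon> by (simp add: field_simps)
  then have "exp (- 4 / \<epsilon>) \<le> exp (real d * - (2 * ?x))" by simp
  also have "\<dots> = exp (- (2 * ?x)) ^ d" by (rule exp_of_nat_mult)
  also have "\<dots> \<le> (1 - ?x) ^ d" using e by (intro power_mono) auto
  finally show ?thesis .
qed

text \<open>The degree threshold is \<open>t * max_deg\<close>. The condition
  \<open>4 \<le> \<epsilon> * \<Delta>_low n\<close> makes rounding harmless: either choice of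
  \<open>q\<close> is at least 2 and lies between \<open>\<epsilon> * max_deg / 2\<close> and
  \<open>2 * \<epsilon> * max_deg\<close>.\<close>

lemma rctid_exactly_2:
  fixes ident :: "point \<Rightarrow> nat" and \<epsilon> t :: real
  defines "c \<equiv> exp (- 4 / \<epsilon>) / 2"
  assumes inj: "inj_on ident P" and \<epsilon>: "0 < \<epsilon>" "4 \<le> \<epsilon> * \<Delta>_low n"
    and q: "q \<in> {nat \<lfloor>\<epsilon> * max_deg\<rfloor>, nat \<lceil>\<epsilon> * max_deg\<rceil>}" and t: "0 < t"
  shows "1 - (16 * \<epsilon> * \<Delta>_up n / sum_low n + 64 * sq_up n / (c * \<epsilon> ^ 3 * \<Delta>_low n ^ 3)
      + 2 * (sq_up n)\<^sup>2 / (t ^ 4 * c * \<epsilon> * \<Delta>_low n ^ 5) + 8 * t * sq_up n / (c * \<epsilon> ^ 3 * (\<Delta>_low n)\<^sup>2))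
    \<le> rctid_prob P adj {..<q} ident (terminates_after_exactly P 2)"
proof -
  interpret rctid_graph P adj "{..<q}" ident
    using inj finite_P hyp_adj_irrefl by unfold_locales (auto intro: hyp_adj_sym)
  let ?\<Delta> = max_deg and ?S = "\<Sum>x\<in>P. (deg x)\<^sup>2"
  have low: "0 < \<Delta>_low n" using width_pos by (simp add: \<Delta>_low_def)
  have \<Delta>0: "0 < ?\<Delta>" using low max_deg_ge by linarith
  have "\<epsilon> * \<Delta>_low n \<le> \<epsilon> * ?\<Delta>" using max_deg_ge \<epsilon> by (intro mult_left_mono) auto
  then have \<epsilon>\<Delta>: "4 \<le> \<epsilon> * ?\<Delta>" using \<epsilon> by linarith
  have q1: "\<epsilon> * ?\<Delta> / 2 \<le> real q" and q2: "real q \<le> 2 * (\<epsilon> * ?\<Delta>)" and q3: "2 \<le> q"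
    using q \<epsilon>\<Delta> by (auto, linarith+)
  have cq: "card {..<q} = q" by simp
  have c: "0 < c" "c \<le> 1 / 2" using \<epsilon> by (auto simp: c_def)
  have S0: "0 \<le> ?S" by (intro sum_nonneg) auto
  have S1: "?S \<le> sq_up n" by (rule sum_sq_le)
  have sum0: "0 < sum_low n" using n_pos[OF L_ge] width_pos by (simp add: sum_low_def)
  have edges: "sum_low n / 2 \<le> real (card edges)"
  proof -
    have "2 * real (card edges) = (\<Sum>x\<in>P. deg x)"
      using card_edges by (metis of_nat_mult of_nat_numeral of_nat_sum)
    then show ?thesis using sum_deg_ge by linarith
  qed
  then have ne: "edges \<noteq> {}" using sum0 by auto
  have deg: "2 * c \<le> (1 - 1 / real (card {..<q})) ^ vertex_degree P adj u" if "u \<in> P" for u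
  proof -
    have "\<epsilon> * deg u \<le> \<epsilon> * max_deg" using deg_le_max[OF that] \<epsilon> by (intro mult_left_mono) auto
    then have "\<epsilon> * deg u \<le> 2 * real q" using q1 by linarith
    then have "deg u \<le> 2 * real q / \<epsilon>"
      using \<epsilon> by (simp add: pos_le_divide_eq mult.commute)
    then show ?thesis
      using one_minus_inverse_power_ge[of "real q" "vertex_degree P adj u" \<epsilon>] q3 \<epsilon> by (simp add: c_def)
  qed
  have T: "0 < t * ?\<Delta>" using t \<Delta>0 by simp
  note main = prob_exactly_2_ge_moments[OF c _ ne T deg, unfolded cq, OF q3]
  have A: "4 * real q / real (card edges) \<le> 16 * \<epsilon> * \<Delta>_up n / sum_low n"
  proof -
    have "4 * real q / real (card edges) \<le> 4 * (2 * (\<epsilon> * \<Delta>_up n)) / (sum_low n / 2)"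
    proof (rule frac_le)
      have "\<epsilon> * ?\<Delta> \<le> \<epsilon> * \<Delta>_up n" using max_deg_le \<epsilon> by (intro mult_left_mono) auto
      then show "4 * real q \<le> 4 * (2 * (\<epsilon> * \<Delta>_up n))" using q2 by linarith
      then show "0 \<le> 4 * (2 * (\<epsilon> * \<Delta>_up n))" by (rule order_trans[rotated]) simp
    qed (use edges sum0 in auto)
    then show ?thesis by simp
  qed
  have q3': "(\<epsilon> * ?\<Delta> / 2) ^ 3 \<le> real q ^ 3" using q1 \<epsilon> \<Delta>0 by (intro power_mono) auto
  have B: "8 * ?S / (c * real q ^ 3) \<le> 64 * sq_up n / (c * \<epsilon> ^ 3 * \<Delta>_low n ^ 3)"
  proof -
    have "8 * ?S / (c * real q ^ 3) \<le> 8 * sq_up n / (c * (\<epsilon> * \<Delta>_low n / 2) ^ 3)"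
    proof (rule frac_le)
      have "(\<epsilon> * \<Delta>_low n / 2) ^ 3 \<le> (\<epsilon> * ?\<Delta> / 2) ^ 3"
        using max_deg_ge \<epsilon> low by (intro power_mono divide_right_mono mult_left_mono) auto
      then show "c * (\<epsilon> * \<Delta>_low n / 2) ^ 3 \<le> c * real q ^ 3" using q3' c by (intro mult_left_mono) auto
    qed (use S0 S1 c \<epsilon> low in auto)
    also have "\<dots> = 64 * sq_up n / (c * \<epsilon> ^ 3 * \<Delta>_low n ^ 3)" by (simp add: power_mult_distrib power_divide)
    finally show ?thesis .
  qed
  have D: "t * ?\<Delta> * ?S / (c * real q ^ 3) \<le> 8 * t * sq_up n / (c * \<epsilon> ^ 3 * (\<Delta>_low n)\<^sup>2)"
  proof -
    have "t * ?\<Delta> * ?S / (c * real q ^ 3) \<le> t * ?\<Delta> * ?S / (c * (\<epsilon> * ?\<Delta> / 2) ^ 3)"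
      using q3' q3 c \<epsilon> \<Delta>0 t S0 by (intro divide_left_mono mult_left_mono mult_pos_pos) auto
    \<comment> \<open>The threshold puts the maximum degree into the numerator, so one factor is
      cancelled before the lower bound is inserted.\<close>
    also have "\<dots> = 8 * t * ?S / (c * \<epsilon> ^ 3 * ?\<Delta>\<^sup>2)"
    proof -
      have eq: "(\<epsilon> * ?\<Delta> / 2) ^ 3 = ?\<Delta> * (\<epsilon> ^ 3 * ?\<Delta>\<^sup>2 / 8)"
        by (simp add: power2_eq_square power3_eq_cube)
      show ?thesis unfolding eq using \<Delta>0 by (simp add: mult_ac)
    qed
    also have "\<dots> \<le> 8 * t * sq_up n / (c * \<epsilon> ^ 3 * (\<Delta>_low n)\<^sup>2)"
      using S0 S1 t c \<epsilon> low max_deg_ge by (intro frac_le mult_left_mono power_mono) auto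
    finally show ?thesis .
  qed
  have F: "?S\<^sup>2 / ((t * ?\<Delta>) ^ 4 * c * real q) \<le> 2 * (sq_up n)\<^sup>2 / (t ^ 4 * c * \<epsilon> * \<Delta>_low n ^ 5)"
  proof -
    have "?S\<^sup>2 / ((t * ?\<Delta>) ^ 4 * c * real q) \<le> (sq_up n)\<^sup>2 / ((t * \<Delta>_low n) ^ 4 * c * (\<epsilon> * \<Delta>_low n / 2))"
    proof (rule frac_le)
      show "?S\<^sup>2 \<le> (sq_up n)\<^sup>2" using S0 S1 by (intro power_mono) auto
      have "\<epsilon> * \<Delta>_low n / 2 \<le> \<epsilon> * ?\<Delta> / 2" using max_deg_ge \<epsilon> by (intro divide_right_mono mult_left_mono) auto
      then have "\<epsilon> * \<Delta>_low n / 2 \<le> real q" using q1 by linarith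
      moreover have "(t * \<Delta>_low n) ^ 4 \<le> (t * ?\<Delta>) ^ 4"
        using max_deg_ge t low by (intro power_mono mult_left_mono) auto
      ultimately show "(t * \<Delta>_low n) ^ 4 * c * (\<epsilon> * \<Delta>_low n / 2) \<le> (t * ?\<Delta>) ^ 4 * c * real q"
        using c \<epsilon> low by (intro mult_mono mult_right_mono) auto
    qed (use t low c \<epsilon> in auto)
    also have "\<dots> = 2 * (sq_up n)\<^sup>2 / (t ^ 4 * c * \<epsilon> * \<Delta>_low n ^ 5)"
      by (simp add: power_mult_distrib eval_nat_numeral mult_ac)
    finally show ?thesis .
  qed
  show ?thesis using main A B D F by linarith
qed

text \<open>Were two arcs to meet, the hubs would be within two arc lengths of each other, less than
  their separation. A hub is no leaf, as their radii differ.\<close>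

lemma leaves_disjoint:
  assumes v: "v \<in> hubs" "v' \<in> hubs" "v \<noteq> v'"
  shows "insert v (leaves v) \<inter> insert v' (leaves v') = {}"
proof -
  have small: "20 * arc_len v \<le> sep_angle n" if "v \<in> P" for v
    using depth_less[OF that] by (simp add: arc_len_def sep_angle_def depth_def)
  have no: "v \<notin> leaves v'" if "v \<in> hubs" "v' \<in> hubs" for v v'
    using leaves_fst[OF hubs_D(1)[OF that(2)] hubs_D(2)[OF that(2)], of v] hubs_D(2)[OF that(1)] R_ge by auto
  have "p \<notin> leaves v'" if "p \<in> leaves v" for p
  proof
    assume "p \<in> leaves v'"
    then have "\<bar>snd v - snd v'\<bar> \<le> arc_len v + arc_len v'"
      using leaves_snd[OF hubs_D(1)[OF v(1)] hubs_D(2)[OF v(1)] that] leaves_snd[OF hubs_D(1)[OF v(2)] hubs_D(2)[OF v(2)], of p] by linarith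
    also have "\<dots> \<le> sep_angle n"
      using small[OF hubs_D(1)[OF v(1)]] small[OF hubs_D(1)[OF v(2)]] sep_angle_def[of n]
        exp_gt_zero[of "(max_depth n - R n) / 2"] by linarith
    finally have "near_angle (sep_angle n) (snd v) (snd v')" by (simp add: near_angle_def)
    then show False
      using separated[of v v'] v depths by (auto simp: hubs_def)
  qed
  then show ?thesis using v no by auto
qed


text \<open>A vertex as deep as \<open>sep_depth n\<close> is so far from the hub in angle that it
  misses the whole arc; the reach of any other vertex is bounded through
  \<open>sep_depth n\<close>.\<close>

lemma card_adj_hub_leaves_le:
  assumes v: "v \<in> hubs" and x: "x \<in> P" "x \<noteq> v"
  shows "real (card {p \<in> leaves v. adj x p}) \<le> leaf_mult n"
proof (cases "sep_depth n \<le> depth x")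
  case True
  have "\<not> adj x p" if p: "p \<in> leaves v" for p
  proof
    assume "adj x p"
    then have "near_angle (16 * exp (- fst x / 2)) (snd p) (snd x)"
      by (rule near_leaves[OF hubs_D(1)[OF v] hubs_D(2)[OF v] x(1) p])
    then have "near_angle (16 * exp (- fst x / 2) + arc_len v) (snd v) (snd x)"
      by (rule near_angle_trans_abs) (use leaves_snd[OF hubs_D(1)[OF v] hubs_D(2)[OF v] p] in \<open>simp add: abs_minus_commute\<close>)
    then have "near_angle (sep_angle n) (snd v) (snd x)"
    proof (rule near_angle_mono)
      have "exp (- fst x / 2) \<le> exp ((max_depth n - R n) / 2)" "arc_len v \<le> exp ((max_depth n - R n) / 2)"
        using depth_less[OF x(1)] depth_less[OF hubs_D(1)[OF v]] by (auto simp: depth_def arc_len_def)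
      then show "16 * exp (- fst x / 2) + arc_len v \<le> sep_angle n"
        using exp_gt_zero[of "(max_depth n - R n) / 2"] unfolding sep_angle_def by linarith
    qed
    then show False using separated[of v x] v x True depths by (auto simp: hubs_def)
  qed
  then have "{p \<in> leaves v. adj x p} = {}" by auto
  then show ?thesis using width_pos by (simp only: card.empty) (simp add: leaf_mult_def)
next
  case False
  have "exp (- fst x / 2) / cell_width n \<le> exp ((sep_depth n - R n) / 2) / cell_width n"
    using False width_pos by (intro divide_right_mono) (auto simp: depth_def)
  then show ?thesis
    using card_adj_leaves_le[OF hubs_D(1)[OF v] hubs_D(2)[OF v] x(1)] by (simp add: leaf_mult_def)
qed

text \<open>Leaves have depth at most 1 and so degree \<open>O(ln n)\<close>. The hypothesis
  \<open>many\<close> makes the hubs outnumber this by the factor 8 of the blocking estimate, the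
  reason for the exponent \<open>1 + \<tau>\<close> in their number.\<close>

lemma rctid_never:
  assumes many: "64 * max (deg_const * exp (1 / 2)) (L n) \<le> L n powr (1 + \<tau>) / 4"
    and q: "real q \<le> Q"
  shows "1 - (2 powr (- (L n powr (1 + \<tau>) / 4)) + Q * (exp (- \<Delta>_low n / (8 * leaf_mult n)) + exp (- \<Delta>_low n / (4 * Q))))
    \<le> rctid_random_prob P adj {..<q} (never_terminates P)"
proof -
  let ?D = "8 * max (deg_const * exp (1 / 2)) (L n)"
  have low: "0 < \<Delta>_low n" using width_pos by (simp add: \<Delta>_low_def)
  have b: "0 < leaf_mult n" using width_pos by (simp add: leaf_mult_def add_pos_pos)
  have main: "1 - 1 / 2 ^ card hubs - real (card {..<q}) * (exp (- \<Delta>_low n / (8 * leaf_mult n)) + exp (- \<Delta>_low n / (4 * real (card {..<q}))))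
     \<le> rctid_random_prob P adj {..<q} (never_terminates P)"
  proof (rule rctid_random_never_ge[where H = hubs and W = leaves and D = ?D])
    show "finite P" by (rule finite_P)
    show "adj w u" if "adj u w" for u w using that by (rule hyp_adj_sym)
    show "\<not> adj u u" for u by (rule hyp_adj_irrefl)
    show "hubs \<subseteq> P" "hubs \<noteq> {}" using hubs_D hubs_nonempty by auto
    show "adj u w" if "u \<in> hubs" "w \<in> hubs" "u \<noteq> w" for u w
      using hubs_D[OF that(1)] hubs_D[OF that(2)] P_D(1) that(3) by (intro hyp_adj_of_radii) auto
    fix v assume v: "v \<in> hubs"
    note vv = hubs_D(1)[OF v] hubs_D(2)[OF v]
    show "leaves v \<subseteq> P" by (rule leaves_subset[OF vv])
    show "adj v w" if "w \<in> leaves v" for w using leaves_adj[OF vv that] .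
    show "\<not> adj w w'" if "w \<in> leaves v" "w' \<in> leaves v" for w w' using leaves_independent[OF vv that] .
    show "\<Delta>_low n \<le> real (card (leaves v))" using card_leaves_ge[OF vv] hub_low[OF v] by linarith
    show "real (card {w \<in> leaves v. adj x w}) \<le> leaf_mult n" if "x \<in> P" "x \<noteq> v" for x
      by (rule card_adj_hub_leaves_le[OF v that])
    show "deg w \<le> ?D" if w: "w \<in> leaves v" for w
    proof -
      have wP: "w \<in> P" using leaves_subset[OF vv] w by auto
      have "depth w \<le> 1" using leaves_fst[OF vv w] by (simp add: depth_def)
      then have "8 * max (deg_const * exp (depth w / 2)) (L n) \<le> ?D"
        using deg_const_pos by (intro mult_left_mono max.mono) auto
      then show ?thesis using deg_le[OF wP] by linarith
    qed
  next
    show "insert v (leaves v) \<inter> insert v' (leaves v') = {}" if "v \<in> hubs" "v' \<in> hubs" "v \<noteq> v'" for v v'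
      using leaves_disjoint[OF that] .
    show "8 * ?D \<le> real (card hubs)" using many card_hubs by linarith
  qed (use b in auto)
  have "1 / 2 ^ card hubs = 2 powr (- real (card hubs))"
    by (simp add: powr_minus powr_realpow inverse_eq_divide)
  also have "\<dots> \<le> 2 powr (- (L n powr (1 + \<tau>) / 4))"
    using card_hubs by (intro powr_mono) auto
  finally have 1: "1 / 2 ^ card hubs \<le> 2 powr (- (L n powr (1 + \<tau>) / 4))" .
  have Q0: "0 \<le> Q" using q by (rule order_trans[rotated]) simp
  have 2: "real q * (exp (- \<Delta>_low n / (8 * leaf_mult n)) + exp (- \<Delta>_low n / (4 * real q)))
      \<le> Q * (exp (- \<Delta>_low n / (8 * leaf_mult n)) + exp (- \<Delta>_low n / (4 * Q)))"
  proof (cases "q = 0")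
    case True
    then show ?thesis using Q0 by (simp add: add_nonneg_nonneg)
  next
    case False
    then have "\<Delta>_low n / (4 * Q) \<le> \<Delta>_low n / (4 * real q)"
      using q low by (intro divide_left_mono) auto
    then show ?thesis using q by (intro mult_mono add_mono) auto
  qed
  show ?thesis using main 1 2 by simp
qed

end

section \<open>Asymptotics\<close>

context hrg_parameters
begin

text \<open>Half of the gap \<open>3 / 2 - \<alpha> - 1 / (2 * \<alpha>)\<close> between the
  exponents of the edge bound and of the number of colours. The cap \<open>1 / 20\<close> stays
  below the \<open>1 / 16\<close> of the degree threshold.\<close>

definition rate :: real where "rate = min ((2 * \<alpha> - 1) * (1 - \<alpha>) / (4 * \<alpha>)) (1 / 20)"

lemma rate_pos: "0 < rate"
  using \<alpha>_gt \<alpha>_lt by (simp add: rate_def)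

lemma rate_bound: "1 / \<alpha> / 2 + \<alpha> + rate < 3 / 2"
proof -
  have "rate \<le> (2 * \<alpha> - 1) * (1 - \<alpha>) / (4 * \<alpha>)" by (simp add: rate_def)
  also have "\<dots> < (2 * \<alpha> - 1) * (1 - \<alpha>) / (2 * \<alpha>)"
    using \<alpha>_gt \<alpha>_lt by (intro divide_strict_left_mono) auto
  also have "\<dots> = 3 / 2 - \<alpha> - 1 / \<alpha> / 2"
    using \<alpha>_gt by (simp add: field_simps)
  finally show ?thesis by simp
qed

lemma rate_le: "rate \<le> 1 / 20"
  by (simp add: rate_def)

lemmas bound_defs = \<Delta>_low_def \<Delta>_up_def sq_up_def sum_low_def leaf_mult_def

text \<open>With \<open>1 / \<alpha>\<close> and \<open>deg_const\<close> as opaque parameters, the signs of all exponents occurring below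
  follow from linear facts, as \<open>real_asymp\<close> needs them.\<close>

context
  fixes b d :: real
  assumes b: "b = 1 / \<alpha>" and d: "d = deg_const"
begin

lemma b_bounds: "1 < b" "b < 2" using \<alpha>_gt \<alpha>_lt by (auto simp: b field_simps)

lemma d_pos: "0 < d" using deg_const_pos by (simp add: d)

lemma depth_eqs: "max_depth n = (L n + \<tau> * ln (L n)) * b" "hub_depth n = (L n - (1 + \<tau>) * ln (L n)) * b"
  by (simp_all add: max_depth_def hub_depth_def b)

lemmas unfold_all = bound_defs d[symmetric] sep_depth_def depth_eqs cell_width_def L_def R_def hrg_radius_def

text \<open>Here and in the three further estimates of the first part the right-hand side is a
  quarter of a negative power of \<open>n\<close>, since four error terms are added.\<close>

lemma error_no_conflict:
  assumes "0 < \<epsilon>"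
  shows "\<forall>\<^sub>F n in sequentially. 16 * \<epsilon> * \<Delta>_up n / sum_low n \<le> real n powr - rate / 4"
  unfolding unfold_all using assms b_bounds d_pos rate_bound[folded b] \<alpha>_gt \<alpha>_lt by real_asymp

text \<open>The logarithms lost in \<open>\<Delta>_low\<close>: \<open>(1 + \<tau>) * b / 2\<close>
  through the hub depth and 1 through the cell width.\<close>

definition \<sigma> :: real where "\<sigma> = (1 + \<tau>) * b / 2 + 1"

lemma powr_eq_exp: "1 \<le> L n \<Longrightarrow> real n powr x = exp (x * L n)" "1 \<le> L n \<Longrightarrow> ln (real n) powr x = exp (x * ln (L n))"
  using n_pos[of n] by (auto simp: powr_def L_def)

lemma exp_depth_div_width:
  assumes L: "1 \<le> L n"
  shows "exp ((x - R n) / 2) / cell_width n = exp (- C / 2) / 64 * exp (x / 2 - ln (L n))"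
proof -
  have "exp ((x - R n) / 2) = exp (x / 2) * exp (- R n / 2)"
    by (simp add: mult_exp_exp field_simps)
  also have "\<dots> = exp (x / 2) * (exp (- C / 2) / real n)"
    by (simp only: exp_half_R[OF L])
  finally have 1: "exp ((x - R n) / 2) = exp (x / 2) * (exp (- C / 2) / real n)" .
  have 2: "exp (x / 2 - ln (L n)) = exp (x / 2) / L n"
    using L by (simp add: exp_diff)
  show ?thesis
    unfolding 1 2 using L n_pos[OF L] by (simp add: cell_width_def)
qed

lemma low_eq:
  assumes L: "1 \<le> L n"
  shows "\<Delta>_low n = exp (- C / 2) / 256 * (real n powr (b / 2) * ln (real n) powr - \<sigma>)"
proof -
  have "hub_depth n / 2 - ln (L n) = b / 2 * L n + - \<sigma> * ln (L n)"
    by (simp add: depth_eqs \<sigma>_def field_simps)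
  then have "exp ((hub_depth n - R n) / 2) / cell_width n = exp (- C / 2) / 64 * exp (b / 2 * L n + - \<sigma> * ln (L n))"
    by (simp only: exp_depth_div_width[OF L])
  moreover have "\<Delta>_low n = exp ((hub_depth n - R n) / 2) / cell_width n / 4"
    by (simp add: \<Delta>_low_def)
  ultimately show ?thesis
    by (simp only: powr_eq_exp[OF L] mult_exp_exp)
qed

lemma exp_max_eq:
  assumes L: "1 \<le> L n"
  shows "exp (max_depth n) = real n powr b * ln (real n) powr (\<tau> * b)"
    "exp (max_depth n / 2) = real n powr (b / 2) * ln (real n) powr (\<tau> * b / 2)"
  by (simp_all add: powr_eq_exp[OF L] mult_exp_exp depth_eqs field_simps)

lemma leaf_eq:
  assumes L: "1 \<le> L n"
  shows "leaf_mult n = 3 / 4 * exp (- C / 2) * (real n powr (b / 2) * ln (real n) powr - (\<sigma> + 2)) + 6"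
proof -
  have "sep_depth n / 2 - ln (L n) = b / 2 * L n + - (\<sigma> + 2) * ln (L n)"
    by (simp add: sep_depth_def depth_eqs \<sigma>_def field_simps)
  then show ?thesis
    using exp_depth_div_width[OF L, of "sep_depth n"] by (simp add: leaf_mult_def powr_eq_exp[OF L] exp_add)
qed

lemma up_le:
  "\<forall>\<^sub>F n in sequentially. \<Delta>_up n \<le> 8 * (d + 1) * (real n powr (b / 2) * ln (real n) powr (\<tau> * b / 2))"
proof -
  have "\<forall>\<^sub>F n in sequentially. ln (real n) \<le> real n powr (b / 2) * ln (real n) powr (\<tau> * b / 2)"
    using b_bounds by real_asymp
  then show ?thesis
    using ev_L
  proof eventually_elim
    case (elim n)
    let ?X = "real n powr (b / 2) * ln (real n) powr (\<tau> * b / 2)"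
    have X: "0 \<le> ?X" by simp
    have m: "max (d * ?X) (L n) \<le> (d + 1) * ?X"
      using elim X d_pos mult_nonneg_nonneg[of d ?X] unfolding distrib_right L_def
      by (intro max.boundedI) linarith+
    then show ?case
      unfolding \<Delta>_up_def d[symmetric] exp_max_eq(2)[OF elim(2)]
      using mult_left_mono[OF m, of 8] by (simp only: mult.assoc zero_le_numeral)
  qed
qed

context
  fixes A \<epsilon> c K s U :: real
  assumes A: "0 < A" "0 < \<epsilon>" "0 < c" "0 < K" "0 < s" "0 < U"
begin

lemma ev_degree_large:
  "\<forall>\<^sub>F n in sequentially. 4 \<le> \<epsilon> * (A * (real n powr (b / 2) * ln (real n) powr - s))"
  using b_bounds A by real_asymp

lemma error_palettes:
  "\<forall>\<^sub>F n in sequentially. 64 * (64 * (d + ln (real n))\<^sup>2 * ((2 * ln (real n) + C + 1) * (8 * exp 1 * (7 + ln (real n)) *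
      (real n powr b * ln (real n) powr (\<tau> * b))))) / (c * \<epsilon> ^ 3 * (A * (real n powr (b / 2) * ln (real n) powr - s)) ^ 3) \<le> real n powr (- 1 / 20) / 4"
  using A b_bounds by real_asymp

text \<open>Up to logarithms the degree sum is the square of \<Delta>, so the threshold
  \<open>\<Delta> * n powr (- 1 / 16)\<close> leaves about \<open>n powr (1 / 4) / \<Delta>\<close>,
  where \<Delta> has an exponent above \<open>1 / 2\<close>.\<close>

lemma error_hub_pairs:
  "\<forall>\<^sub>F n in sequentially. 2 * (64 * (d + ln (real n))\<^sup>2 * ((2 * ln (real n) + C + 1) * (8 * exp 1 * (7 + ln (real n)) *
      (real n powr b * ln (real n) powr (\<tau> * b)))))\<^sup>2 / ((real n powr (- 1 / 16)) ^ 4 * c * \<epsilon> * (A * (real n powr (b / 2) * ln (real n) powr - s)) ^ 5) \<le> real n powr (- 1 / 20) / 4"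
  using A b_bounds by real_asymp

text \<open>The threshold factor \<open>n powr (- 1 / 16)\<close> is all that is gained here; the
  step from \<open>1 / 16\<close> to \<open>1 / 20\<close> pays for the logarithms.\<close>

lemma error_low_degree_pairs:
  "\<forall>\<^sub>F n in sequentially. 8 * (real n powr (- 1 / 16)) * (64 * (d + ln (real n))\<^sup>2 * ((2 * ln (real n) + C + 1) * (8 * exp 1 * (7 + ln (real n)) *
      (real n powr b * ln (real n) powr (\<tau> * b))))) / (c * \<epsilon> ^ 3 * (A * (real n powr (b / 2) * ln (real n) powr - s))\<^sup>2) \<le> real n powr (- 1 / 20) / 4"
  using A b_bounds by real_asymp

text \<open>The quotient in the exponent is of order \<open>ln n\<close> squared, which exceeds the
  demanded \<open>ln n powr (1 + \<tau> / 2)\<close> and absorbs the polynomial prefactor.\<close>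

lemma error_blocked:
  "\<forall>\<^sub>F n in sequentially. (U * (real n powr (b / 2) * ln (real n) powr (\<tau> * b / 2)) / ln (real n) ^ 3) *
     exp (- (A * (real n powr (b / 2) * ln (real n) powr - s)) / (8 * (K * (real n powr (b / 2) * ln (real n) powr - (s + 2)) + 6)))
     \<le> real n powr - (ln (real n) powr (\<tau> / 2)) / 4"
  using A b_bounds \<tau>_pos \<tau>_less by real_asymp

lemma error_missed:
  assumes g: "1 + \<tau> / 2 < g"
  shows "\<forall>\<^sub>F n in sequentially. (U * (real n powr (b / 2) * ln (real n) powr (\<tau> * b / 2)) / ln (real n) ^ 3) *
     exp (- (A * ln (real n) powr g)) \<le> real n powr - (ln (real n) powr (\<tau> / 2)) / 4"
  using A b_bounds \<tau>_pos \<tau>_less g by real_asymp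

end

text \<open>The hubs give an exponent of order \<open>L n powr (1 + \<tau>)\<close>; halving \<tau>
  in the target absorbs the constants.\<close>

lemma error_ids: "\<forall>\<^sub>F n in sequentially. 2 powr (- (L n powr (1 + \<tau>) / 4)) \<le> real n powr - (ln (real n) powr (\<tau> / 2)) / 2"
  unfolding L_def using \<tau>_pos by real_asymp

text \<open>The place where the exponent 3 of the logarithm is used. Clearing denominators leaves
  \<open>1 + 2 * \<tau> + \<alpha> * \<tau> < 2 * \<alpha>\<close>, which by
  \<open>1 + 4 * \<tau> = 2 * \<alpha>\<close> reduces to
  \<open>\<alpha> * \<tau> < 2 * \<tau>\<close>.\<close>

lemma exponent_gap: "1 + \<tau> / 2 < 3 - \<sigma> - \<tau> * b / 2"
proof -
  have "1 + 2 * \<tau> + \<alpha> * \<tau> < 2 * \<alpha>"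
    using \<tau>_\<alpha> \<tau>_pos \<alpha>_lt mult_strict_right_mono[of \<alpha> 2 \<tau>] by linarith
  then have "(1 + 2 * \<tau>) * b / 2 + \<tau> / 2 < 1"
    using \<alpha>_gt by (simp add: b field_simps)
  then show ?thesis by (simp add: \<sigma>_def field_simps)
qed

lemma \<sigma>_pos: "0 < \<sigma>"
  using \<tau>_pos b_bounds by (simp add: \<sigma>_def add_pos_pos)

lemma part1_error:
  assumes \<epsilon>: "0 < \<epsilon>" and c: "0 < c"
  shows "\<forall>\<^sub>F n in sequentially. 4 \<le> \<epsilon> * \<Delta>_low n \<and>
    16 * \<epsilon> * \<Delta>_up n / sum_low n + 64 * sq_up n / (c * \<epsilon> ^ 3 * \<Delta>_low n ^ 3)
      + 2 * (sq_up n)\<^sup>2 / ((real n powr (- 1 / 16)) ^ 4 * c * \<epsilon> * \<Delta>_low n ^ 5)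
      + 8 * (real n powr (- 1 / 16)) * sq_up n / (c * \<epsilon> ^ 3 * (\<Delta>_low n)\<^sup>2) \<le> real n powr - rate"
proof -
  have A: "0 < exp (- C / 2) / 256" by simp
  note hyps = A \<epsilon> c zero_less_one \<sigma>_pos zero_less_one
  show ?thesis
    using ev_degree_large[OF hyps] error_no_conflict[OF \<epsilon>] error_palettes[OF hyps] error_hub_pairs[OF hyps] error_low_degree_pairs[OF hyps] ev_L
  proof eventually_elim
    case (elim n)
    have R: "R n = 2 * ln (real n) + C" by (simp add: R_def hrg_radius_def)
    have Ln: "L n = ln (real n)" by (simp add: L_def)
    have sq: "sq_up n = 64 * (d + ln (real n))\<^sup>2 * ((2 * ln (real n) + C + 1) * (8 * exp 1 * (7 + ln (real n)) *
        (real n powr b * ln (real n) powr (\<tau> * b))))"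
      unfolding sq_up_def d[symmetric] exp_max_eq(1)[OF elim(6)] unfolding R Ln ..
    have "1 \<le> real n" using n_pos[OF elim(6)] by simp
    then have "real n powr (- 1 / 20) \<le> real n powr - rate"
      using rate_le by (intro powr_mono) auto
    then show ?case
      using elim(1-5) unfolding sq low_eq[OF elim(6)] by linarith
  qed
qed

lemma part2_error:
  fixes K :: real
  defines "Q \<equiv> \<lambda>n. K * (8 * (d + 1)) * (real n powr (b / 2) * ln (real n) powr (\<tau> * b / 2)) / ln (real n) ^ 3"
  assumes K: "0 < K"
  shows "\<forall>\<^sub>F n in sequentially. K * (\<Delta>_up n / ln (real n) ^ 3) \<le> Q n \<and>
    2 powr (- (L n powr (1 + \<tau>) / 4)) + Q n * (exp (- \<Delta>_low n / (8 * leaf_mult n)) + exp (- \<Delta>_low n / (4 * Q n)))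
      \<le> real n powr - (ln (real n) powr (\<tau> / 2))"
proof -
  let ?U = "K * (8 * (d + 1))" and ?A = "exp (- C / 2) / 256" and ?K = "3 / 4 * exp (- C / 2)"
  have U: "0 < ?U" using K d_pos by simp
  have A: "0 < ?A" and K0: "0 < ?K" by simp_all
  have A': "0 < ?A / (4 * ?U)" using A U by simp
  note blocked = error_blocked[OF A zero_less_one zero_less_one K0 \<sigma>_pos U]
  note missed = error_missed[OF A' zero_less_one zero_less_one zero_less_one zero_less_one U exponent_gap]
  show ?thesis
    using up_le error_ids blocked missed ev_L
  proof eventually_elim
    case (elim n)
    let ?l = "ln (real n)"
    have l: "1 \<le> ?l" using elim(5) by (simp add: L_def)
    have n: "0 < real n" using n_pos[OF elim(5)] by simp
    have n1: "Suc 0 < n" using l n by (cases "n = 1") auto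
    have "K * (\<Delta>_up n / ?l ^ 3) \<le> K * ((8 * (d + 1) * (real n powr (b / 2) * ?l powr (\<tau> * b / 2))) / ?l ^ 3)"
      using elim(1) K l by (intro mult_left_mono divide_right_mono) auto
    then have 1: "K * (\<Delta>_up n / ?l ^ 3) \<le> Q n" by (simp add: Q_def mult.assoc)
    \<comment> \<open>Leaves per colour: three logarithms from the number of colours, less \<sigma>
      from the hubs, less \<open>\<tau> * b / 2\<close> from the upper bound on the maximum
      degree.\<close>
    have e: "\<Delta>_low n / (4 * Q n) = ?A / (4 * ?U) * ?l powr (3 - \<sigma> - \<tau> * b / 2)"
    proof -
      have "?l powr (3 - \<sigma> - \<tau> * b / 2) = ?l powr 3 * ?l powr - \<sigma> / ?l powr (\<tau> * b / 2)"
        by (simp add: powr_add[symmetric] powr_diff[symmetric])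
      also have "?l powr 3 = ?l ^ 3" using l by (simp add: powr_numeral)
      finally have eq: "?l powr (3 - \<sigma> - \<tau> * b / 2) = ?l ^ 3 * ?l powr - \<sigma> / ?l powr (\<tau> * b / 2)" .
      have "(a * (x * y)) / (4 * (u * (x * z) / t)) = a / (4 * u) * (t * y / z)"
        if "0 < x" "0 < z" "0 < t" "0 < u" for a x y z t u :: real
        using that by (simp add: field_simps)
      then show ?thesis
        unfolding low_eq[OF elim(5)] Q_def eq by this (use l n n1 U in auto)
    qed
    have 3: "Q n * exp (- \<Delta>_low n / (8 * leaf_mult n)) \<le> real n powr - (?l powr (\<tau> / 2)) / 4"
      using elim(3) unfolding low_eq[OF elim(5)] leaf_eq[OF elim(5)] Q_def .
    have 4: "Q n * exp (- \<Delta>_low n / (4 * Q n)) \<le> real n powr - (?l powr (\<tau> / 2)) / 4"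
      using elim(4) unfolding minus_divide_left[symmetric] e unfolding Q_def .
    show ?case
      using 1 elim(2) 3 4 by (simp add: distrib_left)
  qed
qed

lemma ev_enough_hubs: "\<forall>\<^sub>F n in sequentially. 64 * max (d * exp (1 / 2)) (L n) \<le> L n powr (1 + \<tau>) / 4"
  unfolding L_def using d_pos \<tau>_pos by real_asymp

end
end

section \<open>Transfer to the random graph\<close>

context hrg
begin

lemma prob_space_M: "prob_space (M n)"
  using ppp[of n] by (simp add: poisson_point_process_def)

lemma ev_width: "\<forall>\<^sub>F n in sequentially. 6 * cell_width n \<le> exp (- R n / 4) \<and> 9 * exp ((2 - R n) / 2) < cell_width n"
proof (rule eventually_conj)
  show "\<forall>\<^sub>F n in sequentially. 6 * cell_width n \<le> exp (- R n / 4)"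
    unfolding cell_width_def L_def R_def hrg_radius_def by real_asymp
  show "\<forall>\<^sub>F n in sequentially. 9 * exp ((2 - R n) / 2) < cell_width n"
    unfolding cell_width_def L_def R_def hrg_radius_def by real_asymp
qed

definition typical_counts :: "nat \<Rightarrow> point set \<Rightarrow> bool" where
  "typical_counts n P \<longleftrightarrow>
     card (P \<inter> ball n (max_depth n) {0..<2 * pi}) = 0 \<and>
     (\<forall>(k, i)\<in>{(k, i) \<in> layers n \<times> {..nat \<lceil>7 * exp (R n / 2)\<rceil>}. real i * layer_cell n k \<le> 2 * pi}.
       real (card (P \<inter> region n k i)) < 8 * max (deg_const * exp (real k / 2)) (L n)) \<and>
     (\<forall>k\<in>layers n. real (card (P \<inter> ball n (real k) {0..<2 * pi}))
       < 8 * max (real n * exp (- \<alpha> * real k) * (2 * pi)) (L n)) \<and>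
     (\<forall>i\<in>{i \<in> {..<n}. (real i + 1) * cell_width n \<le> 2 * pi}. 0 < card (P \<inter> cell n i)) \<and>
     real n * exp (- \<alpha> * (R n / 2)) / 4 \<le> real (card (P \<inter> ball n (R n / 2) {0..<2 * pi})) \<and>
     L n powr (1 + \<tau>) / 4 \<le> real (card (P \<inter> ball n (hub_depth n) {0..<2 * pi})) \<and>
     card (P \<inter> ball n (sep_depth n) (sep_wrap n)) \<le> 1 \<and>
     (\<forall>i\<in>{..nat \<lceil>2 * pi / sep_angle n\<rceil>}. card (P \<inter> ball n (sep_depth n) (sep_cell n i)) \<le> 1)"

lemma aas_typical: "aas M (\<lambda>n \<omega>. typical \<alpha> C n (V n \<omega>))"
proof (rule aas_mono)
  note conj = aas_conj[OF prob_space_M]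
  show "aas M (\<lambda>n \<omega>. typical_counts n (V n \<omega>))"
    unfolding typical_counts_def
    by (intro conj aas_max_depth aas_regions aas_layers aas_cells aas_core aas_hubs aas_sep_wrap aas_sep_cells)
  show "\<forall>\<^sub>F n in sequentially. \<forall>\<omega>\<in>space (M n). typical_counts n (V n \<omega>) \<longrightarrow> typical \<alpha> C n (V n \<omega>)"
    using ev_L ev_R ev_depths ev_width
  proof eventually_elim
    case (elim n)
    have "finite (V n \<omega>) \<and> V n \<omega> \<subseteq> disk (R n)" if "\<omega> \<in> space (M n)" for \<omega>
      using ppp[of n] that by (simp add: poisson_point_process_def space_hrg_intensity R_def)
    then show ?case
      using elim by (intro ballI impI typical.intro hrg_parameters_axioms typical_axioms.intro)
        (auto simp: typical_counts_def)
  qed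
qed

lemma aas_exactly_2:
  assumes \<epsilon>: "0 < \<epsilon>"
  shows "aas M (\<lambda>n \<omega>. \<forall>ident q.
    inj_on ident (V n \<omega>) \<longrightarrow>
    q \<in> {nat \<lfloor>\<epsilon> * real (max_degree (V n \<omega>) (hyp_adj (R n)))\<rfloor>, nat \<lceil>\<epsilon> * real (max_degree (V n \<omega>) (hyp_adj (R n)))\<rceil>} \<longrightarrow>
    rctid_prob (V n \<omega>) (hyp_adj (R n)) {..<q} ident (terminates_after_exactly (V n \<omega>) 2)
      \<ge> 1 - 1 * real n powr - rate)"
proof (rule aas_mono[OF aas_typical])
  have c: "0 < exp (- 4 / \<epsilon>) / 2" by simp
  show "\<forall>\<^sub>F n in sequentially. \<forall>\<omega>\<in>space (M n). typical \<alpha> C n (V n \<omega>) \<longrightarrow> (\<forall>ident q.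
    inj_on ident (V n \<omega>) \<longrightarrow>
    q \<in> {nat \<lfloor>\<epsilon> * real (max_degree (V n \<omega>) (hyp_adj (R n)))\<rfloor>, nat \<lceil>\<epsilon> * real (max_degree (V n \<omega>) (hyp_adj (R n)))\<rceil>} \<longrightarrow>
    rctid_prob (V n \<omega>) (hyp_adj (R n)) {..<q} ident (terminates_after_exactly (V n \<omega>) 2)
      \<ge> 1 - 1 * real n powr - rate)"
    using part1_error[OF refl refl \<epsilon> c] ev_L
  proof eventually_elim
    case (elim n)
    have t: "0 < real n powr (- 1 / 16)" using n_pos[OF elim(2)] by simp
    show ?case
    proof (intro ballI impI allI)
      fix \<omega> and ident :: "point \<Rightarrow> nat" and q assume ty: "typical \<alpha> C n (V n \<omega>)" and inj: "inj_on ident (V n \<omega>)"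
        and q: "q \<in> {nat \<lfloor>\<epsilon> * real (max_degree (V n \<omega>) (hyp_adj (R n)))\<rfloor>, nat \<lceil>\<epsilon> * real (max_degree (V n \<omega>) (hyp_adj (R n)))\<rceil>}"
      from typical.rctid_exactly_2[OF ty inj \<epsilon> conjunct1[OF elim(1)] q t] conjunct2[OF elim(1)]
      show "1 - 1 * real n powr - rate \<le>
          rctid_prob (V n \<omega>) (hyp_adj (R n)) {..<q} ident (terminates_after_exactly (V n \<omega>) 2)"
        by linarith
    qed
  qed
qed

lemma aas_never:
  assumes K: "0 < K"
  shows "aas M (\<lambda>n \<omega>. \<forall>q. real q \<le> K * (real (max_degree (V n \<omega>) (hyp_adj (R n))) / ln (real n) ^ 3) \<longrightarrow>
    rctid_random_prob (V n \<omega>) (hyp_adj (R n)) {..<q} (never_terminates (V n \<omega>))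
      \<ge> 1 - real n powr - (ln (real n) powr (\<tau> / 2)))"
proof (rule aas_mono[OF aas_typical])
  show "\<forall>\<^sub>F n in sequentially. \<forall>\<omega>\<in>space (M n). typical \<alpha> C n (V n \<omega>) \<longrightarrow>
    (\<forall>q. real q \<le> K * (real (max_degree (V n \<omega>) (hyp_adj (R n))) / ln (real n) ^ 3) \<longrightarrow>
    rctid_random_prob (V n \<omega>) (hyp_adj (R n)) {..<q} (never_terminates (V n \<omega>))
      \<ge> 1 - real n powr - (ln (real n) powr (\<tau> / 2)))"
    using part2_error[OF refl refl K] ev_enough_hubs[OF refl refl] ev_L
  proof eventually_elim
    case (elim n)
    show ?case
    proof (intro ballI impI allI)
      fix \<omega> q assume ty: "typical \<alpha> C n (V n \<omega>)"
        and q: "real q \<le> K * (real (max_degree (V n \<omega>) (hyp_adj (R n))) / ln (real n) ^ 3)"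
      have "0 \<le> ln (real n) ^ 3" using elim(3) by (simp add: L_def)
      then have "K * (real (max_degree (V n \<omega>) (hyp_adj (R n))) / ln (real n) ^ 3) \<le> K * (\<Delta>_up n / ln (real n) ^ 3)"
        using typical.max_deg_le[OF ty] K by (intro mult_left_mono divide_right_mono) auto
      with q conjunct1[OF elim(1)] have "real q \<le> K * (8 * (deg_const + 1)) *
          (real n powr (1 / \<alpha> / 2) * ln (real n) powr (\<tau> * (1 / \<alpha>) / 2)) / ln (real n) ^ 3"
        by linarith
      from typical.rctid_never[OF ty elim(2) this] conjunct2[OF elim(1)]
      show "1 - real n powr - (ln (real n) powr (\<tau> / 2))
          \<le> rctid_random_prob (V n \<omega>) (hyp_adj (R n)) {..<q} (never_terminates (V n \<omega>))"
        by linarith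
    qed
  qed
qed

end

theorem theorem1p2:
  fixes \<alpha> C :: real
    and M :: "nat \<Rightarrow> 'w measure"
    and V :: "nat \<Rightarrow> 'w \<Rightarrow> point set"
    and E :: "nat \<Rightarrow> point \<Rightarrow> point \<Rightarrow> bool"
    and \<Delta> :: "nat \<Rightarrow> 'w \<Rightarrow> real"
  assumes "1 / 2 < \<alpha>" and "\<alpha> < 1"
    and "\<And>n. hyperbolic_random_graph \<alpha> C n (M n) (V n)"
    and "\<And>n. E n = hyp_adj (hrg_radius C n)"
    and "\<And>n \<omega>. \<Delta> n \<omega> = real (max_degree (V n \<omega>) (E n))"
  shows "(\<forall>\<epsilon>>0. \<exists>c>0. \<exists>K.
            aas M (\<lambda>n \<omega>. \<forall>ident q.
              inj_on ident (V n \<omega>) \<longrightarrow>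
              q \<in> {nat \<lfloor>\<epsilon> * \<Delta> n \<omega>\<rfloor>, nat \<lceil>\<epsilon> * \<Delta> n \<omega>\<rceil>} \<longrightarrow>
              rctid_prob (V n \<omega>) (E n) {..<q} ident (terminates_after_exactly (V n \<omega>) 2)
                \<ge> 1 - K * real n powr - c)) \<and>
         (\<forall>K>0. \<exists>f. filterlim f at_top sequentially \<and>
            aas M (\<lambda>n \<omega>. \<forall>q. real q \<le> K * (\<Delta> n \<omega> / ln (real n) ^ 3) \<longrightarrow>
              rctid_random_prob (V n \<omega>) (E n) {..<q} (never_terminates (V n \<omega>))
                \<ge> 1 - real n powr - f n))"
proof -
  interpret hrg \<alpha> C M V
    using assms(1-3) by unfold_locales
  have E: "E n = hyp_adj (R n)" for n
    by (simp add: assms(4) R_def)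
  show ?thesis
    unfolding assms(5) E
  proof (intro conjI allI impI)
    fix \<epsilon> :: real assume "0 < \<epsilon>"
    from aas_exactly_2[OF this] rate_pos
    show "\<exists>c>0. \<exists>K. aas M (\<lambda>n \<omega>. \<forall>ident q. inj_on ident (V n \<omega>) \<longrightarrow>
        q \<in> {nat \<lfloor>\<epsilon> * real (max_degree (V n \<omega>) (hyp_adj (R n)))\<rfloor>, nat \<lceil>\<epsilon> * real (max_degree (V n \<omega>) (hyp_adj (R n)))\<rceil>} \<longrightarrow>
        rctid_prob (V n \<omega>) (hyp_adj (R n)) {..<q} ident (terminates_after_exactly (V n \<omega>) 2)
          \<ge> 1 - K * real n powr - c)"
      by blast
  next
    fix K :: real assume "0 < K"
    have "filterlim (\<lambda>n. ln (real n) powr (\<tau> / 2)) at_top sequentially"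
      using \<tau>_pos by real_asymp
    with aas_never[OF \<open>0 < K\<close>]
    show "\<exists>f. filterlim f at_top sequentially \<and> aas M (\<lambda>n \<omega>. \<forall>q.
        real q \<le> K * (real (max_degree (V n \<omega>) (hyp_adj (R n))) / ln (real n) ^ 3) \<longrightarrow>
        rctid_random_prob (V n \<omega>) (hyp_adj (R n)) {..<q} (never_terminates (V n \<omega>)) \<ge> 1 - real n powr - f n)"
      by (intro exI[of _ "\<lambda>n. ln (real n) powr (\<tau> / 2)"] conjI)
  qed
qed

end
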